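(* An element $\tau\in B_\infty=\mathbb Z[e_1,e_2,\ldots]$ is a solution to the equation $$\mathrm{Res}_z\left(E_\infty(z)\,\sigma_-(z)\tau\otimes_{\mathbb Z}\frac1{E_\infty(z)}\,\overline\sigma_-(z)\tau\right)=0$$ (in $B_\infty\otimes_{\mathbb Z}B_\infty$) if and only if there exists $s\ge0$ such that $\tau \in B_r$ and $\phi_r(\tau)\in\mathcal G_r$ for all $r\ge s$.
   Context: $M_0$ is a free abelian group with basis $(b_0,b_1,\ldots)$; $b_k=0$ for $k<0$. $\mathcal P_r$ is the set of partitions $\lambda=(\lambda_1\ge\cdots\ge\lambda_r\ge0)$ of length at most $r$, $\mathcal P=\bigcup_r\mathcal P_r$. For $\lambda\in\mathcal P_r$, $[\mathbf b]^r_\lambda=b_{\lambda_r}\wedge b_{1+\lambda_{r-1}}\wedge\cdots\wedge b_{r-1+\lambda_1}$; these form a $\mathbb Z$-basis of $\bigwedge^rM_0$. $\mathcal G_r\subseteq\bigwedge^rM_0$ is the set of all $m_1\wedge\cdots\wedge m_r$ with $m_i\in M_0$. $B_r=\mathbb Z[e_1,\ldots,e_r]\subset B_\infty$, $E_r(z)=1-e_1z+\cdots+(-1)^re_rz^r$, and $H_r=(h_j)_{j\in\mathbb Z}$ is defined by $\sum_jh_jz^j=1/E_r(z)$. Likewise $E_\infty(z)=1+\sum_{i\ge1}(-1)^ie_iz^i\in B_\infty[[z]]$ and $H_\infty=(h_j)_{j\in\mathbb Z}$ is defined by $\sum_jh_jz^j=1/E_\infty(z)$. For a sequence $(c_j)_{j\in\mathbb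 Z}$ in a commutative ring and $\lambda\in\mathcal P_r$, $\Delta_\lambda((c_j))=\det(c_{\lambda_j-j+i})_{1\le i,j\le r}$ (for $H_\infty$ this does not depend on the choice of $r\ge\ell(\lambda)$). The $\Delta_\lambda(H_r)$, $\lambda\in\mathcal P_r$, form a $\mathbb Z$-basis of $B_r$, the $\Delta_\lambda(H_\infty)$, $\lambda\in\mathcal P$, a $\mathbb Z$-basis of $B_\infty$. $\phi_r:B_r\to\bigwedge^rM_0$ is the isomorphism of abelian groups $\Delta_\lambda(H_r)\mapsto[\mathbf b]^r_\lambda$. Every $\tau\in B_\infty$ belongs to $B_r$ for all sufficiently large $r$. On $\bigwedge M_0$, $\sigma_-(z)$ and $\overline\sigma_-(z)$ are the unique homomorphisms of $\wedge$-algebras $\bigwedge M_0\to\bigwedge M_0[[z^{-1}]]$ with $\sigma_-(z)b_j=\sum_{i\ge0}b_{j-i}z^{-i}$ and $\overline\sigma_-(z)b_j=b_j-b_{j-1}z^{-1}$. If $\sigma_-(z)[\mathbf b]^r_\lambda=\sum_\mu c_{\lambda\mu}(z^{-1})[\mathbf b]^r_\mu$, the coefficients do not depend on $r\geq \max(1,\ell(\lambda))$, and $\sigma_-(z):B_\infty\to B_\infty[z^{-1}]$ is the additive map $\Delta_\lambda(H_\infty)\mapsto\sum_\mu c_{\lambda\mu}(z^{-1})\Delta_\mu(H_\infty)$; $\overline\sigma_-(z):B_\infty\to B_\infty[z^{-1}]$ is defined in the same way from $\overline\sigma_-(z)[\mathbf b]^r_\lambda$. $\mathrm{Res}_z$ is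 the coefficient of $z^{-1}$ of a formal Laurent series; for Laurent series, $(\sum f_iz^i)\otimes(\sum g_jz^j)=\sum(f_i\otimes g_j)z^{i+j}$. *)

theory Defs
  imports
    "HOL-Library.Poly_Mapping"
    "HOL-Computational_Algebra.Polynomial_FPS"
    "HOL-Computational_Algebra.Formal_Laurent_Series"
    "Jordan_Normal_Form.Determinant"
begin

section \<open>The tensor product over the integers of two abelian groups\<close>

text \<open>
  The free abelian group on pairs, modulo the subgroup generated by the biadditivity relations.
\<close>

inductive_set tensor_rel :: "(('a::ab_group_add \<times> 'b::ab_group_add) \<Rightarrow>\<^sub>0 int) set" where
  zero: "0 \<in> tensor_rel"
| add: "x \<in> tensor_rel \<Longrightarrow> y \<in> tensor_rel \<Longrightarrow> x + y \<in> tensor_rel"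
| uminus: "x \<in> tensor_rel \<Longrightarrow> - x \<in> tensor_rel"
| left: "Poly_Mapping.single (a + a', b) 1 - Poly_Mapping.single (a, b) 1
           - Poly_Mapping.single (a', b) 1 \<in> tensor_rel"
| right: "Poly_Mapping.single (a, b + b') 1 - Poly_Mapping.single (a, b) 1
           - Poly_Mapping.single (a, b') 1 \<in> tensor_rel"

lemma tensor_rel_diff: "x \<in> tensor_rel \<Longrightarrow> y \<in> tensor_rel \<Longrightarrow> x - y \<in> tensor_rel"
  using tensor_rel.add[OF _ tensor_rel.uminus, of x y] by simp

definition tensor_eq ::
  "(('a::ab_group_add \<times> 'b::ab_group_add) \<Rightarrow>\<^sub>0 int) \<Rightarrow> (('a \<times> 'b) \<Rightarrow>\<^sub>0 int) \<Rightarrow> bool" where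
  "tensor_eq x y \<longleftrightarrow> x - y \<in> tensor_rel"

quotient_type (overloaded) ('a, 'b) tensor =
  "('a::ab_group_add \<times> 'b::ab_group_add) \<Rightarrow>\<^sub>0 int" / tensor_eq
proof (rule equivpI)
  show "reflp (tensor_eq :: ('a \<times> 'b \<Rightarrow>\<^sub>0 int) \<Rightarrow> _)"
    by (rule reflpI) (simp add: tensor_eq_def tensor_rel.zero)
  show "symp (tensor_eq :: ('a \<times> 'b \<Rightarrow>\<^sub>0 int) \<Rightarrow> _)"
    by (rule sympI) (metis tensor_eq_def tensor_rel.uminus minus_diff_eq)
  show "transp (tensor_eq :: ('a \<times> 'b \<Rightarrow>\<^sub>0 int) \<Rightarrow> _)"
  proof (rule transpI)
    fix x y z :: "'a \<times> 'b \<Rightarrow>\<^sub>0 int"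
    assume "tensor_eq x y" "tensor_eq y z"
    then have "(x - y) + (y - z) \<in> tensor_rel"
      unfolding tensor_eq_def by (rule tensor_rel.add)
    then show "tensor_eq x z" by (simp add: tensor_eq_def)
  qed
qed

instantiation tensor :: (ab_group_add, ab_group_add) ab_group_add
begin

lift_definition zero_tensor :: "('a, 'b) tensor" is 0 .

lift_definition plus_tensor :: "('a, 'b) tensor \<Rightarrow> ('a, 'b) tensor \<Rightarrow> ('a, 'b) tensor" is "(+)"
  unfolding tensor_eq_def by (metis tensor_rel.add add_diff_add)

lift_definition uminus_tensor :: "('a, 'b) tensor \<Rightarrow> ('a, 'b) tensor" is uminus
  unfolding tensor_eq_def by (metis tensor_rel.uminus minus_diff_minus)

lift_definition minus_tensor :: "('a, 'b) tensor \<Rightarrow> ('a, 'b) tensor \<Rightarrow> ('a, 'b) tensor" is "(-)"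
proof -
  fix x x' y y' :: "'a \<times> 'b \<Rightarrow>\<^sub>0 int"
  assume "tensor_eq x x'" "tensor_eq y y'"
  then have "(x - x') - (y - y') \<in> tensor_rel"
    unfolding tensor_eq_def by (rule tensor_rel_diff)
  moreover have "(x - x') - (y - y') = (x - y) - (x' - y')" by (simp add: algebra_simps)
  ultimately show "tensor_eq (x - y) (x' - y')" by (simp add: tensor_eq_def)
qed

instance
  by standard (transfer, simp add: tensor_eq_def tensor_rel.zero algebra_simps)+

end

lift_definition tens :: "'a::ab_group_add \<Rightarrow> 'b::ab_group_add \<Rightarrow> ('a, 'b) tensor"
  is "\<lambda>a b. Poly_Mapping.single (a, b) 1" .

text \<open>The sum below is finite because both Laurent series are bounded below.\<close>

definition tens_fls ::
  "'a::ab_group_add fls \<Rightarrow> 'b::ab_group_add fls \<Rightarrow> ('a, 'b) tensor fls" where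
  "tens_fls f g = Abs_fls (\<lambda>n. \<Sum>i | fls_nth f i \<noteq> 0 \<and> fls_nth g (n - i) \<noteq> 0.
     tens (fls_nth f i) (fls_nth g (n - i)))"


section \<open>The exterior algebra of an abelian group\<close>

text \<open>
  The free associative unital ring on the underlying set of \<open>M\<close> is the monoid ring of the
  words over \<open>M\<close>. Its quotient by the two-sided ideal generated by all \<open>[m + n] - [m] - [n]\<close>
  and all \<open>[m] [m]\<close> is the exterior algebra of \<open>M\<close> over the integers, with \<open>\<and>\<close> as product.
\<close>

datatype 'a fword = Fword (letters: "'a list")

instantiation fword :: (type) monoid_add
begin
definition "0 = Fword []"
definition "v + w = Fword (letters v @ letters w)"
instance by standard (simp_all add: zero_fword_def plus_fword_def)
end

definition fgen :: "'m \<Rightarrow> ('m fword \<Rightarrow>\<^sub>0 int)" where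
  "fgen m = Poly_Mapping.single (Fword [m]) 1"

inductive_set ext_ideal :: "('m::ab_group_add fword \<Rightarrow>\<^sub>0 int) set" where
  zero: "0 \<in> ext_ideal"
| add: "x \<in> ext_ideal \<Longrightarrow> y \<in> ext_ideal \<Longrightarrow> x + y \<in> ext_ideal"
| mult_left: "x \<in> ext_ideal \<Longrightarrow> a * x \<in> ext_ideal"
| mult_right: "x \<in> ext_ideal \<Longrightarrow> x * a \<in> ext_ideal"
| additive: "fgen (m + n) - fgen m - fgen n \<in> ext_ideal"
| square: "fgen m * fgen m \<in> ext_ideal"

lemma ext_ideal_uminus: "x \<in> ext_ideal \<Longrightarrow> - x \<in> ext_ideal"
  using ext_ideal.mult_left[of x "-1"] by simp

lemma ext_ideal_diff: "x \<in> ext_ideal \<Longrightarrow> y \<in> ext_ideal \<Longrightarrow> x - y \<in> ext_ideal"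
  using ext_ideal.add[OF _ ext_ideal_uminus, of x y] by simp

lemma lookup_mult_fword_zero:
  fixes x y :: "'m fword \<Rightarrow>\<^sub>0 int"
  shows "Poly_Mapping.lookup (x * y) 0 = Poly_Mapping.lookup x 0 * Poly_Mapping.lookup y 0"
proof -
  have e: "(0::'m fword) = u + v \<longleftrightarrow> u = 0 \<and> v = 0" for u v
    by (cases u; cases v) (auto simp: zero_fword_def plus_fword_def)
  have "Poly_Mapping.lookup (x * y) 0 = Sum_any (\<lambda>u. Poly_Mapping.lookup x u * Sum_any (\<lambda>v. Poly_Mapping.lookup y v when (0::'m fword) = u + v))"
    by (rule lookup_mult)
  also have "\<dots> = Sum_any (\<lambda>u. (Poly_Mapping.lookup x u * Poly_Mapping.lookup y 0) when u = 0)"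
    by (rule Sum_any.cong) (auto simp: e when_def)
  also have "\<dots> = Poly_Mapping.lookup x 0 * Poly_Mapping.lookup y 0" by simp
  finally show ?thesis .
qed

lemma ext_ideal_lookup_zero: "x \<in> ext_ideal \<Longrightarrow> Poly_Mapping.lookup x 0 = 0"
  by (induction rule: ext_ideal.induct)
    (simp_all add: lookup_add lookup_minus lookup_mult_fword_zero
       lookup_mult_fword_zero[unfolded zero_fword_def] fgen_def lookup_single
       zero_fword_def when_def)

definition ext_eq ::
  "('m::ab_group_add fword \<Rightarrow>\<^sub>0 int) \<Rightarrow> ('m fword \<Rightarrow>\<^sub>0 int) \<Rightarrow> bool" where
  "ext_eq x y \<longleftrightarrow> x - y \<in> ext_ideal"

quotient_type (overloaded) 'm ext = "'m::ab_group_add fword \<Rightarrow>\<^sub>0 int" / ext_eq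
proof (rule equivpI)
  show "reflp (ext_eq :: ('m fword \<Rightarrow>\<^sub>0 int) \<Rightarrow> _)"
    by (rule reflpI) (simp add: ext_eq_def ext_ideal.zero)
  show "symp (ext_eq :: ('m fword \<Rightarrow>\<^sub>0 int) \<Rightarrow> _)"
    by (rule sympI) (metis ext_eq_def ext_ideal_uminus minus_diff_eq)
  show "transp (ext_eq :: ('m fword \<Rightarrow>\<^sub>0 int) \<Rightarrow> _)"
  proof (rule transpI)
    fix x y z :: "'m fword \<Rightarrow>\<^sub>0 int"
    assume "ext_eq x y" "ext_eq y z"
    then have "(x - y) + (y - z) \<in> ext_ideal"
      unfolding ext_eq_def by (rule ext_ideal.add)
    then show "ext_eq x z" by (simp add: ext_eq_def)
  qed
qed

instantiation ext :: (ab_group_add) ring_1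
begin

lift_definition zero_ext :: "'a ext" is 0 .

lift_definition one_ext :: "'a ext" is 1 .

lift_definition plus_ext :: "'a ext \<Rightarrow> 'a ext \<Rightarrow> 'a ext" is "(+)"
  unfolding ext_eq_def by (metis ext_ideal.add add_diff_add)

lift_definition uminus_ext :: "'a ext \<Rightarrow> 'a ext" is uminus
  unfolding ext_eq_def by (metis ext_ideal_uminus minus_diff_minus)

lift_definition minus_ext :: "'a ext \<Rightarrow> 'a ext \<Rightarrow> 'a ext" is "(-)"
proof -
  fix x x' y y' :: "'a fword \<Rightarrow>\<^sub>0 int"
  assume "ext_eq x x'" "ext_eq y y'"
  then have "(x - x') - (y - y') \<in> ext_ideal"
    unfolding ext_eq_def by (rule ext_ideal_diff)
  moreover have "(x - x') - (y - y') = (x - y) - (x' - y')" by (simp add: algebra_simps)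
  ultimately show "ext_eq (x - y) (x' - y')" by (simp add: ext_eq_def)
qed

lift_definition times_ext :: "'a ext \<Rightarrow> 'a ext \<Rightarrow> 'a ext" is "(*)"
proof -
  fix x x' y y' :: "'a fword \<Rightarrow>\<^sub>0 int"
  assume "ext_eq x x'" "ext_eq y y'"
  then have "(x - x') * y + x' * (y - y') \<in> ext_ideal"
    unfolding ext_eq_def by (intro ext_ideal.add ext_ideal.mult_left ext_ideal.mult_right)
  moreover have "(x - x') * y + x' * (y - y') = x * y - x' * y'" by (simp add: algebra_simps)
  ultimately show "ext_eq (x * y) (x' * y')" by (simp add: ext_eq_def)
qed

instance
proof
  show "(0::'a ext) \<noteq> 1"
  proof (transfer, rule notI)
    assume "ext_eq 0 (1 :: 'a fword \<Rightarrow>\<^sub>0 int)"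
    then have "Poly_Mapping.lookup (0 - 1 :: 'a fword \<Rightarrow>\<^sub>0 int) 0 = 0"
      unfolding ext_eq_def by (rule ext_ideal_lookup_zero)
    then show False by (simp add: lookup_minus lookup_one)
  qed
qed (transfer, simp add: ext_eq_def ext_ideal.zero algebra_simps)+

end

lift_definition ext_incl :: "'m::ab_group_add \<Rightarrow> 'm ext" is fgen .


section \<open>Coordinates and additive extension\<close>

text \<open>
  For a basis \<open>v\<close> indexed by \<open>I\<close>, with scalar multiplication \<open>scl\<close>, the unique coordinates of \<open>x\<close>.
\<close>

definition coords ::
  "('c::zero \<Rightarrow> 'v::comm_monoid_add \<Rightarrow> 'v) \<Rightarrow> 'i set \<Rightarrow> ('i \<Rightarrow> 'v) \<Rightarrow> 'v \<Rightarrow> ('i \<Rightarrow>\<^sub>0 'c)" where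
  "coords scl I v x = (THE c. Poly_Mapping.keys c \<subseteq> I \<and> (\<Sum>i\<in>Poly_Mapping.keys c. scl (Poly_Mapping.lookup c i) (v i)) = x)"

text \<open>
  The additive map \<open>v i \<mapsto> w i\<close>, defined on the group with \<open>\<int>\<close>-basis \<open>v i\<close>, \<open>i \<in> I\<close>.
\<close>

definition additive_ext ::
  "'i set \<Rightarrow> ('i \<Rightarrow> 'v::ring_1) \<Rightarrow> ('i \<Rightarrow> 'w::ring_1) \<Rightarrow> 'v \<Rightarrow> 'w" where
  "additive_ext I v w x =
     (let c = coords (\<lambda>k y. of_int k * y) I v x in \<Sum>i\<in>Poly_Mapping.keys c. of_int (Poly_Mapping.lookup c i) * w i)"


section \<open>Partitions\<close>

text \<open>The value at \<open>i\<close> is the part \<open>\<lambda>\<^bsub>i+1\<^esub>\<close>.\<close>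

type_synonym partn = "nat \<Rightarrow> nat"

definition Par_le :: "nat \<Rightarrow> partn set" where
  "Par_le r = {lam. antimono lam \<and> (\<forall>i\<ge>r. lam i = 0)}"

definition Par :: "partn set" where
  "Par = (\<Union>r. Par_le r)"

definition par_length :: "partn \<Rightarrow> nat" where
  "par_length lam = card {i. lam i \<noteq> 0}"


section \<open>The group \<open>M\<^sub>0\<close> and its exterior algebra\<close>

type_synonym M0 = "nat \<Rightarrow>\<^sub>0 int"

definition bvec :: "int \<Rightarrow> M0" where
  "bvec k = (if k < 0 then 0 else Poly_Mapping.single (nat k) 1)"

definition bwedge :: "nat \<Rightarrow> partn \<Rightarrow> M0 ext" where
  "bwedge r lam = prod_list (map (\<lambda>k. ext_incl (bvec (int (k + lam (r - 1 - k))))) [0..<r])"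

definition decomposable :: "nat \<Rightarrow> M0 ext set" where
  "decomposable r = {prod_list (map ext_incl ms) | ms. length ms = r}"

text \<open>
  Unital ring homomorphisms \<open>\<And>M\<^sub>0 \<rightarrow> \<And>M\<^sub>0[[z\<^sup>-\<^sup>1]]\<close>; the indeterminate of the power series is
  \<open>z\<^sup>-\<^sup>1\<close> and commutes with the coefficients.
\<close>

definition wedge_hom :: "(M0 ext \<Rightarrow> M0 ext fps) \<Rightarrow> bool" where
  "wedge_hom f \<longleftrightarrow> f 1 = 1 \<and> (\<forall>x y. f (x + y) = f x + f y) \<and> (\<forall>x y. f (x * y) = f x * f y)"

definition sigma_minus :: "M0 ext \<Rightarrow> M0 ext fps" where
  "sigma_minus = (THE f. wedge_hom f \<and>
     (\<forall>j::nat. f (ext_incl (bvec (int j))) = Abs_fps (\<lambda>i. ext_incl (bvec (int j - int i)))))"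

definition sigma_bar_minus :: "M0 ext \<Rightarrow> M0 ext fps" where
  "sigma_bar_minus = (THE f. wedge_hom f \<and>
     (\<forall>j::nat. f (ext_incl (bvec (int j))) =
        fps_const (ext_incl (bvec (int j))) - fps_const (ext_incl (bvec (int j - 1))) * fps_X))"


section \<open>The ring \<open>B\<^sub>\<infinity>\<close>\<close>

text \<open>
  Polynomials over \<open>\<int>\<close> in countably many indeterminates; the indeterminate with number \<open>i\<close>
  is \<open>e\<^bsub>i+1\<^esub>\<close>, so that \<open>evar i\<close> is \<open>e\<^sub>i\<close> for \<open>i \<ge> 1\<close> (the value \<open>evar 0\<close> is never used).
\<close>

type_synonym Binf = "(nat \<Rightarrow>\<^sub>0 nat) \<Rightarrow>\<^sub>0 int"

definition evar :: "nat \<Rightarrow> Binf" where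
  "evar i = Poly_Mapping.single (Poly_Mapping.single (i - 1) 1) 1"

definition Bfin :: "nat \<Rightarrow> Binf set" where
  "Bfin r = {p. \<forall>m\<in>Poly_Mapping.keys p. Poly_Mapping.keys m \<subseteq> {..<r}}"

definition Efin :: "nat \<Rightarrow> Binf fps" where
  "Efin r = Abs_fps (\<lambda>i. if i = 0 then 1 else if i \<le> r then (- 1) ^ i * evar i else 0)"

definition Einf :: "Binf fps" where
  "Einf = Abs_fps (\<lambda>i. if i = 0 then 1 else (- 1) ^ i * evar i)"

text \<open>
  The inverse of a power series with constant term 1. The library's \<open>inverse\<close> on power
  series is not available here since the coefficients have no division.
\<close>

definition fps_recip :: "'a::comm_ring_1 fps \<Rightarrow> 'a fps" where
  "fps_recip f = fps_right_inverse f 1"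

definition fps_coeff_int :: "'a::zero fps \<Rightarrow> int \<Rightarrow> 'a" where
  "fps_coeff_int f j = (if j < 0 then 0 else fps_nth f (nat j))"

definition Hfin :: "nat \<Rightarrow> int \<Rightarrow> Binf" where
  "Hfin r = fps_coeff_int (fps_recip (Efin r))"

definition Hinf :: "int \<Rightarrow> Binf" where
  "Hinf = fps_coeff_int (fps_recip Einf)"

text \<open>Rows and columns are numbered from 0, which leaves the index \<open>\<lambda>\<^sub>j - j + i\<close> unchanged.\<close>

definition schur_det :: "nat \<Rightarrow> (int \<Rightarrow> 'a::comm_ring_1) \<Rightarrow> partn \<Rightarrow> 'a" where
  "schur_det r c lam = det (mat r r (\<lambda>(i, j). c (int (lam j) - int j + int i)))"

definition schur_inf :: "partn \<Rightarrow> Binf" where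
  "schur_inf lam = schur_det (par_length lam) Hinf lam"

definition phi :: "nat \<Rightarrow> Binf \<Rightarrow> M0 ext" where
  "phi r = additive_ext (Par_le r) (schur_det r (Hfin r)) (bwedge r)"


section \<open>The operators on \<open>B\<^sub>\<infinity>\<close>\<close>

text \<open>
  The polynomials \<open>c\<^bsub>\<lambda>\<mu>\<^esub>(z\<^sup>-\<^sup>1)\<close> with \<open>D [b]\<^sup>r\<^sub>\<lambda> = (\<Sum>\<mu>. c\<^bsub>\<lambda>\<mu>\<^esub>(z\<^sup>-\<^sup>1) [b]\<^sup>r\<^sub>\<mu>)\<close>, where
  \<open>r = max 1 (\<ell>(\<lambda>))\<close>. The indeterminate of the polynomials is \<open>z\<^sup>-\<^sup>1\<close>, here and in \<open>transfer_op\<close>.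
\<close>

definition wedge_coeffs :: "(M0 ext \<Rightarrow> M0 ext fps) \<Rightarrow> partn \<Rightarrow> (partn \<Rightarrow>\<^sub>0 int poly)" where
  "wedge_coeffs D lam =
     (let r = max 1 (par_length lam)
      in coords (\<lambda>p x. fps_of_poly (map_poly of_int p) * x) (Par_le r)
           (\<lambda>mu. fps_const (bwedge r mu)) (D (bwedge r lam)))"

definition transfer_op :: "(M0 ext \<Rightarrow> M0 ext fps) \<Rightarrow> Binf \<Rightarrow> Binf poly" where
  "transfer_op D = additive_ext Par schur_inf
     (\<lambda>lam. \<Sum>mu\<in>Poly_Mapping.keys (wedge_coeffs D lam).
        Polynomial.smult (schur_inf mu) (map_poly of_int (Poly_Mapping.lookup (wedge_coeffs D lam) mu)))"

definition sigma_minus_B :: "Binf \<Rightarrow> Binf poly" where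
  "sigma_minus_B = transfer_op sigma_minus"

definition sigma_bar_minus_B :: "Binf \<Rightarrow> Binf poly" where
  "sigma_bar_minus_B = transfer_op sigma_bar_minus"

text \<open>A polynomial in \<open>z\<^sup>-\<^sup>1\<close> as a Laurent series in \<open>z\<close>.\<close>

definition poly_zinv :: "'a::comm_ring_1 poly \<Rightarrow> 'a fls" where
  "poly_zinv p = poly (map_poly fls_const p) fls_X_inv"

end

theory Submission
  imports Defs
begin

text \<open>
  Write \<open>\<tau> = \<Sum> a\<^sub>\<lambda> \<Delta>\<^sub>\<lambda>(H\<^sub>\<infinity>)\<close>. For large \<open>r\<close> the determinants in \<open>H\<^sub>r\<close> and in \<open>H\<^sub>\<infinity>\<close> agree on the
  support of \<open>a\<close>, so that \<open>\<phi>\<^sub>r(\<tau>) = T = \<Sum> a\<^sub>\<lambda> [b]\<^sup>r\<^sub>\<lambda>\<close>. Row operations on the determinants show that,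
  under \<open>\<Delta>\<^sub>\<mu> \<mapsto> [b]\<^sub>\<mu>\<close>, the coefficient of \<open>z\<^sup>n\<close> of \<open>E\<^sub>\<infinity>(z) \<sigma>\<^sub>-(z) \<tau>\<close> is a contraction of \<open>T\<close> for \<open>n < r\<close>, and
  the coefficient of \<open>z\<^sup>n\<close> of the other factor is \<open>T \<and> b\<^bsub>n+r\<^esub>\<close>. Hence the residue vanishes iff
  \<open>\<Sum>\<^sub>k (b\<^sub>k\<^sup>* \<rfloor> T) \<otimes> (T \<and> b\<^sub>k) = 0\<close>, that is, iff every contraction of \<open>T\<close> to a vector annihilates \<open>T\<close>.
  Decomposable elements have this property. Conversely, contracting \<open>T \<noteq> 0\<close> along a nonzero
  coordinate yields vectors whose product is a nonzero multiple \<open>d T\<close>; a prime \<open>p\<close> dividing \<open>d\<close> divides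
  all coordinates of that product, which makes its factors dependent modulo \<open>p\<close>, so that \<open>p\<close> can be
  divided out of one of them.
\<close>

definition pm_extend :: "('k \<Rightarrow> 'r::ring_1) \<Rightarrow> ('k \<Rightarrow>\<^sub>0 int) \<Rightarrow> 'r" where
  "pm_extend f p = (\<Sum>k\<in>Poly_Mapping.keys p. of_int (Poly_Mapping.lookup p k) * f k)"

lemma pm_extend_superset:
  assumes "finite A" "Poly_Mapping.keys p \<subseteq> A"
  shows "pm_extend f p = (\<Sum>k\<in>A. of_int (Poly_Mapping.lookup p k) * f k)"
  unfolding pm_extend_def using assms
  by (intro sum.mono_neutral_left) (auto simp: in_keys_iff)

lemma pm_extend_zero [simp]: "pm_extend f 0 = 0"
  by (simp add: pm_extend_def)

lemma pm_extend_add: "pm_extend f (p + q) = pm_extend f p + pm_extend f q"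
proof -
  let ?A = "Poly_Mapping.keys p \<union> Poly_Mapping.keys q"
  have "pm_extend f (p + q) = (\<Sum>k\<in>?A. of_int (Poly_Mapping.lookup (p + q) k) * f k)"
    by (rule pm_extend_superset) (simp_all add: keys_add)
  then show ?thesis
    by (simp add: lookup_add distrib_right sum.distrib pm_extend_superset[of ?A])
qed

lemma pm_extend_uminus: "pm_extend f (- p) = - pm_extend f p"
  by (simp add: pm_extend_def sum_negf)

lemma pm_extend_diff: "pm_extend f (p - q) = pm_extend f p - pm_extend f q"
  using pm_extend_add[of f p "- q"] by (simp add: pm_extend_uminus)

lemma pm_extend_single [simp]: "pm_extend f (Poly_Mapping.single k c) = of_int c * f k"
  by (simp add: pm_extend_def)

lemma pm_extend_sum: "pm_extend f (sum p A) = (\<Sum>a\<in>A. pm_extend f (p a))"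
  by (induction A rule: infinite_finite_induct) (simp_all add: pm_extend_add)

lemma pm_induct [case_names zero add uminus single]:
  fixes p :: "'k \<Rightarrow>\<^sub>0 int"
  assumes zero: "P 0" and add: "\<And>x y. P x \<Longrightarrow> P y \<Longrightarrow> P (x + y)"
    and uminus: "\<And>x. P x \<Longrightarrow> P (- x)" and single: "\<And>k. P (Poly_Mapping.single k 1)"
  shows "P p"
  using subset_UNIV
proof (induction p rule: frag_induction)
  case zero show ?case by (rule assms(1))
next
  case (one x) show ?case using single by simp
next
  case (diff a b) then show ?case using add[OF _ uminus, of a b] by simp
qed

text \<open>
  The universal property of the monoid ring of a monoid over the integers: both the free
  associative ring on words and the polynomial ring \<open>B\<^sub>\<infinity>\<close> are of this form.
\<close>

lemma pm_extend_mult: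
  fixes f :: "'k::monoid_add \<Rightarrow> 'r::ring_1"
  assumes "\<And>k l. f (k + l) = f k * f l"
  shows "pm_extend f (p * q) = pm_extend f p * pm_extend f q"
proof (induction p rule: pm_induct)
  case (single k)
  show ?case
    by (induction q rule: pm_induct)
      (simp_all add: distrib_left pm_extend_add pm_extend_uminus mult_single assms)
qed (simp_all add: distrib_right pm_extend_add pm_extend_uminus)

lemma additive_zero:
  fixes h :: "'a::ab_group_add \<Rightarrow> 'b::ab_group_add"
  assumes "\<And>x y. h (x + y) = h x + h y"
  shows "h 0 = 0"
  using assms[of 0 0] by simp

lemma additive_uminus:
  fixes h :: "'a::ab_group_add \<Rightarrow> 'b::ab_group_add"
  assumes "\<And>x y. h (x + y) = h x + h y"
  shows "h (- x) = - h x"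
  using assms[of x "- x"] additive_zero[OF assms] by (simp add: eq_neg_iff_add_eq_0 add.commute)

lemma additive_diff:
  fixes h :: "'a::ab_group_add \<Rightarrow> 'b::ab_group_add"
  assumes "\<And>x y. h (x + y) = h x + h y"
  shows "h (x - y) = h x - h y"
  using assms[of x "- y"] additive_uminus[OF assms] by simp

lemma additive_sum:
  fixes h :: "'a::ab_group_add \<Rightarrow> 'b::ab_group_add"
  assumes "\<And>x y. h (x + y) = h x + h y"
  shows "h (sum f A) = (\<Sum>a\<in>A. h (f a))"
  by (induction A rule: infinite_finite_induct) (simp_all add: assms additive_zero[OF assms])

lemma additive_of_int_mult:
  fixes h :: "'a::ring_1 \<Rightarrow> 'b::ring_1"
  assumes "\<And>x y. h (x + y) = h x + h y"
  shows "h (of_int c * x) = of_int c * h x"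
proof (induction c rule: int_induct[of _ 0])
  case base then show ?case by (simp add: additive_zero[OF assms])
next
  case (step1 i) then show ?case by (simp add: distrib_right assms)
next
  case (step2 i) then show ?case by (simp add: left_diff_distrib additive_diff[of h, OF assms])
qed


section \<open>The universal property of the exterior algebra\<close>

definition word_extend :: "('m \<Rightarrow> 'r::ring_1) \<Rightarrow> ('m fword \<Rightarrow>\<^sub>0 int) \<Rightarrow> 'r" where
  "word_extend g = pm_extend (\<lambda>w. prod_list (map g (letters w)))"

lemma word_extend_fgen: "word_extend g (fgen m) = g m"
  by (simp add: word_extend_def fgen_def)

lemma word_extend_mult: "word_extend g (p * q) = word_extend g p * word_extend g q"
  unfolding word_extend_def by (rule pm_extend_mult) (simp add: plus_fword_def)

lemma word_extend_add: "word_extend g (p + q) = word_extend g p + word_extend g q"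
  by (simp add: word_extend_def pm_extend_add)

lemma word_extend_diff: "word_extend g (p - q) = word_extend g p - word_extend g q"
  by (simp add: word_extend_def pm_extend_diff)

lemma word_extend_one: "word_extend g 1 = 1"
  by (simp add: word_extend_def pm_extend_single zero_fword_def flip: single_one)

lemma word_extend_ext_ideal:
  assumes "\<And>m n. g (m + n) = g m + g n" "\<And>m. g m * g m = 0" "x \<in> ext_ideal"
  shows "word_extend g x = 0"
  using assms(3)
proof (induction rule: ext_ideal.induct)
  case zero then show ?case by (simp add: word_extend_def)
qed (simp_all add: word_extend_add word_extend_diff word_extend_mult word_extend_fgen assms(1,2))

definition ext_extend :: "('m::ab_group_add \<Rightarrow> 'r::ring_1) \<Rightarrow> 'm ext \<Rightarrow> 'r" where
  "ext_extend g x = word_extend g (rep_ext x)"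

lemma ext_extend_abs:
  assumes "\<And>m n. g (m + n) = g m + g n" "\<And>m. g m * g m = 0"
  shows "ext_extend g (abs_ext p) = word_extend g p"
proof -
  have "ext_eq (rep_ext (abs_ext p)) p"
    using Quotient3_rep_abs[OF Quotient3_ext] by (metis Quotient3_ext Quotient3_def equivp_reflp ext_equivp)
  then have "word_extend g (rep_ext (abs_ext p) - p) = 0"
    unfolding ext_eq_def by (rule word_extend_ext_ideal[OF assms])
  then show ?thesis by (simp add: ext_extend_def word_extend_diff)
qed

context
  fixes g :: "'m::ab_group_add \<Rightarrow> 'r::ring_1"
  assumes add: "\<And>m n. g (m + n) = g m + g n" and square: "\<And>m. g m * g m = 0"
begin

lemma ext_extend_incl: "ext_extend g (ext_incl m) = g m"
  by (simp add: ext_incl.abs_eq ext_extend_abs[OF add square] word_extend_fgen)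

lemma ext_extend_add: "ext_extend g (x + y) = ext_extend g x + ext_extend g y"
  by (induction x; induction y) (simp add: plus_ext.abs_eq ext_extend_abs[OF add square] word_extend_add)

lemma ext_extend_mult: "ext_extend g (x * y) = ext_extend g x * ext_extend g y"
  by (induction x; induction y) (simp add: times_ext.abs_eq ext_extend_abs[OF add square] word_extend_mult)

lemma ext_extend_one: "ext_extend g 1 = 1"
  by (simp add: one_ext.abs_eq ext_extend_abs[OF add square] word_extend_one)

end

lemma ext_incl_add: "ext_incl (m + n) = ext_incl m + ext_incl n"
proof (transfer)
  fix m n :: 'a
  show "ext_eq (fgen (m + n)) (fgen m + fgen n)"
    using ext_ideal.additive[of m n] by (simp add: ext_eq_def algebra_simps)
qed

lemma ext_incl_square: "ext_incl m * ext_incl m = 0"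
  by transfer (simp add: ext_eq_def ext_ideal.square)

lemmas ext_incl_zero = additive_zero[of ext_incl, OF ext_incl_add]
lemmas ext_incl_uminus = additive_uminus[of ext_incl, OF ext_incl_add]
lemmas ext_incl_diff = additive_diff[of ext_incl, OF ext_incl_add]
lemmas ext_incl_sum = additive_sum[of ext_incl, OF ext_incl_add]

lemma ext_incl_anticommute: "ext_incl m * ext_incl n = - (ext_incl n * ext_incl m)"
proof -
  have "ext_incl (m + n) * ext_incl (m + n) = 0" by (rule ext_incl_square)
  then show ?thesis
    by (simp add: ext_incl_add algebra_simps ext_incl_square eq_neg_iff_add_eq_0)
qed

lemma ext_induct [case_names zero add uminus wedge]:
  fixes x :: "'m::ab_group_add ext"
  assumes zero: "P 0" and add: "\<And>x y. P x \<Longrightarrow> P y \<Longrightarrow> P (x + y)"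
    and uminus: "\<And>x. P x \<Longrightarrow> P (- x)" and wedge: "\<And>ms. P (prod_list (map ext_incl ms))"
  shows "P x"
proof -
  obtain p where x: "x = abs_ext p" by (metis Quotient3_ext Quotient3_abs_rep)
  have "P (abs_ext p)"
  proof (induction p rule: pm_induct)
    case zero then show ?case using assms(1) by (simp add: zero_ext_def)
  next
    case (add x y) then show ?case using assms(2) by (metis plus_ext.abs_eq)
  next
    case (uminus x) then show ?case using assms(3) by (metis uminus_ext.abs_eq)
  next
    case (single k)
    have "abs_ext (Poly_Mapping.single (Fword ms) 1) = prod_list (map ext_incl ms)" for ms :: "'m list"
    proof (induction ms)
      case Nil then show ?case by (simp add: one_ext.abs_eq zero_fword_def flip: single_one)
    next
      case (Cons m ms)
      have "Poly_Mapping.single (Fword (m # ms)) 1 = fgen m * Poly_Mapping.single (Fword ms) (1::int)"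
        by (simp add: fgen_def mult_single plus_fword_def)
      then have "abs_ext (Poly_Mapping.single (Fword (m # ms)) 1) =
          abs_ext (fgen m) * abs_ext (Poly_Mapping.single (Fword ms) (1::int))"
        by (simp add: times_ext.abs_eq)
      then show ?case by (simp add: Cons.IH ext_incl.abs_eq)
    qed
    then show ?case using wedge by (metis fword.exhaust)
  qed
  then show ?thesis using x by simp
qed

lemma additive_ext_eqI:
  fixes f h :: "'m::ab_group_add ext \<Rightarrow> 'r::ab_group_add"
  assumes "\<And>x y. f (x + y) = f x + f y" "\<And>x y. h (x + y) = h x + h y"
    and "\<And>ms. f (prod_list (map ext_incl ms)) = h (prod_list (map ext_incl ms))"
  shows "f x = h x"
  by (induction x rule: ext_induct)
    (simp_all add: assms additive_zero[of f, OF assms(1)] additive_zero[of h, OF assms(2)]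
      additive_uminus[of f, OF assms(1)] additive_uminus[of h, OF assms(2)])


section \<open>Contractions and decomposable elements\<close>

lemma mult_of_int_left: "x * (of_int c * y) = of_int c * (x * (y::'a::ring_1))"
  by (metis mult.assoc mult_of_int_commute)

datatype 'a tri = Tri (tri11: 'a) (tri12: 'a) (tri22: 'a)

instantiation tri :: (ring_1) ring_1
begin
definition "0 = Tri 0 0 0"
definition "1 = Tri 1 0 1"
definition "x + y = Tri (tri11 x + tri11 y) (tri12 x + tri12 y) (tri22 x + tri22 y)"
definition "x - y = Tri (tri11 x - tri11 y) (tri12 x - tri12 y) (tri22 x - tri22 y)"
definition "- x = Tri (- tri11 x) (- tri12 x) (- tri22 x)"
definition "x * y = Tri (tri11 x * tri11 y) (tri11 x * tri12 y + tri12 x * tri22 y) (tri22 x * tri22 y)"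
instance
  by standard
    (simp_all add: zero_tri_def one_tri_def plus_tri_def minus_tri_def uminus_tri_def times_tri_def
      algebra_simps)
end

definition contr_mat :: "nat \<Rightarrow> M0 \<Rightarrow> M0 ext tri" where
  "contr_mat k m = Tri (ext_incl m) (of_int (Poly_Mapping.lookup m k)) (- ext_incl m)"

text \<open>
  The interior product by the \<open>k\<close>-th coordinate function, acting from the right: upper
  triangular matrices with diagonal \<open>(x, \<plusminus>x)\<close> encode antiderivations in the corner.
\<close>

definition contr :: "nat \<Rightarrow> M0 ext \<Rightarrow> M0 ext" where
  "contr k x = tri12 (ext_extend (contr_mat k) x)"

lemma contr_mat_simps [simp]:
  "tri11 (contr_mat k m) = ext_incl m" "tri12 (contr_mat k m) = of_int (Poly_Mapping.lookup m k)"
  "tri22 (contr_mat k m) = - ext_incl m"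
  by (simp_all add: contr_mat_def)

lemma contr_mat_add: "contr_mat k (m + n) = contr_mat k m + contr_mat k n"
  by (simp add: contr_mat_def plus_tri_def ext_incl_add lookup_add)

lemma contr_mat_square: "contr_mat k m * contr_mat k m = 0"
  by (simp add: contr_mat_def times_tri_def zero_tri_def ext_incl_square mult_of_int_commute)

lemmas contr_hom = ext_extend_incl[of "contr_mat k" for k, OF contr_mat_add contr_mat_square]
  ext_extend_add[of "contr_mat k" for k, OF contr_mat_add contr_mat_square]
  ext_extend_mult[of "contr_mat k" for k, OF contr_mat_add contr_mat_square]
  ext_extend_one[of "contr_mat k" for k, OF contr_mat_add contr_mat_square]

lemma contr_add: "contr k (x + y) = contr k x + contr k y"
  by (simp add: contr_def contr_hom plus_tri_def)

lemmas contr_zero [simp] = additive_zero[of "contr k" for k, OF contr_add]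
lemmas contr_uminus = additive_uminus[of "contr k" for k, OF contr_add]
lemmas contr_diff = additive_diff[of "contr k" for k, OF contr_add]
lemmas contr_of_int_mult = additive_of_int_mult[of "contr k" for k, OF contr_add]

lemma contr_one [simp]: "contr k 1 = 0"
  by (simp add: contr_def contr_hom one_tri_def)

lemma tri11_contr_hom: "tri11 (ext_extend (contr_mat k) x) = x"
proof (rule additive_ext_eqI)
  fix ms
  show "tri11 (ext_extend (contr_mat k) (prod_list (map ext_incl ms))) = prod_list (map ext_incl ms)"
    by (induction ms) (simp_all add: contr_hom one_tri_def times_tri_def)
qed (simp_all add: contr_hom plus_tri_def)

lemma contr_mult_incl:
  "contr k (x * ext_incl m) = of_int (Poly_Mapping.lookup m k) * x - contr k x * ext_incl m"
proof -
  have "contr k (x * ext_incl m) = x * of_int (Poly_Mapping.lookup m k) - contr k x * ext_incl m"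
    by (simp add: contr_def contr_hom times_tri_def tri11_contr_hom)
  then show ?thesis by (simp add: mult_of_int_commute)
qed

lemma contr_anticommute: "contr k (contr l x) = - contr l (contr k x)"
proof (rule additive_ext_eqI[where f = "\<lambda>x. contr k (contr l x)" and h = "\<lambda>x. - contr l (contr k x)"])
  fix ms
  show "contr k (contr l (prod_list (map ext_incl ms))) = - contr l (contr k (prod_list (map ext_incl ms)))"
    by (induction ms rule: rev_induct)
      (simp_all add: contr_mult_incl contr_diff contr_of_int_mult algebra_simps)
qed (simp_all add: contr_add)

lemma contr_contr [simp]: "contr k (contr k x) = 0"
proof (rule additive_ext_eqI[where f = "\<lambda>x. contr k (contr k x)" and h = "\<lambda>_. 0"])
  fix ms
  show "contr k (contr k (prod_list (map ext_incl ms))) = 0"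
    by (induction ms rule: rev_induct)
      (simp_all add: contr_mult_incl contr_diff contr_of_int_mult algebra_simps)
qed (simp_all add: contr_add)

definition counit :: "M0 ext \<Rightarrow> int" where
  "counit = ext_extend (\<lambda>_. 0)"

lemma counit_add: "counit (x + y) = counit x + counit y"
  unfolding counit_def by (rule ext_extend_add) simp_all

lemma counit_mult: "counit (x * y) = counit x * counit y"
  unfolding counit_def by (rule ext_extend_mult) simp_all

lemma counit_one [simp]: "counit 1 = 1"
  unfolding counit_def by (rule ext_extend_one) simp_all

lemma counit_incl [simp]: "counit (ext_incl m) = 0"
  unfolding counit_def by (rule ext_extend_incl) simp_all

lemma counit_of_int [simp]: "counit (of_int c) = c"
  using additive_of_int_mult[of counit c 1, OF counit_add] by simp

definition pairing :: "nat list \<Rightarrow> M0 ext \<Rightarrow> int" where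
  "pairing ks x = counit (fold contr ks x)"

lemma pairing_Nil: "pairing [] x = counit x"
  by (simp add: pairing_def)

lemma pairing_Cons: "pairing (k # ks) x = pairing ks (contr k x)"
  by (simp add: pairing_def)

lemma pairing_add: "pairing ks (x + y) = pairing ks x + pairing ks y"
  by (induction ks arbitrary: x y) (simp_all add: pairing_Nil pairing_Cons counit_add contr_add)

lemmas pairing_zero [simp] = additive_zero[of "pairing ks" for ks, OF pairing_add]
lemmas pairing_uminus = additive_uminus[of "pairing ks" for ks, OF pairing_add]
lemmas pairing_sum = additive_sum[of "pairing ks" for ks, OF pairing_add]
lemmas pairing_of_int_mult =
  additive_of_int_mult[of "pairing ks" for ks, OF pairing_add, unfolded of_int_eq_id id_apply]

lemma pairing_move: "\<exists>c\<in>{1, -1}. pairing (ks @ k # ls) x = c * pairing (k # ks @ ls) x"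
proof (induction ks arbitrary: x)
  case Nil then show ?case by simp
next
  case (Cons l ks)
  obtain c where c: "c \<in> {1, -1}" "pairing (ks @ k # ls) (contr l x) = c * pairing (k # ks @ ls) (contr l x)"
    using Cons.IH by blast
  have "pairing ((l # ks) @ k # ls) x = (- c) * pairing (k # (l # ks) @ ls) x"
    using c(2) contr_anticommute[of k l x] by (simp add: pairing_Cons pairing_uminus)
  then show ?case using c(1) by (intro bexI[of _ "- c"]) auto
qed

lemma pairing_repeated: "k \<in> set ks \<Longrightarrow> pairing (k # ks) x = 0"
proof -
  assume "k \<in> set ks"
  then obtain us vs where ks: "ks = us @ k # vs" by (meson split_list)
  obtain c where "pairing ks (contr k x) = c * pairing (k # us @ vs) (contr k x)"
    using pairing_move ks by blast
  then show ?thesis by (simp add: pairing_Cons)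
qed

abbreviation wedge :: "M0 list \<Rightarrow> M0 ext" where
  "wedge ms \<equiv> prod_list (map ext_incl ms)"

text \<open>The bilinear identity says that these vectors annihilate \<open>x\<close>.\<close>

definition polar :: "(M0 ext \<Rightarrow> int) \<Rightarrow> nat \<Rightarrow> M0 ext \<Rightarrow> M0" where
  "polar g K x = (\<Sum>k<K. Poly_Mapping.single k (g (contr k x)))"

lemma lookup_polar: "Poly_Mapping.lookup (polar g K x) k = (if k < K then g (contr k x) else 0)"
proof -
  have "Poly_Mapping.lookup (polar g K x) k = (\<Sum>l<K. if l = k then g (contr l x) else 0)"
    unfolding polar_def lookup_sum by (intro sum.cong) (auto simp: lookup_single when_def)
  then show ?thesis by simp
qed

lemma ext_incl_frag_cmul: "ext_incl (frag_cmul c m) = of_int c * ext_incl m"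
proof (induction c rule: int_induct[of _ 0])
  case base then show ?case by (simp add: ext_incl_zero)
next
  case (step1 i) then show ?case by (simp add: frag_cmul_distrib ext_incl_add distrib_right)
next
  case (step2 i)
  then show ?case by (simp add: frag_cmul_diff_distrib ext_incl_diff left_diff_distrib)
qed

lemma polar_mult_incl:
  assumes "\<And>x y. g (x + y) = g x + g y" "Poly_Mapping.keys m \<subseteq> {..<K}"
  shows "polar g K (x * ext_incl m) = frag_cmul (g x) m - polar (\<lambda>y. g (y * ext_incl m)) K x"
proof (rule poly_mapping_eqI)
  fix k
  have "g (of_int c * x) = c * g x" for c using additive_of_int_mult[of g c x, OF assms(1)] by simp
  moreover have "Poly_Mapping.lookup m k = 0" if "\<not> k < K" using assms(2) that by (auto simp: in_keys_iff)
  ultimately show "Poly_Mapping.lookup (polar g K (x * ext_incl m)) k =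
      Poly_Mapping.lookup (frag_cmul (g x) m - polar (\<lambda>y. g (y * ext_incl m)) K x) k"
    by (simp add: lookup_polar lookup_minus contr_mult_incl additive_diff[of g, OF assms(1)] mult.commute)
qed

lemma wedge_mult_polar:
  assumes "\<And>x y. g (x + y) = g x + g y" "\<And>m. m \<in> set ms \<Longrightarrow> Poly_Mapping.keys m \<subseteq> {..<K}"
  shows "wedge ms * ext_incl (polar g K (wedge ms)) = 0"
  using assms
proof (induction ms arbitrary: g rule: rev_induct)
  case Nil
  then show ?case using additive_zero[of g] by (simp add: polar_def ext_incl_zero)
next
  case (snoc m ms)
  define h where "h y = g (y * ext_incl m)" for y
  have "wedge ms * ext_incl (polar h K (wedge ms)) = 0"
    using snoc.prems by (intro snoc.IH) (auto simp: h_def distrib_right)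
  moreover have "wedge ms * ext_incl m * ext_incl v = - (wedge ms * ext_incl v * ext_incl m)" for v
    unfolding mult.assoc ext_incl_anticommute[of m v] by simp
  ultimately have *: "wedge ms * ext_incl m * ext_incl (polar h K (wedge ms)) = 0" by simp
  have "polar g K (wedge (ms @ [m])) = frag_cmul (g (wedge ms)) m - polar h K (wedge ms)"
    using polar_mult_incl[of g m K "wedge ms"] snoc.prems by (simp add: h_def[abs_def])
  moreover have "wedge ms * ext_incl m * (of_int c * ext_incl m) = 0" for c
    by (simp add: mult_of_int_left mult.assoc ext_incl_square)
  ultimately show ?case
    using * by (simp add: ext_incl_diff ext_incl_frag_cmul right_diff_distrib)
qed

inductive_set wedge_power :: "nat \<Rightarrow> M0 ext set" for r where
  zero: "0 \<in> wedge_power r"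
| add: "x \<in> wedge_power r \<Longrightarrow> y \<in> wedge_power r \<Longrightarrow> x + y \<in> wedge_power r"
| uminus: "x \<in> wedge_power r \<Longrightarrow> - x \<in> wedge_power r"
| wedge: "length ms = r \<Longrightarrow> wedge ms \<in> wedge_power r"

lemma wedge_power_diff: "x \<in> wedge_power r \<Longrightarrow> y \<in> wedge_power r \<Longrightarrow> x - y \<in> wedge_power r"
  using wedge_power.add[of x r "- y"] wedge_power.uminus[of y] by simp

lemma wedge_power_of_int_mult: "x \<in> wedge_power r \<Longrightarrow> of_int c * x \<in> wedge_power r"
  by (induction c rule: int_induct[of _ 0])
    (simp_all add: wedge_power.zero wedge_power.add wedge_power_diff distrib_right left_diff_distrib)

lemma wedge_power_sum: "(\<And>a. a \<in> A \<Longrightarrow> f a \<in> wedge_power r) \<Longrightarrow> sum f A \<in> wedge_power r"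
  by (induction A rule: infinite_finite_induct) (simp_all add: wedge_power.zero wedge_power.add)

lemma wedge_power_mult_incl: "x \<in> wedge_power r \<Longrightarrow> x * ext_incl m \<in> wedge_power (Suc r)"
proof (induction rule: wedge_power.induct)
  case (wedge ms)
  then show ?case using wedge_power.wedge[of "ms @ [m]" "Suc r"] by simp
qed (simp_all add: wedge_power.zero wedge_power.add wedge_power.uminus distrib_right)

lemma contr_wedge_power: "x \<in> wedge_power (Suc r) \<Longrightarrow> contr k x \<in> wedge_power r"
proof (induction rule: wedge_power.induct)
  case (wedge ms)
  then show ?case
  proof (induction ms arbitrary: r rule: rev_induct)
    case (snoc m ms)
    have "contr k (wedge ms) * ext_incl m \<in> wedge_power r"
    proof (cases r)
      case 0 then show ?thesis using snoc.prems by (simp add: wedge_power.zero)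
    next
      case (Suc s) then show ?thesis using snoc by (auto intro: wedge_power_mult_incl)
    qed
    then show ?case using snoc.prems
      by (auto simp: contr_mult_incl intro!: wedge_power_diff wedge_power_of_int_mult wedge_power.wedge)
  qed simp
qed (simp_all add: wedge_power.zero wedge_power.add wedge_power.uminus contr_add contr_uminus)

lemma wedge_power_0: "x \<in> wedge_power 0 \<Longrightarrow> x = of_int (counit x)"
  by (induction rule: wedge_power.induct)
    (simp_all add: counit_add additive_zero[of counit, OF counit_add] additive_uminus[of counit, OF counit_add])

lemma fold_contr_wedge_power:
  "x \<in> wedge_power (length ks) \<Longrightarrow> fold contr ks x = of_int (pairing ks x)"
  by (induction ks arbitrary: x) (auto simp: pairing_Nil pairing_Cons contr_wedge_power wedge_power_0)

text \<open>If \<open>x \<and> w = 0\<close> then contracting with \<open>k\<close> gives \<open>w\<^sub>k x = (k \<rfloor> x) \<and> w\<close>; this is iterated.\<close>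

lemma contr_annihilators:
  assumes "\<And>k w. (k, w) \<in> set ps \<Longrightarrow> x * ext_incl w = 0"
    and "sorted_wrt (\<lambda>p q. Poly_Mapping.lookup (snd q) (fst p) = 0) ps"
  shows "of_int (\<Prod>p\<leftarrow>ps. Poly_Mapping.lookup (snd p) (fst p)) * x =
    fold contr (map fst ps) x * wedge (rev (map snd ps))"
  using assms
proof (induction ps arbitrary: x)
  case Nil then show ?case by simp
next
  case (Cons p ps)
  obtain k w where p: "p = (k, w)" by force
  have eq: "of_int (Poly_Mapping.lookup v k) * x = contr k x * ext_incl v" if "x * ext_incl v = 0" for v
    using contr_mult_incl[of k x v] that by simp
  define c where "c = (\<Prod>p\<leftarrow>ps. Poly_Mapping.lookup (snd p) (fst p))"
  have IH: "of_int c * contr k x = fold contr (map fst ps) (contr k x) * wedge (rev (map snd ps))"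
    unfolding c_def
  proof (rule Cons.IH)
    fix l v assume v: "(l, v) \<in> set ps"
    then have "Poly_Mapping.lookup v k = 0" using Cons.prems(2) p by auto
    then show "contr k x * ext_incl v = 0" using eq[of v] Cons.prems(1)[of l v] v by simp
  qed (use Cons.prems in auto)
  have "of_int (\<Prod>p\<leftarrow>p # ps. Poly_Mapping.lookup (snd p) (fst p)) * x =
      of_int (c * Poly_Mapping.lookup w k) * x"
    by (simp add: p c_def mult.commute)
  also have "\<dots> = of_int c * (of_int (Poly_Mapping.lookup w k) * x)"
    by (simp only: of_int_mult mult.assoc)
  also have "of_int (Poly_Mapping.lookup w k) * x = contr k x * ext_incl w"
    using eq Cons.prems(1) p by auto
  also have "of_int c * (contr k x * ext_incl w) = of_int c * contr k x * ext_incl w"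
    by (simp only: mult.assoc)
  also have "\<dots> = fold contr (map fst ps) (contr k x) * wedge (rev (map snd ps)) * ext_incl w"
    by (simp only: IH)
  finally show ?case by (simp add: p mult.assoc)
qed

lemma wedge_divisible:
  assumes "prime p" "\<And>ks. p dvd pairing ks (wedge ms)"
  shows "\<exists>ns. length ns = length ms \<and> wedge ms = of_int p * wedge ns"
  using assms(2)
proof (induction ms rule: rev_induct)
  case Nil
  from Nil[of "[]"] have "p dvd 1" by (simp add: pairing_Nil)
  then show ?case using assms(1) not_prime_unit by blast
next
  case (snoc w ms)
  show ?case
  proof (cases "\<forall>ks. p dvd pairing ks (wedge ms)")
    case True
    then obtain ns where "length ns = length ms" "wedge ms = of_int p * wedge ns"
      using snoc.IH by blast
    then show ?thesis by (intro exI[of _ "ns @ [w]"]) (simp add: mult.assoc)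
  next
    case False
    then obtain ks where ks: "\<not> p dvd pairing ks (wedge ms)" by blast
    define X where "X = wedge ms"
    obtain K where K: "(\<Union>m\<in>set (ms @ [w]). Poly_Mapping.keys m) \<subseteq> {..<K}"
      using finite_nat_iff_bounded[of "\<Union>m\<in>set (ms @ [w]). Poly_Mapping.keys m"] by auto
    define u where "u = polar (pairing ks) K (X * ext_incl w)"
    define v where "v = polar (\<lambda>y. pairing ks (y * ext_incl w)) K X"
    have u: "u = frag_cmul (pairing ks X) w - v"
      unfolding u_def v_def using K by (intro polar_mult_incl pairing_add) auto
    have Xv: "X * ext_incl v = 0"
      unfolding v_def X_def using K
      by (intro wedge_mult_polar) (auto simp: distrib_right pairing_add)
    define u' where "u' = (\<Sum>k<K. Poly_Mapping.single k (Poly_Mapping.lookup u k div p))"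
    have "Poly_Mapping.lookup u' k = Poly_Mapping.lookup u k div p" for k
    proof -
      have "Poly_Mapping.lookup u' k = (\<Sum>l<K. if l = k then Poly_Mapping.lookup u l div p else 0)"
        unfolding u'_def lookup_sum by (intro sum.cong) (auto simp: lookup_single when_def)
      then show ?thesis by (simp add: u_def lookup_polar)
    qed
    moreover have "p dvd Poly_Mapping.lookup u k" for k
      using snoc.prems[of "k # ks"] by (simp add: u_def lookup_polar X_def pairing_Cons)
    ultimately have u': "u = frag_cmul p u'"
      by (intro poly_mapping_eqI) simp
    have "coprime (pairing ks X) p"
      using ks assms(1) X_def by (metis coprime_commute prime_imp_coprime)
    then obtain y q where yq: "y * pairing ks X + q * p = 1"
      by (metis bezout_int coprime_iff_gcd_eq_1)
    define w' where "w' = frag_cmul y u' + frag_cmul q w"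
    have w': "frag_cmul p w' = w - frag_cmul y v"
    proof -
      have "frag_cmul p w' = frag_cmul y u + frag_cmul (q * p) w"
        by (simp add: w'_def u' frag_cmul_distrib2 mult.commute)
      also have "\<dots> = frag_cmul (y * pairing ks X + q * p) w - frag_cmul y v"
        by (intro poly_mapping_eqI) (simp add: u lookup_add lookup_minus algebra_simps)
      finally show ?thesis by (simp add: yq)
    qed
    have "of_int p * (X * ext_incl w') = X * ext_incl (frag_cmul p w')"
      by (simp add: ext_incl_frag_cmul mult_of_int_left)
    also have "\<dots> = X * ext_incl w - of_int y * (X * ext_incl v)"
      by (simp add: w' ext_incl_diff right_diff_distrib ext_incl_frag_cmul mult_of_int_left)
    finally have "X * ext_incl w = of_int p * (X * ext_incl w')" using Xv by simp
    then show ?thesis by (intro exI[of _ "ms @ [w']"]) (simp add: X_def)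
  qed
qed


section \<open>Integral spans\<close>

definition int_span :: "'i set \<Rightarrow> ('i \<Rightarrow> 'v::ring_1) \<Rightarrow> 'v set" where
  "int_span I v = pm_extend v ` {c. Poly_Mapping.keys c \<subseteq> I}"

lemma int_span_zero [simp, intro]: "0 \<in> int_span I v"
  unfolding int_span_def by (rule image_eqI[of _ _ 0]) simp_all

lemma int_span_add [intro]: "x \<in> int_span I v \<Longrightarrow> y \<in> int_span I v \<Longrightarrow> x + y \<in> int_span I v"
proof -
  assume "x \<in> int_span I v" "y \<in> int_span I v"
  then obtain c d where "x = pm_extend v c" "y = pm_extend v d"
    "Poly_Mapping.keys c \<subseteq> I" "Poly_Mapping.keys d \<subseteq> I" by (auto simp: int_span_def)
  then show ?thesis
    unfolding int_span_def using keys_add[of c d]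
    by (intro image_eqI[of _ _ "c + d"]) (auto simp: pm_extend_add)
qed

lemma int_span_uminus [intro]: "x \<in> int_span I v \<Longrightarrow> - x \<in> int_span I v"
proof -
  assume "x \<in> int_span I v"
  then obtain c where "x = pm_extend v c" "Poly_Mapping.keys c \<subseteq> I" by (auto simp: int_span_def)
  then show ?thesis
    unfolding int_span_def by (intro image_eqI[of _ _ "- c"]) (auto simp: pm_extend_uminus)
qed

lemma int_span_uminus_iff [simp]: "- x \<in> int_span I v \<longleftrightarrow> x \<in> int_span I v"
  using int_span_uminus[of x I v] int_span_uminus[of "- x" I v] by auto

lemma int_span_diff [intro]: "x \<in> int_span I v \<Longrightarrow> y \<in> int_span I v \<Longrightarrow> x - y \<in> int_span I v"
  using int_span_add[of x I v "- y"] int_span_uminus[of y I v] by simp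

lemma int_span_base [intro]: "i \<in> I \<Longrightarrow> v i \<in> int_span I v"
  unfolding int_span_def by (rule image_eqI[of _ _ "Poly_Mapping.single i 1"]) simp_all

lemma int_span_of_int_mult [intro]: "x \<in> int_span I v \<Longrightarrow> of_int c * x \<in> int_span I v"
  by (induction c rule: int_induct[of _ 0]) (auto simp: distrib_right left_diff_distrib)

lemma int_span_sum [intro]: "(\<And>a. a \<in> A \<Longrightarrow> f a \<in> int_span I v) \<Longrightarrow> sum f A \<in> int_span I v"
  by (induction A rule: infinite_finite_induct) auto

lemma int_span_sign_mult [intro]: "x \<in> int_span I v \<Longrightarrow> (- 1) ^ n * x \<in> int_span I v"
  by (cases "even n") auto

lemma int_span_induct [consumes 1, case_names zero add uminus base]:
  assumes "x \<in> int_span I v" and "P 0" "\<And>x y. P x \<Longrightarrow> P y \<Longrightarrow> P (x + y)" "\<And>x. P x \<Longrightarrow> P (- x)"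
    "\<And>i. i \<in> I \<Longrightarrow> P (v i)"
  shows "P x"
proof -
  obtain c where c: "x = pm_extend v c" "Poly_Mapping.keys c \<subseteq> I"
    using assms(1) by (auto simp: int_span_def)
  from c(2) have "P (pm_extend v c)"
  proof (induction c rule: frag_induction)
    case (diff a b)
    then have "P (pm_extend v a + - pm_extend v b)" using assms(3,4) by blast
    then show ?case by (simp add: pm_extend_diff)
  qed (simp_all add: assms(2,5))
  then show ?thesis using c by simp
qed


section \<open>Sorting of alternating expressions\<close>

lemma swap_closed_move:
  assumes "\<And>xs a b ys. P (xs @ a # b # ys) \<Longrightarrow> P (xs @ b # a # ys)"
  shows "P (pre @ a # ys @ zs) \<longleftrightarrow> P (pre @ ys @ a # zs)"
proof (induction ys arbitrary: pre)
  case (Cons y ys)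
  have "P (pre @ a # y # ys @ zs) \<longleftrightarrow> P (pre @ y # a # ys @ zs)" using assms by blast
  also have "\<dots> \<longleftrightarrow> P (pre @ y # ys @ a # zs)" using Cons.IH[of "pre @ [y]"] by simp
  finally show ?case by simp
qed simp

lemma swap_closed_mset:
  assumes "\<And>xs a b ys. P (xs @ a # b # ys) \<Longrightarrow> P (xs @ b # a # ys)" "mset xs = mset ys"
  shows "P (pre @ xs) \<longleftrightarrow> P (pre @ ys)"
  using assms(2)
proof (induction xs arbitrary: pre ys)
  case (Cons a xs)
  then have "a \<in> set ys" by (metis list.set_intros(1) mset_eq_setD)
  then obtain us vs where ys: "ys = us @ a # vs" by (meson split_list)
  then have "mset xs = mset (us @ vs)" using Cons.prems by simp
  then have "P (pre @ a # xs) \<longleftrightarrow> P (pre @ a # us @ vs)" using Cons.IH[of "us @ vs" "pre @ [a]"] by simp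
  also have "\<dots> \<longleftrightarrow> P (pre @ us @ a # vs)" by (rule swap_closed_move[of P, OF assms(1)])
  finally show ?case by (simp add: ys)
qed simp

lemma swap_closed_all:
  fixes P :: "int list \<Rightarrow> bool"
  assumes swap: "\<And>xs a b ys. P (xs @ a # b # ys) \<Longrightarrow> P (xs @ b # a # ys)"
    and dup: "\<And>xs a ys. length xs + length ys + 2 = r \<Longrightarrow> P (xs @ a # a # ys)"
    and sorted: "\<And>qs. length qs = r \<Longrightarrow> sorted_wrt (>) qs \<Longrightarrow> P qs"
    and "length qs = r"
  shows "P qs"
proof (cases "distinct qs")
  case True
  define ps where "ps = rev (sort qs)"
  have "sorted_wrt (<) (sort qs)" using True by (simp add: strict_sorted_iff)
  then have "sorted_wrt (>) ps" by (simp add: ps_def sorted_wrt_rev)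
  then have "P ps" using sorted assms(4) by (simp add: ps_def)
  moreover have "mset ps = mset qs" by (simp add: ps_def)
  ultimately show ?thesis using swap_closed_mset[of P ps qs "[]", OF swap] by simp
next
  case False
  then obtain us a vs ws where qs: "qs = us @ [a] @ vs @ [a] @ ws" using not_distinct_decomp by blast
  have "P (us @ a # a # vs @ ws)" using dup[of us "vs @ ws" a] assms(4) qs by simp
  then have "P ((us @ [a]) @ vs @ a # ws)"
    using swap_closed_move[of P "us @ [a]" a vs ws, OF swap] by simp
  then show ?thesis by (simp add: qs)
qed


section \<open>The monomial basis of the exterior power\<close>

definition bas :: "int \<Rightarrow> M0 ext" where
  "bas q = ext_incl (bvec q)"

text \<open>
  The list is read from right to left, so that a partition is listed by its decreasing parts
  and the contractions, which act from the right, start with the first entry.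
\<close>

definition bas_wedge :: "int list \<Rightarrow> M0 ext" where
  "bas_wedge qs = prod_list (rev (map bas qs))"

lemma bas_wedge_Nil [simp]: "bas_wedge [] = 1"
  and bas_wedge_Cons: "bas_wedge (q # qs) = bas_wedge qs * bas q"
  and bas_wedge_append: "bas_wedge (ps @ qs) = bas_wedge qs * bas_wedge ps"
  by (simp_all add: bas_wedge_def)

lemma bas_neg: "q < 0 \<Longrightarrow> bas q = 0"
  by (simp add: bas_def bvec_def ext_incl_zero)

lemma bas_wedge_neg: "q \<in> set qs \<Longrightarrow> q < 0 \<Longrightarrow> bas_wedge qs = 0"
  by (induction qs) (auto simp: bas_wedge_Cons bas_neg)

lemma bas_wedge_swap: "bas_wedge (ps @ b # a # qs) = - bas_wedge (ps @ a # b # qs)"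
proof -
  have "bas a * bas b = - (bas b * bas a)" unfolding bas_def by (rule ext_incl_anticommute)
  then have "bas_wedge (b # a # qs) = - bas_wedge (a # b # qs)"
    by (simp add: bas_wedge_Cons mult.assoc)
  then show ?thesis by (simp add: bas_wedge_append)
qed

lemma bas_wedge_dup: "bas_wedge (ps @ a # a # qs) = 0"
  by (simp add: bas_wedge_append bas_wedge_Cons mult.assoc) (simp add: bas_def ext_incl_square flip: mult.assoc[of "ext_incl _" "ext_incl _"])

lemma lookup_bvec: "Poly_Mapping.lookup (bvec q) k = (if q = int k then 1 else 0)"
  by (auto simp: bvec_def lookup_single when_def)

lemma contr_mult_bas: "contr k (x * bas q) = (if q = int k then x else 0) - contr k x * bas q"
  by (simp add: bas_def contr_mult_incl lookup_bvec)

definition remove_nth :: "nat \<Rightarrow> 'a list \<Rightarrow> 'a list" where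
  "remove_nth j xs = take j xs @ drop (Suc j) xs"

lemma contr_bas_wedge:
  "contr k (bas_wedge qs) =
     (\<Sum>j<length qs. (- 1) ^ j * (if qs ! j = int k then bas_wedge (remove_nth j qs) else 0))"
proof (induction qs)
  case (Cons q qs)
  define f where "f ps j = (- 1) ^ j * (if ps ! j = int k then bas_wedge (remove_nth j ps) else 0)" for ps j
  have IH: "contr k (bas_wedge qs) = (\<Sum>j<length qs. f qs j)" using Cons.IH by (simp add: f_def)
  have "f (q # qs) (Suc j) = - (f qs j * bas q)" for j
    by (simp add: f_def remove_nth_def bas_wedge_Cons mult.assoc)
  then have "(\<Sum>j<length (q # qs). f (q # qs) j) = f (q # qs) 0 - (\<Sum>j<length qs. f qs j) * bas q"
    by (simp add: sum.lessThan_Suc_shift sum_negf sum_distrib_right del: sum.lessThan_Suc)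
  also have "\<dots> = contr k (bas_wedge (q # qs))"
    by (simp add: IH bas_wedge_Cons contr_mult_bas f_def remove_nth_def)
  finally show ?case by (simp add: f_def)
qed simp

lemma contr_bas_wedge_notin: "int k \<notin> set qs \<Longrightarrow> contr k (bas_wedge qs) = 0"
  by (induction qs) (auto simp: bas_wedge_Cons contr_mult_bas)

lemma pairing_mult_bas: "(\<And>k. k \<in> set ks \<Longrightarrow> int k \<noteq> q) \<Longrightarrow> pairing ks (x * bas q) = 0"
proof (induction ks arbitrary: x)
  case Nil then show ?case by (simp add: pairing_Nil counit_mult bas_def)
next
  case (Cons k ks)
  then have "contr k (x * bas q) = - contr k x * bas q" by (auto simp: contr_mult_bas)
  then show ?case using Cons by (simp add: pairing_Cons pairing_uminus)
qed

lemma pairing_bas_wedge: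
  assumes "sorted_wrt (>) ps" "sorted_wrt (>) qs" "\<And>p. p \<in> set ps \<Longrightarrow> p \<ge> 0" "length ps = length qs"
  shows "pairing (map nat ps) (bas_wedge qs) = (if ps = qs then 1 else 0)"
  using assms
proof (induction qs arbitrary: ps)
  case Nil then show ?case by (simp add: pairing_Nil)
next
  case (Cons b qs)
  then obtain a ps' where ps: "ps = a # ps'" by (cases ps) auto
  have a: "a \<ge> 0" using Cons.prems(3) ps by auto
  show ?case
  proof (cases "a < b")
    case True
    then have "pairing (map nat ps) (bas_wedge qs * bas b) = 0"
      using Cons.prems(1,3) ps by (intro pairing_mult_bas) auto
    then show ?thesis using True by (simp add: bas_wedge_Cons ps)
  next
    case False
    then have "a \<notin> set qs" using Cons.prems(2) by auto
    then have "contr (nat a) (bas_wedge qs) = 0" using a by (intro contr_bas_wedge_notin) auto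
    then have "contr (nat a) (bas_wedge (b # qs)) = (if a = b then bas_wedge qs else 0)"
      using a by (auto simp: bas_wedge_Cons contr_mult_bas)
    then show ?thesis using Cons.IH[of ps'] Cons.prems ps by (auto simp: pairing_Cons)
  qed
qed

definition positions :: "nat \<Rightarrow> partn \<Rightarrow> int list" where
  "positions r lam = map (\<lambda>j. int (lam j) + int r - 1 - int j) [0..<r]"

lemma length_positions [simp]: "length (positions r lam) = r"
  by (simp add: positions_def)

lemma nth_positions [simp]: "j < r \<Longrightarrow> positions r lam ! j = int (lam j) + int r - 1 - int j"
  by (simp add: positions_def)

lemma bwedge_eq_bas_wedge: "bwedge r lam = bas_wedge (positions r lam)"
proof -
  have "map (\<lambda>k. ext_incl (bvec (int (k + lam (r - 1 - k))))) [0..<r] = rev (map bas (positions r lam))"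
    by (rule nth_equalityI) (auto simp: rev_nth bas_def positions_def add.commute)
  then show ?thesis by (simp add: bwedge_def bas_wedge_def)
qed

lemma sorted_positions: "antimono lam \<Longrightarrow> sorted_wrt (>) (positions r lam)"
  by (force simp: sorted_wrt_iff_nth_less dest: antimonoD[of lam _ _, OF _ less_imp_le])

lemma positions_nonneg: "q \<in> set (positions r lam) \<Longrightarrow> q \<ge> 0"
  by (auto simp: positions_def)

lemma positions_inj:
  assumes "lam \<in> Par_le r" "mu \<in> Par_le r" "positions r lam = positions r mu"
  shows "lam = mu"
proof
  fix j
  show "lam j = mu j"
  proof (cases "j < r")
    case True
    then show ?thesis using arg_cong[OF assms(3), of "\<lambda>qs. qs ! j"] by simp
  qed (use assms(1,2) in \<open>auto simp: Par_le_def\<close>)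
qed

lemma sorted_desc_gap:
  fixes qs :: "int list"
  assumes "sorted_wrt (>) qs" "i \<le> j" "j < length qs"
  shows "qs ! j + int (j - i) \<le> qs ! i"
  using assms(2,3)
proof (induction j rule: dec_induct)
  case (step j)
  have "qs ! Suc j < qs ! j" using assms(1) step.prems by (simp add: sorted_wrt_iff_nth_less)
  then show ?case using step by (simp add: Suc_diff_le)
qed simp

lemma positions_surj:
  fixes qs :: "int list"
  assumes "sorted_wrt (>) qs" "\<And>q. q \<in> set qs \<Longrightarrow> q \<ge> 0"
  obtains lam where "lam \<in> Par_le (length qs)" "positions (length qs) lam = qs"
proof -
  let ?r = "length qs"
  define lam where "lam j = (if j < ?r then nat (qs ! j + 1 + int j - int ?r) else 0)" for j
  have ge: "qs ! j + 1 + int j - int ?r \<ge> 0" if "j < ?r" for j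
  proof -
    have "qs ! (?r - 1) \<ge> 0" using that by (intro assms(2) nth_mem) auto
    moreover have "qs ! (?r - 1) + int (?r - 1 - j) \<le> qs ! j"
      using that by (intro sorted_desc_gap assms(1)) auto
    ultimately show ?thesis using that by linarith
  qed
  have "lam j \<le> lam i" if "i \<le> j" for i j
    using sorted_desc_gap[OF assms(1), of i j] that ge by (auto simp: lam_def)
  then have "lam \<in> Par_le ?r" by (auto simp: Par_le_def antimono_def lam_def)
  moreover have "positions ?r lam = qs"
    by (rule nth_equalityI) (use ge in \<open>auto simp: lam_def\<close>)
  ultimately show thesis by (rule that)
qed

lemma bas_wedge_in_span: "bas_wedge qs \<in> int_span (Par_le (length qs)) (bwedge (length qs))"
proof -
  define P where "P ps \<longleftrightarrow> bas_wedge ps \<in> int_span (Par_le (length qs)) (bwedge (length qs))" for ps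
  have "P qs"
  proof (rule swap_closed_all[of P "length qs"])
    fix xs a b ys assume "P (xs @ a # b # ys)"
    then show "P (xs @ b # a # ys)" by (simp add: P_def bas_wedge_swap[of xs b a ys])
  next
    fix ps :: "int list" assume ps: "length ps = length qs" "sorted_wrt (>) ps"
    show "P ps"
    proof (cases "\<forall>p\<in>set ps. p \<ge> 0")
      case True
      then obtain lam where "lam \<in> Par_le (length qs)" "positions (length qs) lam = ps"
        using positions_surj[of ps] ps by auto
      then show ?thesis unfolding P_def by (metis bwedge_eq_bas_wedge int_span_base)
    qed (auto simp: P_def not_le bas_wedge_neg)
  qed (simp_all add: P_def bas_wedge_dup)
  then show ?thesis by (simp add: P_def)
qed

lemma ext_incl_eq_pm_extend: "ext_incl m = pm_extend (\<lambda>k. bas (int k)) m"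
  by (induction m rule: pm_induct)
    (simp_all add: ext_incl_zero ext_incl_add ext_incl_uminus pm_extend_add pm_extend_uminus bas_def bvec_def)

lemma int_span_mult_incl:
  assumes "x \<in> int_span (Par_le r) (bwedge r)"
  shows "x * ext_incl m \<in> int_span (Par_le (Suc r)) (bwedge (Suc r))"
  using assms
proof (induction rule: int_span_induct)
  case (base lam)
  have "bwedge r lam * bas (int k) \<in> int_span (Par_le (Suc r)) (bwedge (Suc r))" for k
    using bas_wedge_in_span[of "int k # positions r lam"] by (simp add: bas_wedge_Cons bwedge_eq_bas_wedge)
  then show ?case
    unfolding ext_incl_eq_pm_extend pm_extend_def sum_distrib_left mult_of_int_left
    by (intro int_span_sum int_span_of_int_mult)
qed (auto simp: distrib_right)

lemma wedge_in_span: "wedge ms \<in> int_span (Par_le (length ms)) (bwedge (length ms))"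
proof (induction ms rule: rev_induct)
  case Nil then show ?case using bas_wedge_in_span[of "[]"] by simp
next
  case (snoc m ms) then show ?case using int_span_mult_incl[OF snoc.IH, of m] by simp
qed

lemma bwedge_in_wedge_power: "bwedge r lam \<in> wedge_power r"
proof -
  have "bwedge r lam = wedge (map (\<lambda>k. bvec (int (k + lam (r - 1 - k)))) [0..<r])"
    by (simp add: bwedge_def o_def)
  then show ?thesis by (metis wedge_power.wedge length_map length_upt minus_nat.diff_0)
qed

lemma wedge_power_eq_span: "wedge_power r = int_span (Par_le r) (bwedge r)"
proof (intro equalityI subsetI)
  fix x assume "x \<in> wedge_power r"
  then show "x \<in> int_span (Par_le r) (bwedge r)"
    by (induction rule: wedge_power.induct) (use wedge_in_span in auto)
next
  fix x assume "x \<in> int_span (Par_le r) (bwedge r)"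
  then show "x \<in> wedge_power r"
    by (induction rule: int_span_induct)
      (auto intro: wedge_power.intros(1-3) bwedge_in_wedge_power)
qed

lemma pairing_bwedge:
  assumes "lam \<in> Par_le r" "mu \<in> Par_le r"
  shows "pairing (map nat (positions r mu)) (bwedge r lam) = (if lam = mu then 1 else 0)"
  using pairing_bas_wedge[of "positions r mu" "positions r lam"] positions_inj[of lam r mu] assms
  by (auto simp: bwedge_eq_bas_wedge sorted_positions positions_nonneg Par_le_def)

lemma pairing_coeff:
  assumes "Poly_Mapping.keys c \<subseteq> Par_le r" "mu \<in> Par_le r"
  shows "pairing (map nat (positions r mu)) (pm_extend (bwedge r) c) = Poly_Mapping.lookup c mu"
proof -
  have "pairing (map nat (positions r mu)) (pm_extend (bwedge r) c) =
      (\<Sum>lam\<in>Poly_Mapping.keys c. Poly_Mapping.lookup c lam * (if lam = mu then 1 else 0))"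
    unfolding pm_extend_def pairing_sum pairing_of_int_mult
    using assms by (intro sum.cong) (auto simp: pairing_bwedge)
  also have "\<dots> = (\<Sum>lam\<in>Poly_Mapping.keys c. if lam = mu then Poly_Mapping.lookup c lam else 0)"
    by (intro sum.cong) auto
  also have "\<dots> = Poly_Mapping.lookup c mu"
    by (simp add: in_keys_iff)
  finally show ?thesis .
qed

lemma wedge_power_nondegenerate:
  assumes "x \<in> wedge_power r" "\<And>mu. mu \<in> Par_le r \<Longrightarrow> pairing (map nat (positions r mu)) x = 0"
  shows "x = 0"
proof -
  obtain c where c: "x = pm_extend (bwedge r) c" "Poly_Mapping.keys c \<subseteq> Par_le r"
    using assms(1) by (auto simp: wedge_power_eq_span int_span_def)
  have "Poly_Mapping.lookup c mu = 0" for mu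
    using assms(2)[of mu] pairing_coeff[OF c(2), of mu] c by (cases "mu \<in> Par_le r") (auto simp: in_keys_iff)
  then have "c = 0" by (intro poly_mapping_eqI) simp
  then show ?thesis by (simp add: c)
qed

lemma wedge_power_cancel:
  assumes "x \<in> wedge_power r" "y \<in> wedge_power r" "of_int d * x = of_int d * y" "d \<noteq> 0"
  shows "x = y"
proof -
  have "of_int d * (x - y) = 0" using assms(3) by (simp add: right_diff_distrib)
  then have "d * pairing ks (x - y) = 0" for ks using pairing_of_int_mult[of ks d "x - y"] by simp
  then have "x - y = 0" using assms by (intro wedge_power_nondegenerate wedge_power_diff) auto
  then show ?thesis by simp
qed

lemma decomposable_of_multiple:
  assumes "x \<in> wedge_power r" "0 < r" "length ms = r" "of_int d * x = wedge ms" "d \<noteq> 0"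
  shows "x \<in> decomposable r"
  using assms(3-5)
proof (induction "nat \<bar>d\<bar>" arbitrary: d ms rule: less_induct)
  case less
  show ?case
  proof (cases "\<bar>d\<bar> = 1")
    case True
    obtain n ns where ms: "ms = n # ns" using less.prems assms(2) by (cases ms) auto
    have "x = of_int d * (of_int d * x)" using True by (cases "d = 1") (auto simp: abs_if split: if_splits)
    also have "\<dots> = wedge (frag_cmul d n # ns)" using less.prems ms by (simp add: ext_incl_frag_cmul mult.assoc)
    finally show ?thesis using less.prems ms unfolding decomposable_def
      by (intro CollectI exI[of _ "frag_cmul d n # ns"]) simp
  next
    case False
    then have "\<not> is_unit d" by simp
    then obtain p where p: "p dvd d" "prime p" using less.prems(3) prime_divisor_exists by blast
    then obtain e where d: "d = p * e" by blast
    have "p dvd pairing ks (wedge ms)" for ks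
      using p(1) pairing_of_int_mult[of ks d x] less.prems(2) by simp
    then obtain ns where ns: "length ns = length ms" "wedge ms = of_int p * wedge ns"
      using wedge_divisible p(2) by blast
    have "of_int e * x = wedge ns"
    proof (rule wedge_power_cancel[where d = p and r = r])
      show "of_int p * (of_int e * x) = of_int p * wedge ns"
        using less.prems(2) ns(2) d by (simp add: mult.assoc)
    qed (use less.prems ns p assms(1) in \<open>auto intro: wedge_power.wedge wedge_power_of_int_mult\<close>)
    moreover have "nat \<bar>e\<bar> < nat \<bar>d\<bar>"
      using p(2) less.prems(3) prime_gt_1_int[of p] by (simp add: d abs_mult)
    ultimately show ?thesis using less.hyps[of e ns] less.prems ns d by auto
  qed
qed

lemma plucker_imp_decomposable:
  assumes T: "T \<in> wedge_power r" and r: "0 < r"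
    and plucker: "\<And>K ks. K \<ge> K0 \<Longrightarrow> T * ext_incl (polar (pairing ks) K T) = 0"
  shows "T \<in> decomposable r"
proof (cases "T = 0")
  case True
  have "wedge (replicate r 0) = 0" using r by (cases r) (auto simp: ext_incl_zero)
  then show ?thesis unfolding decomposable_def True
    by (metis (mono_tags, lifting) CollectI length_replicate)
next
  case False
  then obtain mu where mu: "mu \<in> Par_le r" "pairing (map nat (positions r mu)) T \<noteq> 0"
    using wedge_power_nondegenerate[OF T] by blast
  define I where "I = map nat (positions r mu)"
  have "distinct (positions r mu)"
    using sorted_positions[of mu r] mu(1) strict_sorted_iff[of "rev (positions r mu)"]
    by (simp add: Par_le_def sorted_wrt_rev)
  then have dist: "distinct I"
    unfolding I_def distinct_map by (auto simp: inj_on_def dest!: positions_nonneg)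
  have len: "length I = r" by (simp add: I_def)
  obtain K1 where K1: "set I \<subseteq> {..<K1}" using finite_nat_iff_bounded[of "set I"] by auto
  define K where "K = max K0 K1"
  define w where "w a = polar (pairing (remove_nth a I)) K T" for a
  define ps where "ps = map (\<lambda>a. (I ! a, w a)) [0..<r]"
  have look: "Poly_Mapping.lookup (w b) (I ! a) = pairing (I ! a # remove_nth b I) T" if "a < r" for a b
  proof -
    have "I ! a \<in> set I" using that len by simp
    then have "I ! a < K" using K1 by (auto simp: K_def)
    then show ?thesis by (simp add: w_def lookup_polar pairing_Cons)
  qed
  have split: "I = take a I @ I ! a # drop (Suc a) I" if "a < r" for a
    using that len by (simp add: id_take_nth_drop)
  have diag: "Poly_Mapping.lookup (w a) (I ! a) \<noteq> 0" if a: "a < r" for a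
  proof -
    have "\<exists>c\<in>{1, -1}. pairing I T = c * pairing (I ! a # remove_nth a I) T"
      using pairing_move[of "take a I" "I ! a" "drop (Suc a) I" T] unfolding split[OF a, symmetric] remove_nth_def .
    then show ?thesis using mu(2) look[OF a] by (auto simp: I_def)
  qed
  have off: "Poly_Mapping.lookup (w b) (I ! a) = 0" if "a < b" "b < r" for a b
  proof -
    have "I ! a \<in> set (take b I)" using that len by (auto simp: in_set_conv_nth)
    then have "I ! a \<in> set (remove_nth b I)" by (auto simp: remove_nth_def)
    then show ?thesis using look[of a b] that pairing_repeated by simp
  qed
  define d where "d = (\<Prod>p\<leftarrow>ps. Poly_Mapping.lookup (snd p) (fst p))"
  define vs where "vs = rev (map snd ps)"
  have "of_int d * T = fold contr (map fst ps) T * wedge vs"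
    unfolding d_def vs_def
  proof (rule contr_annihilators)
    fix k v assume "(k, v) \<in> set ps"
    then show "T * ext_incl v = 0" using plucker[of K] by (auto simp: ps_def w_def K_def)
  qed (auto simp: ps_def sorted_wrt_iff_nth_less off)
  also have "map fst ps = I" by (rule nth_equalityI) (auto simp: ps_def len)
  also have "fold contr I T = of_int (pairing I T)"
    using T len by (intro fold_contr_wedge_power) simp
  finally have eq: "of_int d * T = of_int (pairing I T) * wedge vs" .
  obtain n ns where vs: "vs = n # ns" using r by (cases vs) (auto simp: vs_def ps_def)
  have "length vs = r" by (simp add: vs_def ps_def)
  then have "length (frag_cmul (pairing I T) n # ns) = r" by (simp add: vs)
  moreover have "of_int d * T = wedge (frag_cmul (pairing I T) n # ns)"
    by (simp add: eq vs ext_incl_frag_cmul mult.assoc)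
  moreover have "d \<noteq> 0" using diag by (auto simp: d_def ps_def prod_list_zero_iff)
  ultimately show ?thesis by (rule decomposable_of_multiple[OF T r])
qed


section \<open>Bases and additive extension\<close>

definition int_indep :: "'i set \<Rightarrow> ('i \<Rightarrow> 'v::ring_1) \<Rightarrow> bool" where
  "int_indep I v \<longleftrightarrow> (\<forall>c. Poly_Mapping.keys c \<subseteq> I \<longrightarrow> pm_extend v c = 0 \<longrightarrow> c = 0)"

lemma int_indep_coords:
  assumes "int_indep I v" "Poly_Mapping.keys c \<subseteq> I"
  shows "coords (\<lambda>k y. of_int k * y) I v (pm_extend v c) = c"
  unfolding coords_def pm_extend_def[symmetric]
proof (rule the_equality)
  fix d assume d: "Poly_Mapping.keys d \<subseteq> I \<and> pm_extend v d = pm_extend v c"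
  then have "pm_extend v (d - c) = 0" by (simp add: pm_extend_diff)
  moreover have "Poly_Mapping.keys (d - c) \<subseteq> I" using d assms(2) keys_diff[of d c] by auto
  ultimately have "d - c = 0" using assms(1) by (auto simp: int_indep_def)
  then show "d = c" by simp
qed (use assms in auto)

lemma additive_ext_pm_extend:
  assumes "int_indep I v" "Poly_Mapping.keys c \<subseteq> I"
  shows "additive_ext I v w (pm_extend v c) = pm_extend w c"
  unfolding additive_ext_def int_indep_coords[OF assms] Let_def pm_extend_def[symmetric] ..

context
  fixes I :: "'i set" and v :: "'i \<Rightarrow> 'v::ring_1" and w :: "'i \<Rightarrow> 'w::ring_1"
  assumes indep: "int_indep I v"
begin

lemma additive_ext_add:
  assumes "x \<in> int_span I v" "y \<in> int_span I v"
  shows "additive_ext I v w (x + y) = additive_ext I v w x + additive_ext I v w y"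
proof -
  obtain c d where c: "x = pm_extend v c" "Poly_Mapping.keys c \<subseteq> I"
    and d: "y = pm_extend v d" "Poly_Mapping.keys d \<subseteq> I" using assms by (auto simp: int_span_def)
  have "Poly_Mapping.keys (c + d) \<subseteq> I" using keys_add[of c d] c(2) d(2) by auto
  then show ?thesis
    using c d by (simp add: additive_ext_pm_extend[OF indep] flip: pm_extend_add)
qed

lemma additive_ext_uminus:
  assumes "x \<in> int_span I v"
  shows "additive_ext I v w (- x) = - additive_ext I v w x"
proof -
  obtain c where c: "x = pm_extend v c" "Poly_Mapping.keys c \<subseteq> I"
    using assms by (auto simp: int_span_def)
  then show ?thesis
    by (simp add: additive_ext_pm_extend[OF indep] flip: pm_extend_uminus)
qed

lemma additive_ext_zero: "additive_ext I v w 0 = 0"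
  using additive_ext_pm_extend[OF indep, of 0 w] by simp

lemma additive_ext_sum:
  "(\<And>a. a \<in> A \<Longrightarrow> f a \<in> int_span I v) \<Longrightarrow>
    additive_ext I v w (sum f A) = (\<Sum>a\<in>A. additive_ext I v w (f a))"
  by (induction A rule: infinite_finite_induct)
    (auto simp: additive_ext_zero additive_ext_add int_span_sum)

end


section \<open>Determinants of the coefficients of a power series\<close>

definition seq_det :: "(int \<Rightarrow> 'a::comm_ring_1) \<Rightarrow> int list \<Rightarrow> 'a" where
  "seq_det c qs = det (mat (length qs) (length qs) (\<lambda>(i, j). c (qs ! j + 1 + int i - int (length qs))))"

lemma schur_det_eq_seq_det: "schur_det r c lam = seq_det c (positions r lam)"
  unfolding schur_det_def seq_det_def
  by (rule arg_cong[of _ _ det], rule eq_matI) (auto simp: algebra_simps)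

lemma schur_det_Suc:
  assumes "lam r = 0" "c 0 = 1" "\<And>j. j < 0 \<Longrightarrow> c j = 0"
  shows "schur_det (Suc r) c lam = schur_det r c lam"
proof -
  let ?A = "mat (Suc r) (Suc r) (\<lambda>(i, j). c (int (lam j) - int j + int i))"
  have "det ?A = (\<Sum>i<Suc r. ?A $$ (i, r) * cofactor ?A i r)"
    by (rule laplace_expansion_column) auto
  also have "\<dots> = (\<Sum>i<Suc r. if i = r then cofactor ?A r r else 0)"
    using assms by (intro sum.cong) auto
  also have "\<dots> = det (mat_delete ?A r r)" by (simp add: cofactor_def)
  also have "mat_delete ?A r r = mat r r (\<lambda>(i, j). c (int (lam j) - int j + int i))"
    by (rule eq_matI) (auto simp: mat_delete_def)
  finally show ?thesis by (simp add: schur_det_def)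
qed

lemma schur_det_stable:
  assumes "lam \<in> Par_le l" "l \<le> r" "c 0 = 1" "\<And>j. j < 0 \<Longrightarrow> c j = 0"
  shows "schur_det r c lam = schur_det l c lam"
  using assms(2)
proof (induction r rule: dec_induct)
  case (step n)
  then have "lam n = 0" using assms(1) by (simp add: Par_le_def)
  then show ?case using schur_det_Suc[of lam n c] assms(3,4) step.IH by simp
qed simp

lemma Par_le_support: "lam \<in> Par_le r \<Longrightarrow> {i. lam i \<noteq> 0} \<subseteq> {..<r}"
  unfolding Par_le_def by (auto intro: ccontr)

lemma par_length_le: "lam \<in> Par_le r \<Longrightarrow> par_length lam \<le> r"
proof -
  assume "lam \<in> Par_le r"
  then have "{i. lam i \<noteq> 0} \<subseteq> {..<r}" by (rule Par_le_support)
  then show ?thesis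
    using card_mono[of "{..<r}" "{i. lam i \<noteq> 0}"] by (simp add: par_length_def)
qed

lemma Par_le_par_length:
  assumes "lam \<in> Par"
  shows "lam \<in> Par_le (par_length lam)"
proof -
  obtain r where r: "lam \<in> Par_le r" using assms by (auto simp: Par_def)
  then have anti: "antimono lam" by (simp add: Par_le_def)
  have "lam i = 0" if "i \<ge> par_length lam" for i
  proof (rule ccontr)
    assume "lam i \<noteq> 0"
    then have "{..i} \<subseteq> {j. lam j \<noteq> 0}" using antimonoD[OF anti] by fastforce
    moreover have "finite {j. lam j \<noteq> 0}"
      using Par_le_support[OF r] by (rule finite_subset) simp
    ultimately have "Suc i \<le> par_length lam"
      using card_mono[of "{j. lam j \<noteq> 0}" "{..i}"] by (simp add: par_length_def)
    then show False using that by simp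
  qed
  then show ?thesis using anti by (simp add: Par_le_def)
qed

lemma Par_le_mono: "lam \<in> Par_le l \<Longrightarrow> l \<le> r \<Longrightarrow> lam \<in> Par_le r"
  by (auto simp: Par_le_def)

lemma Par_le_subset_Par: "lam \<in> Par_le r \<Longrightarrow> lam \<in> Par"
  by (auto simp: Par_def)

lemma fps_recip_nth_0: "fps_nth (fps_recip f) 0 = 1"
  by (simp add: fps_recip_def)

lemma fps_recip_mult: "fps_nth f 0 = 1 \<Longrightarrow> f * fps_recip f = 1"
  unfolding fps_recip_def by (rule fps_right_inverse) simp

lemma fps_coeff_int_0 [simp]: "fps_coeff_int f 0 = fps_nth f 0"
  and fps_coeff_int_neg [simp]: "j < 0 \<Longrightarrow> fps_coeff_int f j = 0"
  by (simp_all add: fps_coeff_int_def)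

lemma Hinf_0 [simp]: "Hinf 0 = 1" and Hinf_neg [simp]: "j < 0 \<Longrightarrow> Hinf j = 0"
  by (simp_all add: Hinf_def fps_recip_nth_0)

lemma Hfin_0 [simp]: "Hfin r 0 = 1" and Hfin_neg [simp]: "j < 0 \<Longrightarrow> Hfin r j = 0"
  by (simp_all add: Hfin_def fps_recip_nth_0)

lemma schur_inf_eq: "lam \<in> Par_le r \<Longrightarrow> schur_inf lam = schur_det r Hinf lam"
  unfolding schur_inf_def
  by (rule schur_det_stable[symmetric])
    (auto simp: par_length_le Par_le_par_length Par_le_subset_Par)

lemma fps_recip_nth_cong:
  assumes "\<And>i. i \<le> n \<Longrightarrow> fps_nth f i = fps_nth g i"
  shows "fps_nth (fps_recip f) n = fps_nth (fps_recip g) n"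
  using assms
proof (induction n rule: less_induct)
  case (less n)
  show ?case
  proof (cases n)
    case (Suc m)
    have "fps_nth f i * fps_nth (fps_recip f) (n - i) = fps_nth g i * fps_nth (fps_recip g) (n - i)"
      if "i \<in> {1..n}" for i
      using less that by simp
    then have "(\<Sum>i\<in>{1..n}. fps_nth f i * fps_nth (fps_recip f) (n - i)) =
        (\<Sum>i\<in>{1..n}. fps_nth g i * fps_nth (fps_recip g) (n - i))" by (rule sum.cong[OF refl])
    then show ?thesis by (simp add: Suc fps_recip_def)
  qed (simp add: fps_recip_nth_0)
qed

lemma Hfin_eq_Hinf: "j \<le> int r \<Longrightarrow> Hfin r j = Hinf j"
  by (auto simp: Hfin_def Hinf_def fps_coeff_int_def Efin_def Einf_def intro!: fps_recip_nth_cong)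

lemma schur_inf_eq_Hfin:
  assumes "lam \<in> Par_le l" "lam 0 + l \<le> r"
  shows "schur_inf lam = schur_det r (Hfin r) lam"
proof -
  have le: "lam j \<le> lam 0" for j using assms(1) by (auto simp: Par_le_def dest: antimonoD)
  have "int (lam j) - int j + int i \<le> int r" if "i < l" for i j
    using that assms(2) le[of j] by linarith
  then have "schur_det l (Hfin r) lam = schur_det l Hinf lam"
    unfolding schur_det_def by (intro arg_cong[of _ _ det] eq_matI) (auto intro!: Hfin_eq_Hinf)
  moreover have "schur_det r (Hfin r) lam = schur_det l (Hfin r) lam"
    using assms by (intro schur_det_stable) auto
  ultimately show ?thesis using schur_inf_eq[OF assms(1)] by simp
qed

lemma schur_inf_eventually_Hfin:
  assumes "finite A" "A \<subseteq> Par"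
  shows "\<exists>R. \<forall>r\<ge>R. \<forall>lam\<in>A. lam \<in> Par_le r \<and> schur_inf lam = schur_det r (Hfin r) lam"
proof -
  define R where "R = (\<Sum>lam\<in>A. lam 0 + par_length lam)"
  have "lam \<in> Par_le r \<and> schur_inf lam = schur_det r (Hfin r) lam" if "r \<ge> R" "lam \<in> A" for r lam
  proof -
    have "lam 0 + par_length lam \<le> R" unfolding R_def using that(2) assms(1)
      by (intro member_le_sum) auto
    then show ?thesis
      using that assms(2) schur_inf_eq_Hfin[of lam "par_length lam" r]
      by (auto intro!: Par_le_mono[OF Par_le_par_length])
  qed
  then show ?thesis by blast
qed


section \<open>Linear independence of the Schur determinants\<close>

definition subst :: "(nat \<Rightarrow> Binf) \<Rightarrow> Binf \<Rightarrow> Binf" where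
  "subst s = pm_extend (\<lambda>m. \<Prod>v\<in>Poly_Mapping.keys m. s v ^ Poly_Mapping.lookup m v)"

lemma subst_mult: "subst s (p * q) = subst s p * subst s q"
  unfolding subst_def
proof (rule pm_extend_mult)
  fix k l :: "nat \<Rightarrow>\<^sub>0 nat"
  let ?A = "Poly_Mapping.keys k \<union> Poly_Mapping.keys l"
  have *: "(\<Prod>v\<in>Poly_Mapping.keys m. s v ^ Poly_Mapping.lookup m v) = (\<Prod>v\<in>?A. s v ^ Poly_Mapping.lookup m v)"
    if "Poly_Mapping.keys m \<subseteq> ?A" for m
    using that by (intro prod.mono_neutral_left) (auto simp: in_keys_iff)
  show "(\<Prod>v\<in>Poly_Mapping.keys (k + l). s v ^ Poly_Mapping.lookup (k + l) v) =
      (\<Prod>v\<in>Poly_Mapping.keys k. s v ^ Poly_Mapping.lookup k v) * (\<Prod>v\<in>Poly_Mapping.keys l. s v ^ Poly_Mapping.lookup l v)"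
    using *[of "k + l"] *[of k] *[of l] keys_add[of k l]
    by (simp add: lookup_add power_add prod.distrib)
qed

lemma subst_one: "subst s 1 = 1"
  by (simp add: subst_def flip: single_one)

lemma subst_add: "subst s (p + q) = subst s p + subst s q"
  by (simp add: subst_def pm_extend_add)

lemma comm_ring_hom_subst: "comm_ring_hom (subst s)"
  by unfold_locales
    (simp_all add: subst_mult subst_one subst_add additive_zero[of "subst s", OF subst_add])

lemma subst_evar: "i > 0 \<Longrightarrow> subst s (evar i) = s (i - 1)"
  by (simp add: subst_def evar_def)

definition xvar :: "nat \<Rightarrow> Binf" where
  "xvar k = Poly_Mapping.single (Poly_Mapping.single k 1) 1"

definition linear_prod :: "nat set \<Rightarrow> Binf fps" where
  "linear_prod A = (\<Prod>k\<in>A. 1 - fps_const (xvar k) * fps_X)"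

lemma linear_prod_nth_0: "fps_nth (linear_prod A) 0 = 1"
  unfolding linear_prod_def by (induction A rule: infinite_finite_induct) simp_all

lemma linear_prod_nth_large: "finite A \<Longrightarrow> card A < n \<Longrightarrow> fps_nth (linear_prod A) n = 0"
proof (induction A arbitrary: n rule: finite_induct)
  case empty then show ?case by (simp add: linear_prod_def)
next
  case (insert a A)
  obtain m where n: "n = Suc m" using insert.prems by (cases n) auto
  have "fps_nth (linear_prod (insert a A)) n =
      fps_nth (linear_prod A) n - fps_nth (fps_const (xvar a) * (fps_X * linear_prod A)) n"
    using insert.hyps by (simp add: linear_prod_def left_diff_distrib mult.assoc)
  also have "\<dots> = fps_nth (linear_prod A) (Suc m) - xvar a * fps_nth (linear_prod A) m"
    by (simp add: n)
  finally show ?case using insert by (simp add: n)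
qed

text \<open>The specialization of the \<open>e\<^sub>i\<close> to the elementary symmetric polynomials in \<open>r\<close> variables.\<close>

definition elem_spec :: "nat \<Rightarrow> Binf \<Rightarrow> Binf" where
  "elem_spec r = subst (\<lambda>i. (- 1) ^ Suc i * fps_nth (linear_prod {..<r}) (Suc i))"

lemma elem_spec_Efin: "elem_spec r (fps_nth (Efin r) n) = fps_nth (linear_prod {..<r}) n"
proof -
  interpret comm_ring_hom "elem_spec r" unfolding elem_spec_def by (rule comm_ring_hom_subst)
  have "n > 0 \<Longrightarrow> elem_spec r (evar n) = (- 1) ^ n * fps_nth (linear_prod {..<r}) n"
    by (cases n) (simp_all add: elem_spec_def subst_evar)
  moreover have "((- 1) ^ n :: Binf) * (- 1) ^ n = 1"
    by (simp flip: power_mult_distrib)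
  ultimately show ?thesis
    by (auto simp: Efin_def linear_prod_nth_0 linear_prod_nth_large hom_distribs mult.assoc[symmetric])
qed

definition H_spec :: "nat \<Rightarrow> Binf fps" where
  "H_spec r = Abs_fps (\<lambda>n. elem_spec r (fps_nth (fps_recip (Efin r)) n))"

lemma linear_prod_H_spec: "linear_prod {..<r} * H_spec r = 1"
proof (rule fps_ext)
  fix n
  interpret comm_ring_hom "elem_spec r" unfolding elem_spec_def by (rule comm_ring_hom_subst)
  have "fps_nth (linear_prod {..<r} * H_spec r) n = elem_spec r (fps_nth (Efin r * fps_recip (Efin r)) n)"
    by (simp add: fps_mult_nth H_spec_def elem_spec_Efin[symmetric] hom_distribs)
  also have "Efin r * fps_recip (Efin r) = 1" by (rule fps_recip_mult) (simp add: Efin_def)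
  finally show "fps_nth (linear_prod {..<r} * H_spec r) n = fps_nth 1 n"
    by (simp add: fps_one_nth)
qed

lemma fps_nth_geometric:
  fixes c :: "'a::comm_ring_1"
  assumes "(1 - fps_const c * fps_X) * f = 1"
  shows "fps_nth f n = c ^ n"
proof (induction n)
  case 0
  show ?case using arg_cong[OF assms, of "\<lambda>g. fps_nth g 0"] by simp
next
  case (Suc n)
  have "f - fps_const c * (fps_X * f) = 1" using assms by (simp add: left_diff_distrib mult.assoc)
  then have "fps_nth (f - fps_const c * (fps_X * f)) (Suc n) = 0" by simp
  then have "fps_nth f (Suc n) = c * fps_nth f n" by simp
  then show ?case using Suc by simp
qed

text \<open>
  Multiplying the complete symmetric functions by the elementary ones in all variables but
  \<open>x\<^sub>k\<close> leaves the powers of \<open>x\<^sub>k\<close>; so the alternant is a multiple of the Schur determinant.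
\<close>

lemma power_eq_sum_H_spec:
  assumes "k < r"
  shows "xvar k ^ m = (\<Sum>i<r. fps_nth (linear_prod ({..<r} - {k})) (r - 1 - i) *
    fps_coeff_int (H_spec r) (int m + 1 + int i - int r))"
proof -
  let ?L = "linear_prod ({..<r} - {k})"
  define f where "f i = fps_nth ?L i * fps_coeff_int (H_spec r) (int m - int i)" for i
  have "(1 - fps_const (xvar k) * fps_X) * (?L * H_spec r) = linear_prod {..<r} * H_spec r"
    using assms by (simp add: linear_prod_def prod.remove[of "{..<r}" k] mult.assoc)
  then have "xvar k ^ m = fps_nth (?L * H_spec r) m"
    by (simp add: linear_prod_H_spec fps_nth_geometric)
  also have "\<dots> = (\<Sum>i\<in>{0..m}. f i)"
    unfolding fps_mult_nth f_def by (intro sum.cong) (auto simp: fps_coeff_int_def simp flip: of_nat_diff)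
  also have "\<dots> = (\<Sum>i\<in>{0..m} \<inter> {..<r}. f i)"
  proof (intro sum.mono_neutral_right ballI)
    fix i assume "i \<in> {0..m} - {0..m} \<inter> {..<r}"
    then have "card ({..<r} - {k}) < i" using assms by auto
    then show "f i = 0" by (simp add: f_def linear_prod_nth_large)
  qed auto
  also have "\<dots> = (\<Sum>i<r. f i)"
  proof (intro sum.mono_neutral_left ballI)
    fix i assume "i \<in> {..<r} - {0..m} \<inter> {..<r}"
    then have "int m - int i < 0" by auto
    then show "f i = 0" by (simp add: f_def)
  qed auto
  also have "\<dots> = (\<Sum>i<r. f (r - Suc i))"
    by (rule sum.nat_diff_reindex[symmetric])
  also have "\<dots> = (\<Sum>i<r. fps_nth ?L (r - 1 - i) * fps_coeff_int (H_spec r) (int m + 1 + int i - int r))"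
    by (intro sum.cong) (auto simp: f_def of_nat_diff algebra_simps)
  finally show ?thesis .
qed

lemma alternant_eq:
  assumes "length qs = r" "\<And>q. q \<in> set qs \<Longrightarrow> q \<ge> 0"
  shows "det (mat r r (\<lambda>(k, j). xvar k ^ nat (qs ! j))) =
    det (mat r r (\<lambda>(k, i). fps_nth (linear_prod ({..<r} - {k})) (r - 1 - i))) *
    elem_spec r (seq_det (Hfin r) qs)"
    (is "det ?A = det ?N * _")
proof -
  interpret comm_ring_hom "elem_spec r" unfolding elem_spec_def by (rule comm_ring_hom_subst)
  let ?M = "mat r r (\<lambda>(i, j). fps_coeff_int (H_spec r) (qs ! j + 1 + int i - int r))"
  have "elem_spec r (Hfin r j) = fps_coeff_int (H_spec r) j" for j
    by (simp add: Hfin_def fps_coeff_int_def H_spec_def)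
  then have "elem_spec r (seq_det (Hfin r) qs) = det ?M"
    unfolding seq_det_def assms(1) hom_det[symmetric]
    by (intro arg_cong[of _ _ det] eq_matI) auto
  moreover have "?A = ?N * ?M"
  proof (rule eq_matI)
    fix k j assume "k < dim_row (?N * ?M)" "j < dim_col (?N * ?M)"
    then have kj: "k < r" "j < r" by auto
    then have "int (nat (qs ! j)) = qs ! j" using assms by simp
    then show "?A $$ (k, j) = (?N * ?M) $$ (k, j)"
      using kj power_eq_sum_H_spec[OF kj(1), of "nat (qs ! j)"]
      by (simp add: scalar_prod_def lessThan_atLeast0)
  qed auto
  ultimately show ?thesis using det_mult[of ?N r ?M] by simp
qed

lemma xvar_power: "xvar k ^ n = Poly_Mapping.single (Poly_Mapping.single k n) 1"
  by (induction n) (simp_all add: xvar_def mult_single single_add[symmetric])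

lemma prod_single_one:
  "(\<Prod>i\<in>A. Poly_Mapping.single (m i) (1::int)) = Poly_Mapping.single (\<Sum>i\<in>A. m i :: nat \<Rightarrow>\<^sub>0 nat) 1"
  by (induction A rule: infinite_finite_induct) (simp_all add: mult_single)

lemma lookup_sum_single:
  "Poly_Mapping.lookup (\<Sum>k<(r::nat). Poly_Mapping.single k (f k)) i = (if i < r then f i else (0::nat))"
proof -
  have "Poly_Mapping.lookup (\<Sum>k<r. Poly_Mapping.single k (f k)) i = (\<Sum>k<r. if k = i then f k else 0)"
    unfolding lookup_sum by (intro sum.cong) (auto simp: lookup_single when_def)
  also have "\<dots> = (if i < r then f i else 0)" by simp
  finally show ?thesis .
qed

lemma positions_permuted:
  assumes "lam \<in> Par_le r" "mu \<in> Par_le r" "p permutes {0..<r}"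
    and "\<And>k. k < r \<Longrightarrow> positions r lam ! p k = positions r mu ! k"
  shows "lam = mu" "p = id"
proof -
  have bij: "p ` {0..<r} = {0..<r}" using permutes_image[OF assms(3)] .
  have pk: "p k < r" if "k < r" for k using permutes_in_image[OF assms(3)] that by auto
  have st: "sorted_wrt (<) (rev (positions r nu))" if "nu \<in> Par_le r" for nu
    using sorted_positions[of nu r] that by (simp add: sorted_wrt_rev Par_le_def)
  have "set (positions r mu) = (\<lambda>k. positions r mu ! k) ` {0..<r}"
    by (auto simp: set_conv_nth simp del: nth_positions)
  also have "\<dots> = (\<lambda>k. positions r lam ! p k) ` {0..<r}" using assms(4) by auto
  also have "\<dots> = (\<lambda>k. positions r lam ! k) ` (p ` {0..<r})" by (simp only: image_image)
  also have "\<dots> = set (positions r lam)" unfolding bij by (auto simp: set_conv_nth simp del: nth_positions)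
  finally have "rev (positions r mu) = rev (positions r lam)"
    using st assms(1,2) by (intro strict_sorted_equal) auto
  then show eq: "lam = mu" using positions_inj assms(1,2) by auto
  have "distinct (positions r lam)"
    using st[OF assms(1)] strict_sorted_iff[of "rev (positions r lam)"] by simp
  then have "p k = k" if "k < r" for k
    using assms(4)[OF that] pk[OF that] that eq by (simp add: nth_eq_iff_index_eq del: nth_positions)
  then show "p = id" using permutes_not_in[OF assms(3)] by (intro ext) (metis atLeastLessThan_iff id_apply zero_le)
qed

lemma alternant_lookup:
  assumes "lam \<in> Par_le r" "mu \<in> Par_le r"
  shows "Poly_Mapping.lookup (det (mat r r (\<lambda>(k, j). xvar k ^ nat (positions r lam ! j))))
    (\<Sum>k<r. Poly_Mapping.single k (nat (positions r mu ! k))) = (if lam = mu then 1 else 0)"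
proof -
  define M where "M p = (\<Sum>k<r. Poly_Mapping.single k (nat (positions r lam ! p k)))" for p
  define M' where "M' = (\<Sum>k<r. Poly_Mapping.single k (nat (positions r mu ! k)))"
  have "(\<Prod>k = 0..<r. mat r r (\<lambda>(k, j). xvar k ^ nat (positions r lam ! j)) $$ (k, p k)) =
      Poly_Mapping.single (M p) 1" if "p permutes {0..<r}" for p
  proof -
    have "(\<Prod>k = 0..<r. mat r r (\<lambda>(k, j). xvar k ^ nat (positions r lam ! j)) $$ (k, p k)) =
        (\<Prod>k = 0..<r. xvar k ^ nat (positions r lam ! p k))"
      using permutes_in_image[OF that] by (intro prod.cong) auto
    then show ?thesis by (simp add: xvar_power prod_single_one M_def lessThan_atLeast0)
  qed
  then have "det (mat r r (\<lambda>(k, j). xvar k ^ nat (positions r lam ! j))) =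
      (\<Sum>p | p permutes {0..<r}. signof p * Poly_Mapping.single (M p) 1)"
    by (subst det_def'[of _ r]) auto
  then have "Poly_Mapping.lookup (det (mat r r (\<lambda>(k, j). xvar k ^ nat (positions r lam ! j)))) M' =
      (\<Sum>p | p permutes {0..<r}. Poly_Mapping.lookup (signof p * Poly_Mapping.single (M p) 1) M')"
    by (simp add: lookup_sum)
  also have "\<dots> = (\<Sum>p | p permutes {0..<r}. if p = id then (if lam = mu then 1 else 0) else 0)"
  proof (intro sum.cong refl)
    fix p assume "p \<in> {p. p permutes {0..<r}}"
    then have p: "p permutes {0..<r}" by simp
    show "Poly_Mapping.lookup (signof p * Poly_Mapping.single (M p) 1) M' =
        (if p = id then (if lam = mu then 1 else 0) else 0)"
    proof (cases "M p = M'")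
      case True
      have "positions r lam ! p k = positions r mu ! k" if "k < r" for k
      proof -
        have "p k < r" using permutes_in_image[OF p] that by auto
        then have "positions r lam ! p k \<ge> 0" "positions r mu ! k \<ge> 0"
          using that by (auto simp del: nth_positions intro!: positions_nonneg nth_mem)
        moreover have "nat (positions r lam ! p k) = nat (positions r mu ! k)"
          using arg_cong[OF True, of "\<lambda>m. Poly_Mapping.lookup m k"] that
          by (simp add: M_def M'_def lookup_sum_single)
        ultimately show ?thesis by simp
      qed
      then have "lam = mu" "p = id" using positions_permuted[OF assms p] by blast+
      then show ?thesis using True by simp
    next
      case False
      then have "\<not> (p = id \<and> lam = mu)" by (auto simp: M_def M'_def)
      moreover have "Poly_Mapping.lookup (signof p * Poly_Mapping.single (M p) 1) M' = 0"
        using False by (cases rule: sign_cases[of p]) (simp_all add: lookup_single_not_eq)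
      ultimately show ?thesis by auto
    qed
  qed
  also have "\<dots> = (if lam = mu then 1 else 0)"
    by (simp add: permutes_id finite_permutations)
  finally show ?thesis by (simp add: M'_def)
qed

lemma int_indep_schur_fin: "int_indep (Par_le r) (schur_det r (Hfin r))"
  unfolding int_indep_def
proof (intro allI impI)
  fix c :: "partn \<Rightarrow>\<^sub>0 int"
  assume c: "Poly_Mapping.keys c \<subseteq> Par_le r" and zero: "pm_extend (schur_det r (Hfin r)) c = 0"
  interpret comm_ring_hom "elem_spec r" unfolding elem_spec_def by (rule comm_ring_hom_subst)
  define N where "N = det (mat r r (\<lambda>(k, i). fps_nth (linear_prod ({..<r} - {k})) (r - 1 - i)))"
  define A where "A lam = det (mat r r (\<lambda>(k, j). xvar k ^ nat (positions r lam ! j)))" for lam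
  have A: "A lam = N * elem_spec r (schur_det r (Hfin r) lam)" for lam
    unfolding A_def N_def schur_det_eq_seq_det by (rule alternant_eq) (auto dest: positions_nonneg)
  have "N * elem_spec r (pm_extend (schur_det r (Hfin r)) c) =
      (\<Sum>lam\<in>Poly_Mapping.keys c. of_int (Poly_Mapping.lookup c lam) * A lam)"
    by (simp add: pm_extend_def hom_distribs sum_distrib_left A mult.left_commute)
  then have eq: "(\<Sum>lam\<in>Poly_Mapping.keys c. of_int (Poly_Mapping.lookup c lam) * A lam) = 0"
    using zero by simp
  have "Poly_Mapping.lookup c mu = 0" if mu: "mu \<in> Par_le r" for mu
  proof -
    let ?m = "\<Sum>k<r. Poly_Mapping.single k (nat (positions r mu ! k))"
    have "Poly_Mapping.lookup (of_int d * p) ?m = d * Poly_Mapping.lookup p ?m" for d and p :: Binf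
      using additive_of_int_mult[of "\<lambda>p. Poly_Mapping.lookup p ?m" d p] by (simp add: lookup_add)
    then have "0 = (\<Sum>lam\<in>Poly_Mapping.keys c. Poly_Mapping.lookup c lam * Poly_Mapping.lookup (A lam) ?m)"
      using arg_cong[OF eq, of "\<lambda>p. Poly_Mapping.lookup p ?m"] by (simp add: lookup_sum)
    also have "\<dots> = (\<Sum>lam\<in>Poly_Mapping.keys c. if lam = mu then Poly_Mapping.lookup c lam else 0)"
      using c by (intro sum.cong) (auto simp: A_def alternant_lookup[OF _ mu] simp del: nth_positions)
    also have "\<dots> = Poly_Mapping.lookup c mu" by (simp add: in_keys_iff)
    finally show ?thesis by simp
  qed
  then show "c = 0" using c by (intro poly_mapping_eqI) (auto simp: in_keys_iff)
qed

lemma int_indep_schur_inf: "int_indep Par schur_inf"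
  unfolding int_indep_def
proof (intro allI impI)
  fix c :: "partn \<Rightarrow>\<^sub>0 int"
  assume c: "Poly_Mapping.keys c \<subseteq> Par" "pm_extend schur_inf c = 0"
  then obtain r where r: "\<forall>lam\<in>Poly_Mapping.keys c. lam \<in> Par_le r \<and> schur_inf lam = schur_det r (Hfin r) lam"
    using schur_inf_eventually_Hfin[of "Poly_Mapping.keys c"] by auto
  then have "pm_extend (schur_det r (Hfin r)) c = 0"
    using c(2) by (simp add: pm_extend_def)
  then show "c = 0" using int_indep_schur_fin[of r] r by (auto simp: int_indep_def)
qed

lemma phi_eventually:
  assumes "Poly_Mapping.keys c \<subseteq> Par"
  shows "\<exists>R. \<forall>r\<ge>R. Poly_Mapping.keys c \<subseteq> Par_le r \<and> phi r (pm_extend schur_inf c) = pm_extend (bwedge r) c"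
proof -
  obtain R where R: "\<forall>r\<ge>R. \<forall>lam\<in>Poly_Mapping.keys c. lam \<in> Par_le r \<and> schur_inf lam = schur_det r (Hfin r) lam"
    using schur_inf_eventually_Hfin[of "Poly_Mapping.keys c"] assms by auto
  have "Poly_Mapping.keys c \<subseteq> Par_le r \<and> phi r (pm_extend schur_inf c) = pm_extend (bwedge r) c"
    if "r \<ge> R" for r
  proof -
    have "pm_extend schur_inf c = pm_extend (schur_det r (Hfin r)) c"
      using R that by (auto simp: pm_extend_def intro!: sum.cong)
    moreover have "Poly_Mapping.keys c \<subseteq> Par_le r" using R that by blast
    ultimately show ?thesis
      by (simp add: phi_def additive_ext_pm_extend[OF int_indep_schur_fin])
  qed
  then show ?thesis by blast
qed


section \<open>Determinants given by columns\<close>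

definition col_det :: "(int \<Rightarrow> 'a::comm_ring_1) list \<Rightarrow> 'a" where
  "col_det cs = det (mat (length cs) (length cs) (\<lambda>(i, j). (cs ! j) (1 + int i - int (length cs))))"

lemma seq_det_eq_col_det: "seq_det c qs = col_det (map (\<lambda>q x. c (q + x)) qs)"
  unfolding seq_det_def col_det_def
  by (rule arg_cong[of _ _ det], rule eq_matI) (auto simp: algebra_simps)

lemma col_det_laplace:
  fixes as bs :: "(int \<Rightarrow> 'a::comm_ring_1) list"
  shows "\<exists>m. \<forall>c. col_det (as @ c # bs) =
    (\<Sum>i < length as + length bs + 1. c (1 + int i - int (length as + length bs + 1)) * m i)"
proof -
  let ?n = "length as + length bs + 1"
  let ?A = "\<lambda>c. mat ?n ?n (\<lambda>(i, j). ((as @ c # bs) ! j) (1 + int i - int ?n))"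
  define m where "m i = cofactor (?A (\<lambda>_. 0)) i (length as)" for i
  have "col_det (as @ c # bs) = (\<Sum>i<?n. c (1 + int i - int ?n) * m i)" for c
  proof -
    have "mat_delete (?A c) i (length as) = mat_delete (?A (\<lambda>_. 0)) i (length as)" for i
      by (rule eq_matI) (auto simp: mat_delete_def nth_append nth_Cons split: nat.split)
    then have "cofactor (?A c) i (length as) = m i" for i by (simp add: m_def cofactor_def)
    then have "det (?A c) = (\<Sum>i<?n. ?A c $$ (i, length as) * m i)"
      using laplace_expansion_column[of "?A c" ?n "length as"] by simp
    also have "\<dots> = (\<Sum>i<?n. c (1 + int i - int ?n) * m i)"
      by (intro sum.cong) auto
    finally show ?thesis by (simp add: col_det_def)
  qed
  then show ?thesis by blast
qed

lemma col_det_linear: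
  assumes "\<And>x. x \<le> 0 \<Longrightarrow> c x = (\<Sum>a\<in>A. f a * d a x)"
  shows "col_det (as @ c # bs) = (\<Sum>a\<in>A. f a * col_det (as @ d a # bs))"
proof -
  let ?n = "length as + length bs + 1"
  obtain m where m: "\<And>c. col_det (as @ c # bs) = (\<Sum>i<?n. c (1 + int i - int ?n) * m i)"
    using col_det_laplace[of as bs] by blast
  have "col_det (as @ c # bs) = (\<Sum>i<?n. \<Sum>a\<in>A. f a * (d a (1 + int i - int ?n) * m i))"
    unfolding m by (intro sum.cong) (auto simp: assms sum_distrib_right mult.assoc)
  also have "\<dots> = (\<Sum>a\<in>A. f a * col_det (as @ d a # bs))"
    unfolding m sum_distrib_left by (rule sum.swap)
  finally show ?thesis .
qed

lemma col_det_zero: "(\<And>x. x \<le> 0 \<Longrightarrow> c x = 0) \<Longrightarrow> col_det (as @ c # bs) = 0"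
  using col_det_linear[where A = "{}" and c = c] by simp

lemma col_det_dup: "col_det (as @ c # c # bs) = 0"
proof -
  let ?cs = "as @ c # c # bs"
  let ?A = "mat (length ?cs) (length ?cs) (\<lambda>(i, j). (?cs ! j) (1 + int i - int (length ?cs)))"
  have "col ?A (length as) = col ?A (Suc (length as))"
    by (rule eq_vecI) (auto simp: nth_append)
  then have "det ?A = 0"
    by (intro det_identical_columns[of ?A "length ?cs" "length as" "Suc (length as)"]) auto
  then show ?thesis by (simp only: col_det_def)
qed

lemma col_det_swap: "col_det (as @ d # c # bs) = - col_det (as @ c # d # bs)"
proof -
  let ?e = "\<lambda>x. c x + d x"
  have e: "?e x = (\<Sum>b\<in>UNIV. 1 * (if b then c else d) x)" for x by (simp add: UNIV_bool)
  have 1: "col_det (us @ ?e # vs) = col_det (us @ c # vs) + col_det (us @ d # vs)" for us vs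
    using col_det_linear[where as = us and bs = vs, OF e] by (simp add: UNIV_bool add.commute)
  have "0 = col_det (as @ ?e # ?e # bs)" by (simp add: col_det_dup)
  also have "\<dots> = col_det (as @ c # ?e # bs) + col_det (as @ d # ?e # bs)" by (rule 1)
  also have "\<dots> = col_det (as @ c # d # bs) + col_det (as @ d # c # bs)"
    using 1[of "as @ [c]" bs] 1[of "as @ [d]" bs] by (simp add: col_det_dup)
  finally show ?thesis by (simp add: eq_neg_iff_add_eq_0 add.commute)
qed

lemma seq_det_swap: "seq_det c (ps @ b # a # qs) = - seq_det c (ps @ a # b # qs)"
  unfolding seq_det_eq_col_det map_append list.map by (rule col_det_swap)

lemma seq_det_dup: "seq_det c (ps @ a # a # qs) = 0"
  by (simp add: seq_det_eq_col_det col_det_dup)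

lemma seq_det_neg:
  assumes "\<And>j. j < 0 \<Longrightarrow> c j = 0" "q \<in> set qs" "q < 0"
  shows "seq_det c qs = 0"
proof -
  obtain us vs where "qs = us @ q # vs" using assms(2) by (meson split_list)
  then show ?thesis using assms by (simp add: seq_det_eq_col_det col_det_zero)
qed


section \<open>From Schur determinants to wedges\<close>

abbreviation schur_span :: "nat \<Rightarrow> Binf set" where
  "schur_span r \<equiv> int_span (Par_le r) schur_inf"

definition weight_span :: "nat \<Rightarrow> int \<Rightarrow> Binf set" where
  "weight_span r s = int_span {mu \<in> Par_le r. sum_list (positions r mu) = s} schur_inf"

lemma weight_span_subset: "x \<in> weight_span r s \<Longrightarrow> x \<in> schur_span r"
  unfolding weight_span_def int_span_def by auto

lemma weight_span_zero: "0 \<in> weight_span r s"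
  and weight_span_of_int_mult: "x \<in> weight_span r s \<Longrightarrow> of_int c * x \<in> weight_span r s"
  and weight_span_sum: "(\<And>a. a \<in> A \<Longrightarrow> f a \<in> weight_span r s) \<Longrightarrow> sum f A \<in> weight_span r s"
  by (simp_all add: weight_span_def int_span_of_int_mult int_span_sum)

definition to_wedge :: "nat \<Rightarrow> Binf \<Rightarrow> M0 ext" where
  "to_wedge r = additive_ext Par schur_inf (\<lambda>lam. if lam \<in> Par_le r then bwedge r lam else 0)"

lemma schur_span_subset: "x \<in> schur_span r \<Longrightarrow> x \<in> int_span Par schur_inf"
  unfolding int_span_def by (auto dest: Par_le_subset_Par)

lemma to_wedge_pm_extend:
  assumes "Poly_Mapping.keys c \<subseteq> Par_le r"
  shows "to_wedge r (pm_extend schur_inf c) = pm_extend (bwedge r) c"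
proof -
  have "Poly_Mapping.keys c \<subseteq> Par" using assms Par_le_subset_Par by blast
  then have "to_wedge r (pm_extend schur_inf c) = pm_extend (\<lambda>lam. if lam \<in> Par_le r then bwedge r lam else 0) c"
    by (simp add: to_wedge_def additive_ext_pm_extend int_indep_schur_inf)
  also have "\<dots> = pm_extend (bwedge r) c"
    unfolding pm_extend_def using assms by (intro sum.cong) auto
  finally show ?thesis .
qed

lemma to_wedge_schur_inf: "lam \<in> Par_le r \<Longrightarrow> to_wedge r (schur_inf lam) = bwedge r lam"
  using to_wedge_pm_extend[of "Poly_Mapping.single lam 1" r] by simp

lemma to_wedge_zero: "to_wedge r 0 = 0"
  by (simp add: to_wedge_def additive_ext_zero int_indep_schur_inf)

lemma to_wedge_add:
  "x \<in> schur_span r \<Longrightarrow> y \<in> schur_span r \<Longrightarrow> to_wedge r (x + y) = to_wedge r x + to_wedge r y"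
  by (simp add: to_wedge_def additive_ext_add int_indep_schur_inf schur_span_subset)

lemma to_wedge_uminus: "x \<in> schur_span r \<Longrightarrow> to_wedge r (- x) = - to_wedge r x"
  by (simp add: to_wedge_def additive_ext_uminus int_indep_schur_inf schur_span_subset)

lemma to_wedge_sum:
  "(\<And>a. a \<in> A \<Longrightarrow> f a \<in> schur_span r) \<Longrightarrow> to_wedge r (sum f A) = (\<Sum>a\<in>A. to_wedge r (f a))"
  unfolding to_wedge_def by (rule additive_ext_sum[OF int_indep_schur_inf]) (rule schur_span_subset)

lemma to_wedge_of_int_mult:
  "x \<in> schur_span r \<Longrightarrow> to_wedge r (of_int c * x) = of_int c * to_wedge r x"
proof (induction c rule: int_induct[of _ 0])
  case base then show ?case by (simp add: to_wedge_zero)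
next
  case (step1 i) then show ?case by (simp add: distrib_right to_wedge_add int_span_of_int_mult)
next
  case (step2 i)
  then show ?case
    using to_wedge_add[of "of_int i * x" r "- x"]
    by (simp add: left_diff_distrib to_wedge_uminus int_span_of_int_mult)
qed

lemma to_wedge_inject:
  assumes "x \<in> schur_span r" "to_wedge r x = 0"
  shows "x = 0"
proof -
  obtain c where c: "x = pm_extend schur_inf c" "Poly_Mapping.keys c \<subseteq> Par_le r"
    using assms(1) by (auto simp: int_span_def)
  then have "pm_extend (bwedge r) c = 0" using assms(2) to_wedge_pm_extend by simp
  then have "Poly_Mapping.lookup c mu = 0" if "mu \<in> Par_le r" for mu
    using pairing_coeff[OF c(2) that] by simp
  then have "c = 0" using c(2) by (intro poly_mapping_eqI) (auto simp: in_keys_iff)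
  then show ?thesis using c by simp
qed

lemma seq_det_to_wedge:
  "seq_det Hinf qs \<in> weight_span (length qs) (sum_list qs)"
  "to_wedge (length qs) (seq_det Hinf qs) = bas_wedge qs"
proof -
  let ?r = "length qs"
  define P where "P ps \<longleftrightarrow> seq_det Hinf ps \<in> weight_span ?r (sum_list ps) \<and>
    to_wedge ?r (seq_det Hinf ps) = bas_wedge ps" for ps
  have "P qs"
  proof (rule swap_closed_all[of P ?r])
    fix xs a b ys assume "P (xs @ a # b # ys)"
    then show "P (xs @ b # a # ys)"
      by (auto simp: P_def seq_det_swap[of _ xs b a ys] bas_wedge_swap[of xs b a ys] to_wedge_uminus
          weight_span_subset weight_span_def add.left_commute)
  next
    fix ps :: "int list" assume ps: "length ps = ?r" "sorted_wrt (>) ps"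
    show "P ps"
    proof (cases "\<forall>p\<in>set ps. p \<ge> 0")
      case True
      then obtain lam where lam: "lam \<in> Par_le ?r" "positions ?r lam = ps"
        using positions_surj[of ps] ps by auto
      then have "seq_det Hinf ps = schur_inf lam"
        by (simp add: schur_inf_eq[of lam ?r] schur_det_eq_seq_det)
      then show ?thesis
        using lam by (auto simp: P_def to_wedge_schur_inf bwedge_eq_bas_wedge weight_span_def)
    next
      case False
      then show ?thesis
        by (auto simp: P_def not_le bas_wedge_neg seq_det_neg[of Hinf] to_wedge_zero weight_span_def)
    qed
  qed (simp_all add: P_def bas_wedge_dup seq_det_dup to_wedge_zero weight_span_def)
  then show "seq_det Hinf qs \<in> weight_span (length qs) (sum_list qs)"
    "to_wedge (length qs) (seq_det Hinf qs) = bas_wedge qs" by (simp_all add: P_def)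
qed

lemma seq_det_in_schur_span: "seq_det Hinf qs \<in> schur_span (length qs)"
  by (rule weight_span_subset) (rule seq_det_to_wedge)


section \<open>The operators on determinants\<close>

text \<open>
  Both operators act by \<open>b\<^sub>q \<mapsto> \<Sum>\<^sub>i t\<^sub>i b\<^bsub>q-i\<^esub> z\<^sup>-\<^sup>i\<close>, with \<open>t = (1, 1, \<dots>)\<close> and
  \<open>t = (1, -1, 0, \<dots>)\<close>.
\<close>

definition shift_hom :: "(nat \<Rightarrow> int) \<Rightarrow> (M0 ext \<Rightarrow> M0 ext fps) \<Rightarrow> bool" where
  "shift_hom t D \<longleftrightarrow> wedge_hom D \<and>
     (\<forall>j::nat. D (bas (int j)) = Abs_fps (\<lambda>i. of_int (t i) * bas (int j - int i)))"

definition shift_vec :: "(nat \<Rightarrow> int) \<Rightarrow> nat \<Rightarrow> M0 \<Rightarrow> M0" where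
  "shift_vec t i m = frag_cmul (t i) (frag_extend (\<lambda>j. bvec (int j - int i)) m)"

lemma shift_hom_exists: "\<exists>D. shift_hom t D"
proof -
  define g where "g m = Abs_fps (\<lambda>i. ext_incl (shift_vec t i m))" for m
  have add: "g (m + n) = g m + g n" for m n
    by (rule fps_ext) (simp add: g_def shift_vec_def frag_extend_add frag_cmul_distrib2 ext_incl_add)
  have square: "g m * g m = 0" for m
  proof (rule fps_ext)
    fix n
    let ?u = "\<lambda>i. shift_vec t i m"
    define z where "z = (\<Sum>i=0..n. ext_incl (?u i) * ext_incl (?u (n - i)))"
    have "z = (\<Sum>i=0..n. ext_incl (?u (n - i)) * ext_incl (?u (n - (n - i))))"
      unfolding z_def by (rule sum.atLeastAtMost_rev[THEN trans]) simp
    also have "\<dots> = (\<Sum>i=0..n. - (ext_incl (?u i) * ext_incl (?u (n - i))))"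
      by (intro sum.cong) (auto intro: ext_incl_anticommute)
    finally have "z = - z" by (simp add: z_def sum_negf)
    then have "of_int 2 * z = of_int 2 * 0" by (simp add: eq_neg_iff_add_eq_0 flip: mult_2)
    moreover have "z \<in> wedge_power 2"
      unfolding z_def
    proof (rule wedge_power_sum)
      fix i show "ext_incl (?u i) * ext_incl (?u (n - i)) \<in> wedge_power 2"
        using wedge_power.wedge[of "[?u i, ?u (n - i)]" 2] by simp
    qed
    ultimately have "z = 0" by (intro wedge_power_cancel[of z 2 0 2]) (auto intro: wedge_power.zero)
    then show "fps_nth (g m * g m) n = fps_nth 0 n" by (simp add: fps_mult_nth g_def z_def)
  qed
  have "ext_extend g (bas (int j)) = Abs_fps (\<lambda>i. of_int (t i) * bas (int j - int i))" for j
    by (rule fps_ext) (simp add: bas_def ext_extend_incl[of g, OF add square] g_def shift_vec_def ext_incl_frag_cmul bvec_def)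
  then have "shift_hom t (ext_extend g)"
    by (simp add: shift_hom_def wedge_hom_def ext_extend_add[of g, OF add square]
        ext_extend_mult[of g, OF add square] ext_extend_one[of g, OF add square])
  then show ?thesis by blast
qed

lemma wedge_hom_eqI:
  assumes "wedge_hom D" "wedge_hom D'" "\<And>j::nat. D (bas (int j)) = D' (bas (int j))"
  shows "D = D'"
proof
  fix x
  have add: "D (x + y) = D x + D y" "D' (x + y) = D' x + D' y" for x y
    using assms by (auto simp: wedge_hom_def)
  have incl: "D (ext_incl m) = D' (ext_incl m)" for m
    unfolding ext_incl_eq_pm_extend pm_extend_def
    by (simp add: additive_sum[of D, OF add(1)] additive_sum[of D', OF add(2)] assms(3)
        additive_of_int_mult[of D, OF add(1)] additive_of_int_mult[of D', OF add(2)])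
  have mult: "D (x * y) = D x * D y" "D' (x * y) = D' x * D' y" "D 1 = 1" "D' 1 = 1" for x y
    using assms by (auto simp: wedge_hom_def)
  have "D (wedge ms) = D' (wedge ms)" for ms
    by (induction ms) (simp_all add: mult incl)
  then show "D x = D' x" by (rule additive_ext_eqI[OF add])
qed

lemma shift_hom_the: "shift_hom t (THE D. shift_hom t D)"
proof -
  have "\<exists>!D. shift_hom t D"
    using shift_hom_exists[of t] by (auto simp: shift_hom_def intro: wedge_hom_eqI)
  then show ?thesis by (rule theI')
qed

lemma shift_hom_sigma_minus: "shift_hom (\<lambda>_. 1) sigma_minus"
  using shift_hom_the[of "\<lambda>_. 1"] by (simp add: shift_hom_def sigma_minus_def bas_def)

lemma shift_hom_sigma_bar_minus:
  "shift_hom (\<lambda>i. if i = 0 then 1 else if i = 1 then - 1 else 0) sigma_bar_minus"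
proof -
  have "fps_const (ext_incl (bvec (int j))) - fps_const (ext_incl (bvec (int j - 1))) * fps_X =
      Abs_fps (\<lambda>i. of_int (if i = 0 then 1 else if i = 1 then - 1 else 0) * bas (int j - int i))" for j
    by (rule fps_ext) (auto simp: bas_def le_Suc_eq)
  then show ?thesis
    using shift_hom_the[of "\<lambda>i. if i = 0 then 1 else if i = 1 then - 1 else 0"]
    by (simp add: shift_hom_def sigma_bar_minus_def bas_def)
qed

lemma shift_hom_bas:
  assumes "shift_hom t D"
  shows "D (bas q) = Abs_fps (\<lambda>i. of_int (t i) * bas (q - int i))"
proof (cases "q < 0")
  case True
  have "\<And>x y. D (x + y) = D x + D y" using assms by (simp add: shift_hom_def wedge_hom_def)
  then have "D 0 = 0" using additive_zero[of D] by simp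
  then show ?thesis using True by (auto simp: bas_neg fps_eq_iff)
next
  case False
  then show ?thesis using assms unfolding shift_hom_def by (metis nonneg_int_cases not_less)
qed

lemma shift_hom_bas_wedge:
  assumes "shift_hom t D"
  shows "D (bas_wedge qs) = prod_list (rev (map (\<lambda>q. D (bas q)) qs))"
  using assms by (induction qs) (simp_all add: bas_wedge_Cons shift_hom_def wedge_hom_def)

definition shift_series :: "(nat \<Rightarrow> int) \<Rightarrow> int \<Rightarrow> Binf poly" where
  "shift_series t m = (\<Sum>i\<le>nat m. Polynomial.monom (of_int (t i) * Hinf (m - int i)) i)"

lemma shift_series_eq:
  assumes "nat m < K"
  shows "shift_series t m = (\<Sum>i<K. (of_int (t i) * Polynomial.monom 1 i) * [:Hinf (m - int i):])"
proof -
  have "shift_series t m = (\<Sum>i<K. Polynomial.monom (of_int (t i) * Hinf (m - int i)) i)"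
    unfolding shift_series_def using assms
    by (intro sum.mono_neutral_left) auto
  also have "\<dots> = (\<Sum>i<K. (of_int (t i) * Polynomial.monom 1 i) * [:Hinf (m - int i):])"
    by (intro sum.cong refl poly_eqI) (simp add: of_int_poly smult_monom mult.commute)
  finally show ?thesis .
qed

lemma shift_series_neg: "m < 0 \<Longrightarrow> shift_series t m = 0"
  by (simp add: shift_series_def)

lemma shift_series_0: "t 0 = 1 \<Longrightarrow> shift_series t 0 = 1"
  by (simp add: shift_series_def monom_0 one_pCons)

definition corresponds :: "nat \<Rightarrow> int \<Rightarrow> M0 ext fps \<Rightarrow> Binf poly \<Rightarrow> bool" where
  "corresponds r s f g \<longleftrightarrow>
     (\<forall>n. poly.coeff g n \<in> weight_span r (s - int n) \<and> fps_nth f n = to_wedge r (poly.coeff g n))"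

lemma corresponds_sum:
  assumes "\<And>a. a \<in> A \<Longrightarrow> corresponds r s (f a) (g a)"
  shows "corresponds r s (sum f A) (sum g A)"
proof -
  have span: "poly.coeff (g a) n \<in> weight_span r (s - int n)" if "a \<in> A" for a n
    using assms that by (simp add: corresponds_def)
  show ?thesis
    unfolding corresponds_def fps_sum_nth coeff_sum
  proof (intro allI conjI weight_span_sum)
    fix n
    have "to_wedge r (\<Sum>a\<in>A. poly.coeff (g a) n) = (\<Sum>a\<in>A. to_wedge r (poly.coeff (g a) n))"
      using span by (intro to_wedge_sum weight_span_subset)
    then show "(\<Sum>a\<in>A. fps_nth (f a) n) = to_wedge r (\<Sum>a\<in>A. poly.coeff (g a) n)"
      using assms by (simp add: corresponds_def)
  qed (use span in blast)
qed

lemma fps_nth_of_int_mult: "fps_nth (of_int c * f) n = of_int c * fps_nth f n"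
  by (rule additive_of_int_mult) (rule fps_add_nth)

lemma corresponds_scale:
  assumes "corresponds r s f g"
  shows "corresponds r (s + int i) (of_int c * fps_X ^ i * f) (of_int c * Polynomial.monom 1 i * g)"
proof -
  have "fps_nth (of_int c * fps_X ^ i * f) n = of_int c * (if n < i then 0 else fps_nth f (n - i))" for n
    by (simp add: mult.assoc fps_X_power_mult_nth fps_nth_of_int_mult)
  moreover have "poly.coeff (of_int c * Polynomial.monom 1 i * g) n =
      of_int c * (if n < i then 0 else poly.coeff g (n - i))" for n
    by (simp add: mult.assoc of_int_poly coeff_monom_mult)
  note coeffs = calculation this
  show ?thesis
  proof -
    have "poly.coeff g m \<in> weight_span r (s - int m)" for m using assms by (simp add: corresponds_def)
    then have sp: "poly.coeff g m \<in> schur_span r" for m using weight_span_subset by blast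
    have "poly.coeff g (n - i) \<in> weight_span r (s - int (n - i))" for n by fact
    moreover have "n \<ge> i \<Longrightarrow> s - int (n - i) = s + int i - int n" for n by (simp add: of_nat_diff)
    ultimately have "n \<ge> i \<Longrightarrow> poly.coeff g (n - i) \<in> weight_span r (s + int i - int n)" for n by metis
    then show ?thesis
      using assms by (simp add: corresponds_def coeffs to_wedge_of_int_mult to_wedge_zero
          sp weight_span_zero weight_span_of_int_mult)
  qed
qed

lemma col_det_const: "col_det (map (\<lambda>q x. [:Hinf (q + x):]) qs) = [:seq_det Hinf qs:]"
proof -
  interpret comm_ring_hom "\<lambda>x::Binf. [:x:]" by unfold_locales (simp_all add: one_pCons)
  show ?thesis
    unfolding seq_det_eq_col_det col_det_def hom_det[symmetric]
    by (rule arg_cong[of _ _ det], rule eq_matI) auto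
qed

lemma corresponds_mixed:
  assumes D: "shift_hom t D"
  shows "corresponds (length qs + length ps) (sum_list qs + sum_list ps)
    (prod_list (rev (map (\<lambda>p. D (bas p)) ps)) * fps_const (bas_wedge qs))
    (col_det (map (\<lambda>q x. [:Hinf (q + x):]) qs @ map (\<lambda>p x. shift_series t (p + x)) ps))"
proof (induction ps arbitrary: qs)
  case Nil
  then show ?case
    using seq_det_to_wedge[of qs]
    by (auto simp: corresponds_def col_det_const coeff_pCons to_wedge_zero weight_span_def split: nat.split)
next
  case (Cons p ps)
  define K where "K = Suc (nat p)"
  define f where "f q = prod_list (rev (map (\<lambda>p. D (bas p)) ps)) * fps_const (bas_wedge (qs @ [q]))" for q
  define g where "g q = col_det (map (\<lambda>q x. [:Hinf (q + x):]) (qs @ [q]) @ map (\<lambda>p x. shift_series t (p + x)) ps)" for q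
  have "D (bas p) = (\<Sum>i<K. of_int (t i) * fps_X ^ i * fps_const (bas (p - int i)))"
  proof (rule fps_ext)
    fix n
    have "fps_nth (of_int (t i) * fps_X ^ i * fps_const (bas (p - int i))) n =
        (if i = n then of_int (t n) * bas (p - int n) else 0)" for i
      by (auto simp: mult.assoc fps_X_power_mult_nth fps_nth_of_int_mult)
    then have "fps_nth (\<Sum>i<K. of_int (t i) * fps_X ^ i * fps_const (bas (p - int i))) n =
        (if n < K then of_int (t n) * bas (p - int n) else 0)"
      by (simp add: fps_sum_nth)
    also have "\<dots> = of_int (t n) * bas (p - int n)" by (auto simp: K_def bas_neg)
    finally show "fps_nth (D (bas p)) n = fps_nth (\<Sum>i<K. of_int (t i) * fps_X ^ i * fps_const (bas (p - int i))) n"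
      by (simp add: shift_hom_bas[OF D])
  qed
  moreover have "u * (of_int c * fps_X ^ i * fps_const a) * fps_const b = of_int c * fps_X ^ i * (u * fps_const (a * b))"
    for u :: "M0 ext fps" and c i a b
  proof -
    have "u * (fps_X ^ i * v) = fps_X ^ i * (u * v)" for v
    proof -
      have "u * (fps_X ^ i * v) = u * fps_X ^ i * v" by (rule mult.assoc[symmetric])
      also have "u * fps_X ^ i = fps_X ^ i * u" by (rule fps_mult_fps_X_power_commute[symmetric])
      finally show ?thesis by (simp only: mult.assoc)
    qed
    then show ?thesis by (simp add: mult.assoc mult_of_int_left flip: fps_const_mult)
  qed
  ultimately have "prod_list (rev (map (\<lambda>p. D (bas p)) (p # ps))) * fps_const (bas_wedge qs) =
      (\<Sum>i<K. of_int (t i) * fps_X ^ i * f (p - int i))"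
    by (simp add: f_def bas_wedge_append bas_wedge_Cons sum_distrib_left sum_distrib_right)
  moreover have "col_det (map (\<lambda>q x. [:Hinf (q + x):]) qs @ map (\<lambda>p x. shift_series t (p + x)) (p # ps)) =
      (\<Sum>i<K. of_int (t i) * Polynomial.monom 1 i * g (p - int i))"
  proof -
    have "shift_series t (p + x) = (\<Sum>i<K. of_int (t i) * Polynomial.monom 1 i * [:Hinf (p - int i + x):])"
      if "x \<le> 0" for x
      using that by (subst shift_series_eq[of _ K]) (auto simp: K_def algebra_simps)
    from col_det_linear[OF this] show ?thesis by (simp add: g_def)
  qed
  moreover have "corresponds (length qs + length (p # ps)) (sum_list qs + sum_list (p # ps))
      (of_int (t i) * fps_X ^ i * f (p - int i)) (of_int (t i) * Polynomial.monom 1 i * g (p - int i))" for i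
  proof -
    have "corresponds (length qs + length (p # ps)) (sum_list qs + sum_list (p # ps) - int i)
        (f (p - int i)) (g (p - int i))"
      using Cons.IH[of "qs @ [p - int i]"] by (simp add: f_def g_def algebra_simps)
    from corresponds_scale[OF this, where c = "t i" and i = i] show ?thesis by simp
  qed
  ultimately show ?case by (simp only: corresponds_sum)
qed

lemma corresponds_shift:
  assumes "shift_hom t D"
  shows "corresponds (length qs) (sum_list qs) (D (bas_wedge qs)) (seq_det (shift_series t) qs)"
  using corresponds_mixed[OF assms, of "[]" qs]
  by (simp add: shift_hom_bas_wedge[OF assms] seq_det_eq_col_det)

lemma wedge_coeffs_sum:
  assumes D: "shift_hom t D" and lam: "lam \<in> Par"
  shows "(\<Sum>mu\<in>Poly_Mapping.keys (wedge_coeffs D lam).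
        Polynomial.smult (schur_inf mu) (map_poly of_int (Poly_Mapping.lookup (wedge_coeffs D lam) mu))) =
      seq_det (shift_series t) (positions (max 1 (par_length lam)) lam)"
proof -
  define r where "r = max 1 (par_length lam)"
  define g where "g = seq_det (shift_series t) (positions r lam)"
  define f where "f = D (bwedge r lam)"
  have "corresponds r (sum_list (positions r lam)) f g"
    using corresponds_shift[OF D, of "positions r lam"] by (simp add: f_def g_def bwedge_eq_bas_wedge)
  then have span: "poly.coeff g n \<in> schur_span r" and f: "fps_nth f n = to_wedge r (poly.coeff g n)" for n
    by (auto simp: corresponds_def dest: weight_span_subset)
  define cf where "cf b = coords (\<lambda>k y. of_int k * y) Par schur_inf b" for b
  have cf: "Poly_Mapping.keys (cf b) \<subseteq> Par_le r \<and> pm_extend schur_inf (cf b) = b" if b: "b \<in> schur_span r" for b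
  proof -
    obtain c where c: "b = pm_extend schur_inf c" "Poly_Mapping.keys c \<subseteq> Par_le r"
      using b by (auto simp: int_span_def)
    moreover have "Poly_Mapping.keys c \<subseteq> Par" using c(2) Par_le_subset_Par by blast
    ultimately show ?thesis by (simp add: cf_def int_indep_coords[OF int_indep_schur_inf])
  qed
  have cf_0: "cf 0 = 0" using int_indep_coords[OF int_indep_schur_inf, of 0] by (simp add: cf_def)
  define p where "p mu = map_poly (\<lambda>b. Poly_Mapping.lookup (cf b) mu) g" for mu
  have coeff_p: "poly.coeff (p mu) n = Poly_Mapping.lookup (cf (poly.coeff g n)) mu" for mu n
    unfolding p_def by (rule coeff_map_poly) (simp add: cf_0)
  have supp: "{mu. p mu \<noteq> 0} \<subseteq> (\<Union>n\<le>degree g. Poly_Mapping.keys (cf (poly.coeff g n)))"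
  proof
    fix mu assume "mu \<in> {mu. p mu \<noteq> 0}"
    then obtain n where n: "poly.coeff (p mu) n \<noteq> 0" by (auto simp: poly_eq_iff)
    then have "n \<le> degree g" using coeff_eq_0[of g n] coeff_p[of mu n] cf_0 by (cases "n \<le> degree g") auto
    then show "mu \<in> (\<Union>n\<le>degree g. Poly_Mapping.keys (cf (poly.coeff g n)))"
      using n coeff_p by (auto simp: in_keys_iff)
  qed
  then have fin: "finite {mu. p mu \<noteq> 0}" by (rule finite_subset) simp
  define c where "c = Abs_poly_mapping p"
  have c: "Poly_Mapping.lookup c = p" unfolding c_def using fin by (rule Abs_poly_mapping_inverse[OF CollectI])
  have keys_c: "Poly_Mapping.keys c \<subseteq> Par_le r"
  proof
    fix mu assume "mu \<in> Poly_Mapping.keys c"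
    then have "p mu \<noteq> 0" by (simp add: in_keys_iff c)
    then obtain n where "mu \<in> Poly_Mapping.keys (cf (poly.coeff g n))" using supp by blast
    then show "mu \<in> Par_le r" using cf[OF span[of n]] by blast
  qed
  have keys_cf: "Poly_Mapping.keys (cf (poly.coeff g n)) \<subseteq> Poly_Mapping.keys c" for n
  proof
    fix mu assume "mu \<in> Poly_Mapping.keys (cf (poly.coeff g n))"
    then have "poly.coeff (p mu) n \<noteq> 0" by (simp add: in_keys_iff coeff_p)
    then have "p mu \<noteq> 0" by auto
    then show "mu \<in> Poly_Mapping.keys c" by (simp add: in_keys_iff c)
  qed
  let ?V = "\<lambda>d. \<Sum>mu\<in>Poly_Mapping.keys d. fps_of_poly (map_poly of_int (Poly_Mapping.lookup d mu)) * fps_const (bwedge r mu)"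
  have look: "Poly_Mapping.lookup (Poly_Mapping.map (\<lambda>q. poly.coeff q n) d) mu = poly.coeff (Poly_Mapping.lookup d mu) n"
    for d :: "partn \<Rightarrow>\<^sub>0 int poly" and n mu
    by (simp add: map.rep_eq when_def)
  have nth_V: "fps_nth (?V d) n = pm_extend (bwedge r) (Poly_Mapping.map (\<lambda>q. poly.coeff q n) d)"
    for d :: "partn \<Rightarrow>\<^sub>0 int poly" and n
  proof -
    let ?m = "Poly_Mapping.map (\<lambda>q. poly.coeff q n) d"
    have "pm_extend (bwedge r) ?m = (\<Sum>mu\<in>Poly_Mapping.keys d. of_int (Poly_Mapping.lookup ?m mu) * bwedge r mu)"
      by (intro pm_extend_superset) (auto simp: in_keys_iff look)
    then show ?thesis by (simp add: look fps_sum_nth coeff_map_poly)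
  qed
  have V_c: "?V c = f"
  proof (rule fps_ext)
    fix n
    have "Poly_Mapping.map (\<lambda>q. poly.coeff q n) c = cf (poly.coeff g n)"
      by (rule poly_mapping_eqI) (simp add: look c coeff_p)
    then show "fps_nth (?V c) n = fps_nth f n"
      using cf[OF span, of n] by (simp add: nth_V f to_wedge_pm_extend[symmetric])
  qed
  have "wedge_coeffs D lam = c"
    unfolding wedge_coeffs_def Let_def coords_def r_def[symmetric] f_def[symmetric]
  proof (rule the_equality)
    fix d assume d: "Poly_Mapping.keys d \<subseteq> Par_le r \<and> ?V d = f"
    have *: "poly.coeff (Poly_Mapping.lookup e mu) n = pairing (map nat (positions r mu)) (fps_nth f n)"
      if "mu \<in> Par_le r" "Poly_Mapping.keys e \<subseteq> Par_le r" "?V e = f" for e mu n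
    proof -
      have "Poly_Mapping.keys (Poly_Mapping.map (\<lambda>q. poly.coeff q n) e) \<subseteq> Par_le r"
      proof
        fix nu assume "nu \<in> Poly_Mapping.keys (Poly_Mapping.map (\<lambda>q. poly.coeff q n) e)"
        then have "Poly_Mapping.lookup e nu \<noteq> 0" by (metis in_keys_iff look coeff_0)
        then show "nu \<in> Par_le r" using that(2) by (auto simp: in_keys_iff)
      qed
      then show ?thesis
        using pairing_coeff[of "Poly_Mapping.map (\<lambda>q. poly.coeff q n) e" r mu] that(1) nth_V[of e n] that(3)
        by (simp add: look)
    qed
    show "d = c"
    proof (rule poly_mapping_eqI)
      fix mu
      show "Poly_Mapping.lookup d mu = Poly_Mapping.lookup c mu"
      proof (cases "mu \<in> Par_le r")
        case True
        then show ?thesis using d keys_c V_c by (intro poly_eqI) (simp only: *)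
      next
        case False
        then show ?thesis using d keys_c by (metis in_keys_iff subsetD)
      qed
    qed
  qed (use keys_c V_c in blast)
  moreover have "(\<Sum>mu\<in>Poly_Mapping.keys c. Polynomial.smult (schur_inf mu) (map_poly of_int (Poly_Mapping.lookup c mu))) = g"
  proof (rule poly_eqI)
    fix n
    have "poly.coeff (\<Sum>mu\<in>Poly_Mapping.keys c. Polynomial.smult (schur_inf mu) (map_poly of_int (Poly_Mapping.lookup c mu))) n =
        (\<Sum>mu\<in>Poly_Mapping.keys c. of_int (Poly_Mapping.lookup (cf (poly.coeff g n)) mu) * schur_inf mu)"
      by (simp add: coeff_sum coeff_map_poly c coeff_p mult.commute)
    also have "\<dots> = pm_extend schur_inf (cf (poly.coeff g n))"
      using keys_cf by (intro pm_extend_superset[symmetric]) auto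
    finally show "poly.coeff (\<Sum>mu\<in>Poly_Mapping.keys c. Polynomial.smult (schur_inf mu) (map_poly of_int (Poly_Mapping.lookup c mu))) n =
        poly.coeff g n" using cf[OF span] by simp
  qed
  ultimately show ?thesis by (simp add: g_def r_def)
qed

lemma transfer_op_eq:
  assumes D: "shift_hom t D" and t: "t 0 = 1" and c: "Poly_Mapping.keys c \<subseteq> Par_le r"
  shows "transfer_op D (pm_extend schur_inf c) =
    pm_extend (\<lambda>lam. seq_det (shift_series t) (positions r lam)) c"
proof -
  have Par: "Poly_Mapping.keys c \<subseteq> Par" using c Par_le_subset_Par by blast
  have "transfer_op D (pm_extend schur_inf c) =
      pm_extend (\<lambda>lam. \<Sum>mu\<in>Poly_Mapping.keys (wedge_coeffs D lam).
        Polynomial.smult (schur_inf mu) (map_poly of_int (Poly_Mapping.lookup (wedge_coeffs D lam) mu))) c"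
    unfolding transfer_op_def by (rule additive_ext_pm_extend[OF int_indep_schur_inf Par])
  also have "\<dots> = pm_extend (\<lambda>lam. seq_det (shift_series t) (positions r lam)) c"
    unfolding pm_extend_def
  proof (intro sum.cong refl arg_cong2[of _ _ _ _ "(*)"])
    fix lam assume "lam \<in> Poly_Mapping.keys c"
    then have lam: "lam \<in> Par_le r" "lam \<in> Par" using c Par by auto
    have st: "schur_det l (shift_series t) lam = schur_det (par_length lam) (shift_series t) lam"
      if "par_length lam \<le> l" for l
      using that lam t by (intro schur_det_stable Par_le_par_length) (auto simp: shift_series_0 shift_series_neg)
    show "(\<Sum>mu\<in>Poly_Mapping.keys (wedge_coeffs D lam).
        Polynomial.smult (schur_inf mu) (map_poly of_int (Poly_Mapping.lookup (wedge_coeffs D lam) mu))) =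
        seq_det (shift_series t) (positions r lam)"
      unfolding wedge_coeffs_sum[OF D lam(2)] schur_det_eq_seq_det[symmetric]
      using st[of "max 1 (par_length lam)"] st[of r] par_length_le[OF lam(1)] by simp
  qed
  finally show ?thesis .
qed


section \<open>The vertex operators\<close>

lemma det_row_shift:
  fixes F :: "nat \<Rightarrow> nat \<Rightarrow> 'a::comm_ring_1"
  shows "det (mat n n (\<lambda>(i, j). F i j - (if i = 0 then 0 else w * F (i - 1) j))) = det (mat n n (\<lambda>(i, j). F i j))"
    (is "det ?B = det ?A")
proof -
  let ?N = "mat n n (\<lambda>(i, k). if i = k then 1 else if i = Suc k then - w else 0)"
  have "?N * ?A = ?B"
  proof (rule eq_matI)
    fix i j assume "i < dim_row ?B" "j < dim_col ?B"
    then have ij: "i < n" "j < n" by auto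
    have "(?N * ?A) $$ (i, j) = (\<Sum>k = 0..<n. (if i = k then 1 else if i = Suc k then - w else 0) * F k j)"
      using ij by (simp add: scalar_prod_def)
    also have "\<dots> = (\<Sum>k = 0..<n. (if k = i then F k j else 0) + (if i \<noteq> 0 \<and> k = i - 1 then - w * F k j else 0))"
      by (intro sum.cong) auto
    also have "\<dots> = F i j + (if i \<noteq> 0 then - w * F (i - 1) j else 0)"
      using ij by (auto simp: sum.distrib)
    finally show "(?N * ?A) $$ (i, j) = ?B $$ (i, j)" using ij by simp
  qed auto
  moreover have "det ?N = 1"
  proof -
    have "det ?N = prod_list (diag_mat ?N)" by (rule det_lower_triangular[of n]) auto
    also have "diag_mat ?N = replicate n 1" by (rule nth_equalityI) (auto simp: diag_mat_def)
    finally show ?thesis by simp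
  qed
  ultimately show ?thesis using det_mult[of ?N n ?A] by simp
qed

definition skip :: "nat \<Rightarrow> nat \<Rightarrow> nat" where
  "skip i k = (if k < i then k else Suc k)"

lemma det_first_column:
  fixes F :: "nat \<Rightarrow> nat \<Rightarrow> 'a::comm_ring_1"
  shows "det (mat (Suc n) (Suc n) (\<lambda>(i, j). if j = 0 then c i else F i (j - 1))) =
    (\<Sum>i<Suc n. (- 1) ^ i * c i * det (mat n n (\<lambda>(i', j). F (skip i i') j)))"
proof -
  let ?A = "mat (Suc n) (Suc n) (\<lambda>(i, j). if j = 0 then c i else F i (j - 1))"
  have "det ?A = (\<Sum>i<Suc n. ?A $$ (i, 0) * cofactor ?A i 0)"
    by (rule laplace_expansion_column) auto
  also have "\<dots> = (\<Sum>i<Suc n. (- 1) ^ i * c i * det (mat n n (\<lambda>(i', j). F (skip i i') j)))"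
  proof (intro sum.cong refl)
    fix i assume i: "i \<in> {..<Suc n}"
    have "mat_delete ?A i 0 = mat n n (\<lambda>(i', j). F (skip i i') j)"
      using i by (intro eq_matI) (auto simp: mat_delete_def skip_def)
    then show "?A $$ (i, 0) * cofactor ?A i 0 = (- 1) ^ i * c i * det (mat n n (\<lambda>(i', j). F (skip i i') j))"
      using i by (simp add: cofactor_def)
  qed
  finally show ?thesis .
qed

lemma det_row_difference:
  fixes F :: "nat \<Rightarrow> nat \<Rightarrow> 'a::comm_ring_1"
  shows "det (mat n n (\<lambda>(i, j). F (Suc i) j - w * F i j)) =
    (\<Sum>i<Suc n. (- 1) ^ i * w ^ i * det (mat n n (\<lambda>(i', j). F (skip i i') j)))"
proof -
  define P where "P i j = (if j = 0 then w ^ i else F i (j - 1))" for i j :: nat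
  define Q where "Q i j = F i j - (if i = 0 then 0 else w * F (i - 1) j)" for i j
  have "(\<Sum>i<Suc n. (- 1) ^ i * w ^ i * det (mat n n (\<lambda>(i', j). F (skip i i') j))) =
      det (mat (Suc n) (Suc n) (\<lambda>(i, j). P i j))"
    unfolding P_def by (rule det_first_column[symmetric])
  also have "\<dots> = det (mat (Suc n) (Suc n) (\<lambda>(i, j). P i j - (if i = 0 then 0 else w * P (i - 1) j)))"
    by (rule det_row_shift[symmetric])
  also have "mat (Suc n) (Suc n) (\<lambda>(i, j). P i j - (if i = 0 then 0 else w * P (i - 1) j)) =
      mat (Suc n) (Suc n) (\<lambda>(i, j). if j = 0 then (if i = 0 then 1 else 0) else Q i (j - 1))"
    by (rule eq_matI) (auto simp: P_def Q_def simp flip: power_Suc)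
  also have "det \<dots> = (\<Sum>i<Suc n. (- 1) ^ i * (if i = 0 then 1 else 0) * det (mat n n (\<lambda>(i', j). Q (skip i i') j)))"
    by (rule det_first_column)
  also have "\<dots> = det (mat n n (\<lambda>(i', j). Q (skip 0 i') j))"
    by (subst sum.lessThan_Suc_shift) simp
  also have "\<dots> = det (mat n n (\<lambda>(i, j). F (Suc i) j - w * F i j))"
    by (rule arg_cong[of _ _ det], rule eq_matI) (auto simp: Q_def skip_def)
  finally show ?thesis by simp
qed

definition laurent_coeff :: "Binf fps \<Rightarrow> Binf poly \<Rightarrow> int \<Rightarrow> Binf" where
  "laurent_coeff f p n = fls_nth (fps_to_fls f * poly_zinv p) n"

lemma laurent_coeff_eq:
  "laurent_coeff f p n = (\<Sum>i\<le>degree p. fps_coeff_int f (n + int i) * poly.coeff p i)"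
proof -
  have deg: "degree (map_poly fls_const p) \<le> degree p" by (rule degree_le) (simp add: coeff_map_poly coeff_eq_0)
  have "poly_zinv p = (\<Sum>i\<le>degree (map_poly fls_const p). fls_const (poly.coeff p i) * fls_X_inv ^ i)"
    by (simp add: poly_zinv_def poly_altdef coeff_map_poly)
  also have "\<dots> = (\<Sum>i\<le>degree p. fls_const (poly.coeff p i) * fls_X_inv ^ i)"
  proof (rule sum.mono_neutral_left)
    show "\<forall>i\<in>{..degree p} - {..degree (map_poly fls_const p)}. fls_const (poly.coeff p i) * fls_X_inv ^ i = 0"
      using coeff_eq_0[of "map_poly fls_const p"] by (auto simp: coeff_map_poly not_le)
  qed (use deg in auto)
  finally have "laurent_coeff f p n =
      (\<Sum>i\<le>degree p. fls_nth (fps_to_fls f * (fls_const (poly.coeff p i) * fls_X_inv ^ i)) n)"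
    by (simp add: laurent_coeff_def sum_distrib_left additive_sum[of "\<lambda>g. fls_nth g n", OF fls_plus_nth])
  also have "\<dots> = (\<Sum>i\<le>degree p. fps_coeff_int f (n + int i) * poly.coeff p i)"
  proof (intro sum.cong refl)
    fix i
    have eq: "fps_to_fls f * (fls_const (poly.coeff p i) * fls_X_inv ^ i) =
        fls_shift (int i) (fps_to_fls f * fls_const (poly.coeff p i))"
      by (rule trans[OF mult.assoc[symmetric] fls_X_inv_power_times_conv_shift(2)])
    show "fls_nth (fps_to_fls f * (fls_const (poly.coeff p i) * fls_X_inv ^ i)) n =
        fps_coeff_int f (n + int i) * poly.coeff p i"
      unfolding eq by (simp add: fps_coeff_int_def)
  qed
  finally show ?thesis .
qed

lemma laurent_coeff_eq_sum:
  assumes "degree p < K"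
  shows "laurent_coeff f p n = (\<Sum>i<K. fps_coeff_int f (n + int i) * poly.coeff p i)"
  unfolding laurent_coeff_eq using assms
  by (intro sum.mono_neutral_left) (auto simp: coeff_eq_0)

lemma laurent_coeff_add: "laurent_coeff f (p + q) n = laurent_coeff f p n + laurent_coeff f q n"
proof -
  define K where "K = Suc (max (degree p) (degree q))"
  have "degree p < K" "degree q < K" "degree (p + q) < K"
    using degree_add_le_max[of p q] by (auto simp: K_def)
  then show ?thesis by (simp add: laurent_coeff_eq_sum distrib_left sum.distrib)
qed

lemma laurent_coeff_pm_extend:
  "laurent_coeff f (pm_extend g c) n = pm_extend (\<lambda>k. laurent_coeff f (g k) n) c"
  by (simp add: pm_extend_def additive_sum[of "\<lambda>p. laurent_coeff f p n", OF laurent_coeff_add]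
      additive_of_int_mult[of "\<lambda>p. laurent_coeff f p n", OF laurent_coeff_add])

lemma laurent_coeff_sum: "laurent_coeff f (sum g A) n = (\<Sum>a\<in>A. laurent_coeff f (g a) n)"
  by (rule additive_sum) (rule laurent_coeff_add)

lemma laurent_coeff_monom: "laurent_coeff f (Polynomial.monom c i) n = fps_coeff_int f (n + int i) * c"
proof -
  have "laurent_coeff f (Polynomial.monom c i) n =
      (\<Sum>j<Suc i. fps_coeff_int f (n + int j) * poly.coeff (Polynomial.monom c i) j)"
    by (rule laurent_coeff_eq_sum) (simp add: degree_monom_le less_Suc_eq_le)
  then show ?thesis by simp
qed

lemma laurent_coeff_mult_const: "laurent_coeff f (p * [:c:]) n = laurent_coeff f p n * c"
proof -
  have "degree (p * [:c:]) < Suc (degree p)"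
    using degree_mult_le[of p "[:c:]"] by simp
  then have "laurent_coeff f (p * [:c:]) n =
      (\<Sum>i<Suc (degree p). fps_coeff_int f (n + int i) * poly.coeff (p * [:c:]) i)"
    by (rule laurent_coeff_eq_sum)
  also have "\<dots> = (\<Sum>i<Suc (degree p). fps_coeff_int f (n + int i) * poly.coeff p i) * c"
    unfolding sum_distrib_right by (intro sum.cong refl) (simp add: mult_ac)
  also have "\<dots> = laurent_coeff f p n * c" by (simp add: laurent_coeff_eq_sum[of p "Suc (degree p)"])
  finally show ?thesis .
qed

abbreviation bar_seq :: "nat \<Rightarrow> int" where
  "bar_seq \<equiv> \<lambda>i. if i = 0 then 1 else if i = 1 then - 1 else 0"

lemma shift_series_bar:
  "shift_series bar_seq m = [:Hinf m:] - Polynomial.monom 1 1 * [:Hinf (m - 1):]"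
proof -
  have "shift_series bar_seq m = (\<Sum>i<Suc (Suc (nat m)). of_int (bar_seq i) * Polynomial.monom 1 i * [:Hinf (m - int i):])"
    by (rule shift_series_eq) simp
  then show ?thesis by (simp add: sum.lessThan_Suc_shift del: sum.lessThan_Suc)
qed

text \<open>
  Bernstein's operator: expanding the determinant for \<open>(n + r) # qs\<close> along its first column.
\<close>

lemma laurent_coeff_bar:
  "laurent_coeff (fps_recip Einf) (seq_det (shift_series bar_seq) qs) n =
    seq_det Hinf ((n + int (length qs)) # qs)"
proof -
  let ?r = "length qs"
  define F where "F i j = Hinf (qs ! j + int i - int ?r)" for i j
  define m where "m i = det (mat ?r ?r (\<lambda>(i', j). F (skip i i') j))" for i
  interpret comm_ring_hom "\<lambda>x::Binf. [:x:]" by unfold_locales (simp_all add: one_pCons)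
  have "seq_det (shift_series bar_seq) qs =
      det (mat ?r ?r (\<lambda>(i, j). [:F (Suc i) j:] - Polynomial.monom 1 1 * [:F i j:]))"
    unfolding seq_det_def
    by (rule arg_cong[of _ _ det], rule eq_matI) (auto simp: shift_series_bar F_def algebra_simps)
  also have "\<dots> = (\<Sum>i<Suc ?r. (- 1) ^ i * Polynomial.monom 1 1 ^ i * det (mat ?r ?r (\<lambda>(i', j). [:F (skip i i') j:])))"
    by (rule det_row_difference)
  also have "\<dots> = (\<Sum>i<Suc ?r. Polynomial.monom ((- 1) ^ i * m i) i)"
  proof (intro sum.cong refl)
    fix i
    have "det (mat ?r ?r (\<lambda>(i', j). [:F (skip i i') j:])) = [:m i:]"
      unfolding m_def hom_det[symmetric] by (rule arg_cong[of _ _ det], rule eq_matI) auto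
    moreover have "(- 1) ^ i * Polynomial.monom 1 1 ^ i * [:c:] = Polynomial.monom ((- 1) ^ i * c) i" for c :: Binf
      by (cases "even i") (simp_all add: monom_power smult_monom minus_monom)
    ultimately show "(- 1) ^ i * Polynomial.monom 1 1 ^ i * det (mat ?r ?r (\<lambda>(i', j). [:F (skip i i') j:])) =
        Polynomial.monom ((- 1) ^ i * m i) i" by simp
  qed
  finally have "laurent_coeff (fps_recip Einf) (seq_det (shift_series bar_seq) qs) n =
      (\<Sum>i<Suc ?r. (- 1) ^ i * Hinf (n + int i) * m i)"
    by (simp add: laurent_coeff_sum laurent_coeff_monom mult_ac del: sum.lessThan_Suc flip: Hinf_def)
  also have "\<dots> = det (mat (Suc ?r) (Suc ?r) (\<lambda>(i, j). if j = 0 then Hinf (n + int i) else F i (j - 1)))"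
    unfolding m_def by (rule det_first_column[symmetric])
  also have "\<dots> = seq_det Hinf ((n + int ?r) # qs)"
    unfolding seq_det_def
    by (rule arg_cong[of _ _ det], rule eq_matI) (auto simp: F_def nth_Cons' algebra_simps)
  finally show ?thesis .
qed

lemma det_first_row:
  fixes c :: "int \<Rightarrow> 'a::comm_ring_1"
  assumes "length qs = r" "0 < r"
  shows "det (mat r r (\<lambda>(i, j). if i = 0 then u j else c (qs ! j + 1 + int i - int r))) =
    (\<Sum>j<r. (- 1) ^ j * u j * seq_det c (remove_nth j qs))"
proof -
  let ?A = "mat r r (\<lambda>(i, j). if i = 0 then u j else c (qs ! j + 1 + int i - int r))"
  have "det ?A = (\<Sum>j<r. ?A $$ (0, j) * cofactor ?A 0 j)"
    using assms by (intro laplace_expansion_row) auto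
  also have "\<dots> = (\<Sum>j<r. (- 1) ^ j * u j * seq_det c (remove_nth j qs))"
  proof (intro sum.cong refl)
    fix j assume j: "j \<in> {..<r}"
    have len: "length (remove_nth j qs) = r - 1" using j assms by (simp add: remove_nth_def)
    have "mat_delete ?A 0 j = mat (r - 1) (r - 1) (\<lambda>(i, k). c (remove_nth j qs ! k + 1 + int i - int (r - 1)))"
      using j assms by (intro eq_matI) (auto simp: mat_delete_def remove_nth_def nth_append of_nat_diff algebra_simps)
    then have "det (mat_delete ?A 0 j) = seq_det c (remove_nth j qs)"
      by (simp add: seq_det_def len)
    then show "?A $$ (0, j) * cofactor ?A 0 j = (- 1) ^ j * u j * seq_det c (remove_nth j qs)"
      using j assms by (simp add: cofactor_def)
  qed
  finally show ?thesis .
qed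

abbreviation one_seq :: "nat \<Rightarrow> int" where
  "one_seq \<equiv> \<lambda>_. 1"

lemma shift_series_one:
  "shift_series one_seq m - Polynomial.monom 1 1 * shift_series one_seq (m - 1) = [:Hinf m:]"
proof (cases "m < 0")
  case False
  have "shift_series one_seq m = (\<Sum>i<Suc (Suc (nat m)). Polynomial.monom 1 i * [:Hinf (m - int i):])"
    by (subst shift_series_eq[of _ "Suc (Suc (nat m))"]) auto
  also have "\<dots> = [:Hinf m:] + (\<Sum>i<Suc (nat m). Polynomial.monom 1 1 * (Polynomial.monom 1 i * [:Hinf (m - 1 - int i):]))"
    by (subst sum.lessThan_Suc_shift) (simp add: mult_monom algebra_simps flip: mult.assoc)
  also have "(\<Sum>i<Suc (nat m). Polynomial.monom 1 1 * (Polynomial.monom 1 i * [:Hinf (m - 1 - int i):])) =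
      Polynomial.monom 1 1 * shift_series one_seq (m - 1)"
    by (subst shift_series_eq[of _ "Suc (nat m)"]) (auto simp: sum_distrib_left)
  finally show ?thesis by simp
qed (simp add: shift_series_neg)

text \<open>
  \<open>E(z)H(z) = 1\<close>, with the terms split according to whether the index of \<open>h\<close> exceeds \<open>m\<close>.
\<close>

lemma laurent_coeff_shift_series:
  "laurent_coeff Einf (shift_series one_seq m) n =
    (if n + m = 0 then 1 else 0) -
    (\<Sum>l\<in>{1..nat n}. fps_coeff_int Einf (n - int l) * Hinf (m + int l))"
proof -
  define c where "c k = fps_coeff_int Einf k * Hinf (n + m - k)" for k
  have c_neg: "c k = 0" if "k < 0" for k using that by (simp add: c_def)
  have c_big: "c k = 0" if "k > n + m" for k using that by (simp add: c_def)
  have "laurent_coeff Einf (shift_series one_seq m) n = (\<Sum>i\<le>nat m. c (n + int i))"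
    by (simp add: shift_series_def laurent_coeff_sum laurent_coeff_monom c_def)
  also have "\<dots> = (\<Sum>k\<in>{n..n + int (nat m)}. c k)"
    by (rule sum.reindex_bij_witness[of _ "\<lambda>k. nat (k - n)" "\<lambda>i. n + int i"]) (auto split: if_splits)
  finally have 1: "laurent_coeff Einf (shift_series one_seq m) n = (\<Sum>k\<in>{n..n + int (nat m)}. c k)" .
  have 2: "(\<Sum>l\<in>{1..nat n}. fps_coeff_int Einf (n - int l) * Hinf (m + int l)) = (\<Sum>k\<in>{n - int (nat n)..<n}. c k)"
    by (rule sum.reindex_bij_witness[of _ "\<lambda>k. nat (n - k)" "\<lambda>l. n - int l"])
      (auto simp: c_def algebra_simps split: if_splits)
  have "(\<Sum>k\<in>{n - int (nat n)..<n}. c k) + (\<Sum>k\<in>{n..n + int (nat m)}. c k) =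
      (\<Sum>k\<in>{n - int (nat n)..<n} \<union> {n..n + int (nat m)}. c k)"
    by (rule sum.union_disjoint[symmetric]) auto
  also have "\<dots> = (\<Sum>k\<in>{0..n + m}. c k)"
    by (rule sum.mono_neutral_right) (auto intro: c_neg c_big simp: not_le)
  also have "\<dots> = (if n + m = 0 then 1 else 0)"
  proof (cases "n + m < 0")
    case False
    have "(\<Sum>k\<in>{0..n + m}. c k) = (\<Sum>i=0..nat (n + m). fps_nth Einf i * fps_nth (fps_recip Einf) (nat (n + m) - i))"
      using False
      by (intro sum.reindex_bij_witness[of _ int nat])
        (auto simp: c_def fps_coeff_int_def Hinf_def nat_diff_distrib)
    also have "\<dots> = fps_nth (Einf * fps_recip Einf) (nat (n + m))" by (simp add: fps_mult_nth)
    also have "Einf * fps_recip Einf = 1" by (rule fps_recip_mult) (simp add: Einf_def)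
    finally show ?thesis using False by auto
  qed auto
  finally show ?thesis using 1 2 by (simp add: algebra_simps)
qed

lemma seq_det_shift_one:
  assumes "length qs = r" "0 < r"
  shows "seq_det (shift_series one_seq) qs =
    (\<Sum>j<r. (- 1) ^ j * shift_series one_seq (qs ! j + 1 - int r) * [:seq_det Hinf (remove_nth j qs):])"
proof -
  define F where "F i j = shift_series one_seq (qs ! j + 1 + int i - int r)" for i j
  have "seq_det (shift_series one_seq) qs = det (mat r r (\<lambda>(i, j). F i j))"
    by (simp add: seq_det_def F_def assms)
  also have "\<dots> = det (mat r r (\<lambda>(i, j). F i j - (if i = 0 then 0 else Polynomial.monom 1 1 * F (i - 1) j)))"
    by (rule det_row_shift[symmetric])
  also have "\<dots> = det (mat r r (\<lambda>(i, j). if i = 0 then F 0 j else [:Hinf (qs ! j + 1 + int i - int r):]))"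
  proof (rule arg_cong[of _ _ det], rule eq_matI)
    fix i j
    assume "i < dim_row (mat r r (\<lambda>(i, j). if i = 0 then F 0 j else [:Hinf (qs ! j + 1 + int i - int r):]))"
      "j < dim_col (mat r r (\<lambda>(i, j). if i = 0 then F 0 j else [:Hinf (qs ! j + 1 + int i - int r):]))"
    moreover have "F i j - Polynomial.monom 1 1 * F (i - 1) j = [:Hinf (qs ! j + 1 + int i - int r):]" if "i \<noteq> 0"
      using that shift_series_one[of "qs ! j + 1 + int i - int r"] by (simp add: F_def of_nat_diff algebra_simps)
    ultimately show "mat r r (\<lambda>(i, j). F i j - (if i = 0 then 0 else Polynomial.monom 1 1 * F (i - 1) j)) $$ (i, j) =
        mat r r (\<lambda>(i, j). if i = 0 then F 0 j else [:Hinf (qs ! j + 1 + int i - int r):]) $$ (i, j)" by auto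
  qed auto
  also have "\<dots> = (\<Sum>j<r. (- 1) ^ j * F 0 j * seq_det (\<lambda>m. [:Hinf m:]) (remove_nth j qs))"
    using det_first_row[OF assms, of "F 0" "\<lambda>m. [:Hinf m:]"] .
  also have "\<dots> = (\<Sum>j<r. (- 1) ^ j * F 0 j * [:seq_det Hinf (remove_nth j qs):])"
    by (simp add: seq_det_eq_col_det[of "\<lambda>m. [:Hinf m:]"] col_det_const)
  finally show ?thesis by (simp add: F_def)
qed

lemma det_repeated_row:
  assumes "length qs = r" "0 < l" "l < r"
  shows "(\<Sum>j<r. (- 1) ^ j * Hinf (qs ! j + 1 - int r + int l) * seq_det Hinf (remove_nth j qs)) = 0"
proof -
  let ?A = "mat r r (\<lambda>(i, j). if i = 0 then Hinf (qs ! j + 1 - int r + int l) else Hinf (qs ! j + 1 + int i - int r))"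
  have "row ?A 0 = row ?A l" using assms by (intro eq_vecI) (auto simp: algebra_simps)
  then have "det ?A = 0" using assms by (intro det_identical_rows[of ?A r 0 l]) auto
  then show ?thesis using det_first_row[of qs r "\<lambda>j. Hinf (qs ! j + 1 - int r + int l)" Hinf] assms by simp
qed

text \<open>
  The dual operator. The condition \<open>n < r\<close> makes the terms with index beyond \<open>m\<close> of the
  previous lemma sum up to determinants with a repeated row.
\<close>

lemma laurent_coeff_one:
  assumes r: "length qs = r" "0 < r" and n: "n < int r"
  shows "laurent_coeff Einf (seq_det (shift_series one_seq) qs) n =
    (\<Sum>j<r. (- 1) ^ j * (if qs ! j = int r - 1 - n then seq_det Hinf (remove_nth j qs) else 0))"
proof -
  define a where "a j = qs ! j + 1 - int r" for j
  define S where "S j = seq_det Hinf (remove_nth j qs)" for j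
  define L where "L = {1..nat n}"
  have sign: "laurent_coeff Einf ((- 1) ^ j * p) n = (- 1) ^ j * laurent_coeff Einf p n" for j p
    using additive_uminus[of "\<lambda>p. laurent_coeff Einf p n", OF laurent_coeff_add] by (cases "even j") auto
  have "laurent_coeff Einf (seq_det (shift_series one_seq) qs) n =
      (\<Sum>j<r. (- 1) ^ j * (laurent_coeff Einf (shift_series one_seq (a j)) n * S j))"
    unfolding seq_det_shift_one[OF r] laurent_coeff_sum a_def S_def mult.assoc sign laurent_coeff_mult_const ..
  also have "\<dots> = (\<Sum>j<r. (- 1) ^ j * (if n + a j = 0 then S j else 0)) -
      (\<Sum>j<r. \<Sum>l\<in>L. fps_coeff_int Einf (n - int l) * ((- 1) ^ j * Hinf (a j + int l) * S j))"
    unfolding laurent_coeff_shift_series L_def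
    by (subst sum_subtractf[symmetric], intro sum.cong refl)
      (auto simp: left_diff_distrib right_diff_distrib sum_distrib_left sum_distrib_right mult_ac)
  also have "(\<Sum>j<r. \<Sum>l\<in>L. fps_coeff_int Einf (n - int l) * ((- 1) ^ j * Hinf (a j + int l) * S j)) =
      (\<Sum>l\<in>L. fps_coeff_int Einf (n - int l) * (\<Sum>j<r. (- 1) ^ j * Hinf (a j + int l) * S j))"
    by (subst sum.swap) (simp add: sum_distrib_left)
  also have "\<dots> = 0"
  proof (intro sum.neutral ballI)
    fix l assume "l \<in> L"
    then have "(\<Sum>j<r. (- 1) ^ j * Hinf (a j + int l) * S j) = 0"
      unfolding a_def S_def using r n by (intro det_repeated_row) (auto simp: L_def)
    then show "fps_coeff_int Einf (n - int l) * (\<Sum>j<r. (- 1) ^ j * Hinf (a j + int l) * S j) = 0" by simp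
  qed
  finally show ?thesis by (simp add: a_def S_def algebra_simps eq_diff_eq cong: if_cong)
qed

lemma poly_0_seq_det: "poly.coeff (seq_det (shift_series one_seq) qs) 0 = seq_det Hinf qs"
proof -
  interpret comm_ring_hom "\<lambda>p::Binf poly. poly p 0" by unfold_locales simp_all
  have "poly (shift_series one_seq m) 0 = Hinf m" for m
    using arg_cong[OF shift_series_one[of m], of "\<lambda>p. poly p 0"] by (simp add: poly_monom)
  then have "poly (seq_det (shift_series one_seq) qs) 0 = seq_det Hinf qs"
    unfolding seq_det_def hom_det[symmetric] by (intro arg_cong[of _ _ det] eq_matI) auto
  then show ?thesis by (simp add: poly_0_coeff_0)
qed


section \<open>The Schur determinants span\<close>

abbreviation part_weight :: "nat \<Rightarrow> partn \<Rightarrow> nat" where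
  "part_weight r lam \<equiv> (\<Sum>j<r. lam j)"

lemma sum_list_positions: "sum_list (positions r lam) = int (part_weight r lam) + (\<Sum>j<r. int r - 1 - int j)"
proof -
  have "sum_list (positions r lam) = (\<Sum>j<r. int (lam j) + (int r - 1 - int j))"
    by (simp add: positions_def interv_sum_list_conv_sum_set_nat lessThan_atLeast0 algebra_simps)
  then show ?thesis by (simp add: sum.distrib)
qed

lemma Einf_mult_schur_inf:
  assumes "lam \<in> Par_le r" "n + part_weight r lam < r"
  shows "fps_nth Einf n * schur_inf lam \<in> int_span Par schur_inf"
  using assms
proof (induction "part_weight r lam" arbitrary: n lam rule: less_induct)
  case less
  define qs where "qs = positions r lam"
  define g where "g = seq_det (shift_series one_seq) qs"
  have len: "length qs = r" "0 < r" using less.prems by (auto simp: qs_def)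
  have "laurent_coeff Einf g (int n) = (\<Sum>j<r. (- 1) ^ j *
      (if qs ! j = int r - 1 - int n then seq_det Hinf (remove_nth j qs) else 0))"
    unfolding g_def using less.prems by (intro laurent_coeff_one len) auto
  also have "\<dots> \<in> int_span Par schur_inf"
    using schur_span_subset[OF seq_det_in_schur_span] by (intro int_span_sum int_span_sign_mult) auto
  finally have 1: "laurent_coeff Einf g (int n) \<in> int_span Par schur_inf" .
  have "corresponds (length qs) (sum_list qs) (sigma_minus (bas_wedge qs)) g"
    unfolding g_def by (rule corresponds_shift[OF shift_hom_sigma_minus])
  then have coeff_g: "poly.coeff g i \<in> weight_span r (sum_list qs - int i)" for i
    by (simp add: corresponds_def len)
  have 2: "fps_nth Einf (n + Suc i) * poly.coeff g (Suc i) \<in> int_span Par schur_inf" for i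
    using coeff_g[of "Suc i"] unfolding weight_span_def
  proof (induction rule: int_span_induct)
    case (base mu)
    then have "int (part_weight r mu) = int (part_weight r lam) - int (Suc i)"
      by (simp add: qs_def sum_list_positions)
    then have "part_weight r mu + Suc i = part_weight r lam" by linarith
    then have "part_weight r mu < part_weight r lam" "n + Suc i + part_weight r mu < r"
      using less.prems(2) by linarith+
    then show ?case using base by (intro less.hyps) auto
  qed (auto simp: distrib_left)
  have "laurent_coeff Einf g (int n) = (\<Sum>i<Suc (degree g). fps_nth Einf (n + i) * poly.coeff g i)"
    by (subst laurent_coeff_eq_sum[of _ "Suc (degree g)"]) (simp_all add: fps_coeff_int_def nat_add_distrib del: sum.lessThan_Suc)
  also have "\<dots> = fps_nth Einf n * seq_det Hinf qs +
      (\<Sum>i<degree g. fps_nth Einf (n + Suc i) * poly.coeff g (Suc i))"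
    by (subst sum.lessThan_Suc_shift) (simp add: g_def poly_0_seq_det)
  finally have "fps_nth Einf n * seq_det Hinf qs = laurent_coeff Einf g (int n) -
      (\<Sum>i<degree g. fps_nth Einf (n + Suc i) * poly.coeff g (Suc i))" by simp
  also have "\<dots> \<in> int_span Par schur_inf" using 1 2 by (intro int_span_diff int_span_sum)
  finally show ?case
    using schur_inf_eq[OF less.prems(1)] by (simp add: qs_def schur_det_eq_seq_det)
qed

lemma evar_mult_in_span:
  assumes "x \<in> int_span Par schur_inf" "0 < n"
  shows "evar n * x \<in> int_span Par schur_inf"
  using assms(1)
proof (induction rule: int_span_induct)
  case (base lam)
  then obtain l where l: "lam \<in> Par_le l" by (auto simp: Par_def)
  define r where "r = l + n + part_weight l lam + 1"
  have lam: "lam \<in> Par_le r" using l by (rule Par_le_mono) (simp add: r_def)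
  have "part_weight r lam = part_weight l lam"
    using l by (intro sum.mono_neutral_right) (auto simp: r_def Par_le_def)
  then have "fps_nth Einf n * schur_inf lam \<in> int_span Par schur_inf"
    by (intro Einf_mult_schur_inf[OF lam]) (simp add: r_def)
  then have "(- 1) ^ n * ((- 1) ^ n * (evar n * schur_inf lam)) \<in> int_span Par schur_inf"
    using assms(2) by (intro int_span_sign_mult[of "(- 1) ^ n * (evar n * schur_inf lam)"])
      (simp add: Einf_def mult.assoc)
  moreover have "(- 1) ^ n * ((- 1) ^ n * x) = x" for x :: Binf by (cases "even n") simp_all
  ultimately show ?case by simp
qed (auto simp: distrib_left)

lemma schur_inf_span: "int_span Par schur_inf = UNIV"
proof -
  have one: "1 \<in> int_span Par schur_inf"
  proof -
    have "schur_inf (\<lambda>_. 0) = 1" by (simp add: schur_inf_def par_length_def schur_det_def)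
    moreover have "(\<lambda>_. 0) \<in> Par" by (auto simp: Par_def Par_le_def antimono_def)
    ultimately show ?thesis by (metis int_span_base)
  qed
  have pow: "xvar v ^ e * x \<in> int_span Par schur_inf" if "x \<in> int_span Par schur_inf" for v e x
  proof (induction e)
    case (Suc e)
    have "xvar v = evar (Suc v)" by (simp add: xvar_def evar_def)
    then show ?case using evar_mult_in_span[OF Suc, of "Suc v"] by (simp add: mult.assoc)
  qed (use that in simp)
  have "(\<Prod>v\<in>A. xvar v ^ f v) \<in> int_span Par schur_inf" for A and f :: "nat \<Rightarrow> nat"
    by (induction A rule: infinite_finite_induct) (simp_all add: one pow)
  moreover have "Poly_Mapping.single m 1 = (\<Prod>v\<in>Poly_Mapping.keys m. xvar v ^ Poly_Mapping.lookup m v)"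
    for m :: "nat \<Rightarrow>\<^sub>0 nat"
  proof -
    have "(\<Sum>v\<in>Poly_Mapping.keys m. Poly_Mapping.single v (Poly_Mapping.lookup m v)) = m"
    proof (rule poly_mapping_eqI)
      fix i
      have "Poly_Mapping.lookup (\<Sum>v\<in>Poly_Mapping.keys m. Poly_Mapping.single v (Poly_Mapping.lookup m v)) i =
          (\<Sum>v\<in>Poly_Mapping.keys m. if v = i then Poly_Mapping.lookup m v else 0)"
        unfolding lookup_sum by (intro sum.cong) (auto simp: lookup_single when_def)
      then show "Poly_Mapping.lookup (\<Sum>v\<in>Poly_Mapping.keys m. Poly_Mapping.single v (Poly_Mapping.lookup m v)) i =
          Poly_Mapping.lookup m i" by (simp add: in_keys_iff)
    qed
    then show ?thesis by (simp add: xvar_power prod_single_one)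
  qed
  ultimately have single: "Poly_Mapping.single m 1 \<in> int_span Par schur_inf" for m by simp
  have "x \<in> int_span Par schur_inf" for x
    by (induction x rule: pm_induct) (auto intro: single)
  then show ?thesis by auto
qed

lemma to_wedge_add_UNIV: "to_wedge r (x + y) = to_wedge r x + to_wedge r y"
  by (simp add: to_wedge_def additive_ext_add int_indep_schur_inf schur_inf_span)


section \<open>The tensor product\<close>

lemma tens_add_left: "tens (a + a') b = tens a b + tens a' b"
proof (transfer)
  fix a a' :: 'a and b :: 'b
  show "tensor_eq (Poly_Mapping.single (a + a', b) 1) (Poly_Mapping.single (a, b) 1 + Poly_Mapping.single (a', b) 1)"
    using tensor_rel.left[of a a' b] by (simp add: tensor_eq_def algebra_simps)
qed

lemma tens_add_right: "tens a (b + b') = tens a b + tens a b'"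
proof (transfer)
  fix a :: 'a and b b' :: 'b
  show "tensor_eq (Poly_Mapping.single (a, b + b') 1) (Poly_Mapping.single (a, b) 1 + Poly_Mapping.single (a, b') 1)"
    using tensor_rel.right[of a b b'] by (simp add: tensor_eq_def algebra_simps)
qed

lemmas tens_zero_left [simp] = additive_zero[of "\<lambda>a. tens a b" for b, OF tens_add_left]
lemmas tens_zero_right [simp] = additive_zero[of "tens a" for a, OF tens_add_right]
lemmas tens_sum_left = additive_sum[of "\<lambda>a. tens a b" for b, OF tens_add_left]
lemmas tens_sum_right = additive_sum[of "tens a" for a, OF tens_add_right]

lemma tens_of_int_mult: "tens (of_int c * x) y = tens x (of_int c * y)"
proof (induction c rule: int_induct[of _ 0])
  case base then show ?case by simp
next
  case (step1 i) then show ?case by (simp add: distrib_right tens_add_left tens_add_right)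
next
  case (step2 i)
  then show ?case
    by (simp add: left_diff_distrib additive_diff[of "\<lambda>a. tens a y", OF tens_add_left]
        additive_diff[of "tens x", OF tens_add_right])
qed

lemma sum_tens_biadditive:
  fixes beta :: "'a::ab_group_add \<Rightarrow> 'b::ab_group_add \<Rightarrow> 'r::ring_1"
  assumes left: "\<And>a a' b. beta (a + a') b = beta a b + beta a' b"
    and right: "\<And>a b b'. beta a (b + b') = beta a b + beta a b'"
    and zero: "(\<Sum>k\<in>A. tens (f k) (g k)) = 0"
  shows "(\<Sum>k\<in>A. beta (f k) (g k)) = 0"
proof -
  have rel: "pm_extend (\<lambda>(a, b). beta a b) x = 0" if "x \<in> tensor_rel" for x
    using that by (induction rule: tensor_rel.induct)
      (simp_all add: pm_extend_add pm_extend_uminus pm_extend_diff left right)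
  have abs: "(\<Sum>k\<in>A. tens (f k) (g k)) = abs_tensor (\<Sum>k\<in>A. Poly_Mapping.single (f k, g k) 1)"
    by (induction A rule: infinite_finite_induct) (simp_all add: zero_tensor_def tens.abs_eq plus_tensor.abs_eq)
  have "tensor_eq (\<Sum>k\<in>A. Poly_Mapping.single (f k, g k) 1) 0"
    using zero unfolding abs zero_tensor_def by (simp add: tensor.abs_eq_iff)
  then have "pm_extend (\<lambda>(a, b). beta a b) (\<Sum>k\<in>A. Poly_Mapping.single (f k, g k) 1) = 0"
    unfolding tensor_eq_def by (intro rel) simp
  then show ?thesis by (simp add: pm_extend_sum)
qed

lemma tens_fls_nth:
  "fls_nth (tens_fls f g) n = (\<Sum>i | fls_nth f i \<noteq> 0 \<and> fls_nth g (n - i) \<noteq> 0. tens (fls_nth f i) (fls_nth g (n - i)))"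
  unfolding tens_fls_def
proof (subst nth_Abs_fls_lower_bound[of "fls_subdegree f + fls_subdegree g"])
  show "\<forall>m<fls_subdegree f + fls_subdegree g.
      (\<Sum>i | fls_nth f i \<noteq> 0 \<and> fls_nth g (m - i) \<noteq> 0. tens (fls_nth f i) (fls_nth g (m - i))) = 0"
  proof (intro allI impI)
    fix m assume m: "m < fls_subdegree f + fls_subdegree g"
    have "{i. fls_nth f i \<noteq> 0 \<and> fls_nth g (m - i) \<noteq> 0} = {}"
    proof -
      have False if "fls_nth f i \<noteq> 0" "fls_nth g (m - i) \<noteq> 0" for i
        using fls_subdegree_leI[OF that(1)] fls_subdegree_leI[OF that(2)] m by linarith
      then show ?thesis by blast
    qed
    then show "(\<Sum>i | fls_nth f i \<noteq> 0 \<and> fls_nth g (m - i) \<noteq> 0. tens (fls_nth f i) (fls_nth g (m - i))) = 0"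
      by (simp only: sum.empty)
  qed
qed simp


section \<open>The bilinear identity\<close>

lemma pm_extend_hom:
  assumes "\<And>x y. h (x + y) = h x + h y"
  shows "h (pm_extend f c) = pm_extend (\<lambda>k. h (f k)) c"
  unfolding pm_extend_def
  by (simp add: additive_sum[of h, OF assms] additive_of_int_mult[of h, OF assms])

lemma pm_extend_in_span:
  assumes "\<And>k. k \<in> Poly_Mapping.keys c \<Longrightarrow> f k \<in> int_span I v"
  shows "pm_extend f c \<in> int_span I v"
  unfolding pm_extend_def using assms by (intro int_span_sum int_span_of_int_mult)

context
  fixes c :: "partn \<Rightarrow>\<^sub>0 int" and r :: nat and T :: "M0 ext" and F G :: "int \<Rightarrow> Binf"
  assumes c: "Poly_Mapping.keys c \<subseteq> Par_le r" and r: "0 < r"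
  defines "T \<equiv> pm_extend (bwedge r) c"
    and "F \<equiv> laurent_coeff Einf (sigma_minus_B (pm_extend schur_inf c))"
    and "G \<equiv> laurent_coeff (fps_recip Einf) (sigma_bar_minus_B (pm_extend schur_inf c))"
begin

lemma F_eq: "F n = pm_extend (\<lambda>lam. laurent_coeff Einf (seq_det (shift_series one_seq) (positions r lam)) n) c"
  unfolding F_def sigma_minus_B_def
  by (subst transfer_op_eq[OF shift_hom_sigma_minus _ c]) (simp_all add: laurent_coeff_pm_extend)

lemma G_eq: "G n = pm_extend (\<lambda>lam. seq_det Hinf ((n + int r) # positions r lam)) c"
  unfolding G_def sigma_bar_minus_B_def
  by (subst transfer_op_eq[OF shift_hom_sigma_bar_minus _ c]) (simp_all add: laurent_coeff_pm_extend laurent_coeff_bar)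

lemma F_wedge:
  "F (int r - 1 - int k) \<in> schur_span (r - 1)"
  "to_wedge (r - 1) (F (int r - 1 - int k)) = contr k T"
proof -
  define S where "S lam j = (if positions r lam ! j = int k then seq_det Hinf (remove_nth j (positions r lam)) else 0)" for lam j
  have eq: "laurent_coeff Einf (seq_det (shift_series one_seq) (positions r lam)) (int r - 1 - int k) =
      (\<Sum>j<r. (- 1) ^ j * S lam j)" for lam
    unfolding S_def by (subst laurent_coeff_one[of _ r]) (use r in auto)
  have S: "S lam j \<in> schur_span (r - 1) \<and>
      to_wedge (r - 1) (S lam j) = (if positions r lam ! j = int k then bas_wedge (remove_nth j (positions r lam)) else 0)"
    if "j < r" for lam j
  proof -
    have "length (remove_nth j (positions r lam)) = r - 1" using that by (simp add: remove_nth_def)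
    then show ?thesis
      using seq_det_in_schur_span[of "remove_nth j (positions r lam)"]
        seq_det_to_wedge(2)[of "remove_nth j (positions r lam)"]
      by (auto simp: S_def to_wedge_zero)
  qed
  have span: "(\<Sum>j<r. (- 1) ^ j * S lam j) \<in> schur_span (r - 1)" for lam
    using S by (intro int_span_sum int_span_sign_mult) auto
  have sign: "to_wedge (r - 1) ((- 1) ^ j * x) = (- 1) ^ j * to_wedge (r - 1) x" for j x
    using additive_uminus[of "to_wedge (r - 1)", OF to_wedge_add_UNIV] by (cases "even j") auto
  have "to_wedge (r - 1) (\<Sum>j<r. (- 1) ^ j * S lam j) = contr k (bwedge r lam)" for lam
    unfolding bwedge_eq_bas_wedge contr_bas_wedge additive_sum[of "to_wedge (r - 1)", OF to_wedge_add_UNIV] sign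
    using S by (intro sum.cong) auto
  then show "to_wedge (r - 1) (F (int r - 1 - int k)) = contr k T"
    unfolding F_eq eq T_def
    by (simp only: pm_extend_hom[of "to_wedge (r - 1)", OF to_wedge_add_UNIV] pm_extend_hom[of "contr k", OF contr_add])
  show "F (int r - 1 - int k) \<in> schur_span (r - 1)"
    unfolding F_eq eq by (rule pm_extend_in_span) (rule span)
qed

lemma G_wedge:
  "G n \<in> schur_span (Suc r)"
  "to_wedge (Suc r) (G n) = T * bas (n + int r)"
proof -
  show "G n \<in> schur_span (Suc r)"
    unfolding G_eq
  proof (rule pm_extend_in_span)
    fix lam show "seq_det Hinf ((n + int r) # positions r lam) \<in> schur_span (Suc r)"
      using seq_det_in_schur_span[of "(n + int r) # positions r lam"] by simp
  qed
  have "to_wedge (Suc r) (seq_det Hinf ((n + int r) # positions r lam)) = bwedge r lam * bas (n + int r)" for lam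
    using seq_det_to_wedge(2)[of "(n + int r) # positions r lam"]
    by (simp add: bwedge_eq_bas_wedge bas_wedge_Cons)
  then show "to_wedge (Suc r) (G n) = T * bas (n + int r)"
    unfolding G_eq T_def
    by (simp only: pm_extend_hom[of "to_wedge (Suc r)", OF to_wedge_add_UNIV])
      (simp add: pm_extend_def sum_distrib_right mult.assoc)
qed

lemma G_eq_0: "n < - int r \<Longrightarrow> G n = 0"
  unfolding G_eq pm_extend_def by (intro sum.neutral) (auto intro!: seq_det_neg)

lemma residue_eq:
  "\<exists>K0. \<forall>K\<ge>K0. fls_residue (tens_fls (fps_to_fls Einf * poly_zinv (sigma_minus_B (pm_extend schur_inf c)))
      (fps_to_fls (fps_recip Einf) * poly_zinv (sigma_bar_minus_B (pm_extend schur_inf c)))) =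
    (\<Sum>k<K. tens (F (int r - 1 - int k)) (G (int k - int r)))"
proof -
  let ?f = "fps_to_fls Einf * poly_zinv (sigma_minus_B (pm_extend schur_inf c))"
  let ?g = "fps_to_fls (fps_recip Einf) * poly_zinv (sigma_bar_minus_B (pm_extend schur_inf c))"
  have fg: "fls_nth ?f = F" "fls_nth ?g = G" by (auto simp: F_def G_def laurent_coeff_def)
  define K0 where "K0 = nat (int r - fls_subdegree ?f)"
  have F0: "F i = 0" if "i < fls_subdegree ?f" for i
    using that fls_eq0_below_subdegree[of i ?f] by (simp add: fg)
  have "fls_residue (tens_fls ?f ?g) = (\<Sum>k<K. tens (F (int r - 1 - int k)) (G (int k - int r)))"
    if "K \<ge> K0" for K
  proof -
    let ?h = "\<lambda>k. int r - 1 - int k"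
    let ?S = "{i. F i \<noteq> 0 \<and> G (- 1 - i) \<noteq> 0}"
    have sub: "?S \<subseteq> ?h ` {..<K}"
    proof
      fix i assume i: "i \<in> ?S"
      then have "\<not> - 1 - i < - int r" using G_eq_0 by blast
      moreover have "\<not> i < fls_subdegree ?f" using i F0 by blast
      ultimately show "i \<in> ?h ` {..<K}"
        using that by (intro image_eqI[of _ _ "nat (int r - 1 - i)"]) (auto simp: K0_def)
    qed
    have "fls_residue (tens_fls ?f ?g) = (\<Sum>i\<in>?S. tens (F i) (G (- 1 - i)))"
      by (simp add: tens_fls_nth fg)
    also have "\<dots> = (\<Sum>i\<in>?h ` {..<K}. tens (F i) (G (- 1 - i)))"
      using sub by (intro sum.mono_neutral_left) auto
    also have "\<dots> = (\<Sum>k<K. tens (F (?h k)) (G (- 1 - ?h k)))"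
      by (subst sum.reindex) (auto simp: inj_on_def)
    finally show ?thesis by (simp add: algebra_simps)
  qed
  then show ?thesis by blast
qed

lemma T_wedge_power: "T \<in> wedge_power r"
  unfolding T_def wedge_power_eq_span int_span_def using c by blast

lemma T_mult_polar:
  "T * ext_incl (polar (pairing ks) K T) = (\<Sum>k<K. of_int (pairing ks (contr k T)) * (T * bas (int k)))"
proof -
  have "ext_incl (Poly_Mapping.single k d) = of_int d * bas (int k)" for k d
  proof -
    have "Poly_Mapping.single k d = frag_cmul d (Poly_Mapping.single k 1)"
      by (rule poly_mapping_eqI) (simp add: lookup_single when_def)
    then show ?thesis by (simp add: ext_incl_frag_cmul bas_def bvec_def)
  qed
  then show ?thesis
    by (simp add: polar_def ext_incl_sum sum_distrib_left mult_of_int_left)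
qed

lemma residue_zero_iff:
  "fls_residue (tens_fls (fps_to_fls Einf * poly_zinv (sigma_minus_B (pm_extend schur_inf c)))
      (fps_to_fls (fps_recip Einf) * poly_zinv (sigma_bar_minus_B (pm_extend schur_inf c)))) = 0 \<longleftrightarrow>
    T \<in> decomposable r" (is "?res = 0 \<longleftrightarrow> _")
proof
  obtain K0 where K0: "\<And>K. K \<ge> K0 \<Longrightarrow> ?res = (\<Sum>k<K. tens (F (int r - 1 - int k)) (G (int k - int r)))"
    using residue_eq by blast
  {
    assume zero: "?res = 0"
    show "T \<in> decomposable r"
    proof (rule plucker_imp_decomposable[OF T_wedge_power r])
      fix K ks assume "K \<ge> K0"
      then have "(\<Sum>k<K. tens (F (int r - 1 - int k)) (G (int k - int r))) = 0" using zero K0 by simp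
      then have "(\<Sum>k<K. of_int (pairing ks (to_wedge (r - 1) (F (int r - 1 - int k)))) *
          to_wedge (Suc r) (G (int k - int r))) = 0"
        by (rule sum_tens_biadditive[rotated 2])
          (simp_all add: to_wedge_add_UNIV pairing_add distrib_left distrib_right)
      then show "T * ext_incl (polar (pairing ks) K T) = 0"
        by (simp only: T_mult_polar F_wedge G_wedge diff_add_cancel)
    qed
  next
    assume "T \<in> decomposable r"
    then obtain ms where ms: "T = wedge ms" by (auto simp: decomposable_def)
    obtain K1 where K1: "(\<Union>m\<in>set ms. Poly_Mapping.keys m) \<subseteq> {..<K1}"
      using finite_nat_iff_bounded[of "\<Union>m\<in>set ms. Poly_Mapping.keys m"] by auto
    define K where "K = max K0 K1"
    have plucker: "T * ext_incl (polar (pairing ks) K T) = 0" for ks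
      unfolding ms by (intro wedge_mult_polar pairing_add) (use K1 in \<open>fastforce simp: K_def\<close>)
    have "\<forall>k. \<exists>d. F (int r - 1 - int k) = pm_extend schur_inf d \<and> Poly_Mapping.keys d \<subseteq> Par_le (r - 1)"
      using F_wedge(1) by (auto simp: int_span_def)
    then obtain d where d: "\<And>k. F (int r - 1 - int k) = pm_extend schur_inf (d k)"
      and keys_d: "\<And>k. Poly_Mapping.keys (d k) \<subseteq> Par_le (r - 1)" by metis
    have lookup_d: "Poly_Mapping.lookup (d k) mu = pairing (map nat (positions (r - 1) mu)) (contr k T)"
      if "mu \<in> Par_le (r - 1)" for k mu
      using pairing_coeff[OF keys_d that, of k] F_wedge(2)[of k] unfolding d to_wedge_pm_extend[OF keys_d] by simp
    define A where "A = (\<Union>k<K. Poly_Mapping.keys (d k))"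
    have A: "finite A" "A \<subseteq> Par_le (r - 1)" using keys_d by (auto simp: A_def)
    have "?res = (\<Sum>k<K. tens (F (int r - 1 - int k)) (G (int k - int r)))" by (rule K0) (simp add: K_def)
    also have "\<dots> = (\<Sum>k<K. \<Sum>mu\<in>A. tens (schur_inf mu) (of_int (Poly_Mapping.lookup (d k) mu) * G (int k - int r)))"
    proof (intro sum.cong refl)
      fix k assume "k \<in> {..<K}"
      then have "F (int r - 1 - int k) = (\<Sum>mu\<in>A. of_int (Poly_Mapping.lookup (d k) mu) * schur_inf mu)"
        unfolding d using A by (intro pm_extend_superset) (auto simp: A_def)
      then show "tens (F (int r - 1 - int k)) (G (int k - int r)) =
          (\<Sum>mu\<in>A. tens (schur_inf mu) (of_int (Poly_Mapping.lookup (d k) mu) * G (int k - int r)))"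
        by (simp add: tens_sum_left tens_of_int_mult)
    qed
    also have "\<dots> = (\<Sum>mu\<in>A. tens (schur_inf mu) (\<Sum>k<K. of_int (Poly_Mapping.lookup (d k) mu) * G (int k - int r)))"
      by (subst sum.swap) (simp add: tens_sum_right)
    also have "\<dots> = 0"
    proof (intro sum.neutral ballI)
      fix mu assume mu: "mu \<in> A"
      define y where "y = (\<Sum>k<K. of_int (Poly_Mapping.lookup (d k) mu) * G (int k - int r))"
      have "y \<in> schur_span (Suc r)" unfolding y_def by (intro int_span_sum int_span_of_int_mult G_wedge)
      moreover have "to_wedge (Suc r) y = (\<Sum>k<K. of_int (Poly_Mapping.lookup (d k) mu) * (T * bas (int k)))"
        by (simp add: y_def additive_sum[of "to_wedge (Suc r)", OF to_wedge_add_UNIV]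
            additive_of_int_mult[of "to_wedge (Suc r)", OF to_wedge_add_UNIV] G_wedge)
      moreover have "\<dots> = T * ext_incl (polar (pairing (map nat (positions (r - 1) mu))) K T)"
        using mu A(2) by (auto simp: T_mult_polar lookup_d intro!: sum.cong)
      ultimately have "y = 0" using plucker by (intro to_wedge_inject) auto
      then show "tens (schur_inf mu) (\<Sum>k<K. of_int (Poly_Mapping.lookup (d k) mu) * G (int k - int r)) = 0"
        by (simp add: y_def)
    qed
    finally show "?res = 0" .
  }
qed

end

lemma Bfin_eventually: "\<exists>s. \<forall>r\<ge>s. tau \<in> Bfin r"
proof -
  obtain s where s: "(\<Union>m\<in>Poly_Mapping.keys tau. Poly_Mapping.keys m) \<subseteq> {..<s}"
    using finite_nat_iff_bounded[of "\<Union>m\<in>Poly_Mapping.keys tau. Poly_Mapping.keys m"] by auto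
  then have "\<forall>r\<ge>s. tau \<in> Bfin r" unfolding Bfin_def by fastforce
  then show ?thesis by blast
qed

theorem theorem0p3:
  fixes tau :: Binf
  shows "fls_residue (tens_fls (fps_to_fls Einf * poly_zinv (sigma_minus_B tau))
                               (fps_to_fls (fps_recip Einf) * poly_zinv (sigma_bar_minus_B tau))) = 0
     \<longleftrightarrow> (\<exists>s::nat. \<forall>r\<ge>s. tau \<in> Bfin r \<and> phi r tau \<in> decomposable r)"
    (is "?res = 0 \<longleftrightarrow> ?R")
proof -
  have "tau \<in> int_span Par schur_inf" by (simp add: schur_inf_span)
  then obtain c where c: "tau = pm_extend schur_inf c" "Poly_Mapping.keys c \<subseteq> Par"
    by (auto simp: int_span_def)
  obtain R where R: "\<And>r. r \<ge> R \<Longrightarrow> Poly_Mapping.keys c \<subseteq> Par_le r \<and> phi r tau = pm_extend (bwedge r) c"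
    using phi_eventually[OF c(2)] c(1) by blast
  obtain s0 where s0: "\<And>r. r \<ge> s0 \<Longrightarrow> tau \<in> Bfin r" using Bfin_eventually by blast
  have iff: "?res = 0 \<longleftrightarrow> phi r tau \<in> decomposable r" if "r \<ge> Suc R" for r
    using residue_zero_iff[of c r] R[of r] that by (simp add: c(1))
  show ?thesis
  proof
    assume "?res = 0"
    then show ?R using iff s0 by (intro exI[of _ "max s0 (Suc R)"]) auto
  next
    assume ?R
    then obtain s where "\<forall>r\<ge>s. tau \<in> Bfin r \<and> phi r tau \<in> decomposable r" by blast
    then have "phi (max s (Suc R)) tau \<in> decomposable (max s (Suc R))" by simp
    then show "?res = 0" using iff[of "max s (Suc R)"] by simp
  qed
qed


end
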